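(* Let $r\ge 2$ be a natural number, let $k$ be a fixed integer, and let $\varepsilon>0$ be an arbitrary small positive number. Then for all sufficiently large real numbers $H$ the following hold, with implied constants depending at most on $k$, $r$ and $\varepsilon$. (i) If $k\neq 0$, then $$R(H,r,k)=\prod_p\left(1-\frac{\lambda(p^r;k)}{p^{3r}}\right)H^3+O\left(H^{2}+H^{\frac32+\frac{3}{2r}+\varepsilon}\right).$$ (ii) If $k=0$, then $$R(H,r,0)=\prod_p\left(1-\frac{\lambda(p^r;0)}{p^{3r}}\right)H^3+O\left(H^{2+\varepsilon}+H^{\frac{9r}{5r-2}+\varepsilon}\right).$$ Here the products run over all primes $p$.
   Context: An integer $n$ is called $r$-free if $p^r\nmid n$ for all primes $p$ (so $0$ is not $r$-free; negative integers are allowed). $R(H,r,k)$ denotes the number of triples of integers $(x,y,z)$ with $1\le x,y,z\le H$ such that $x^2+y^2+z^2+k$ is $r$-free. For a positive integer $q$, $\lambda(q;k)$ denotes the number of integer triples $(x,y,z)$ with $1\le x,y,z\le q$ and $x^2+y^2+z^2+k\equiv 0\pmod q$. *)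

theory Defs
  imports "HOL-Analysis.Analysis" "HOL-Number_Theory.Cong" "HOL-Computational_Algebra.Primes"
    "HOL-Library.Landau_Symbols"
begin

definition r_free :: "nat \<Rightarrow> int \<Rightarrow> bool" where
  "r_free r n \<longleftrightarrow> (\<forall>p::nat. prime p \<longrightarrow> \<not> int p ^ r dvd n)"

definition R :: "real \<Rightarrow> nat \<Rightarrow> int \<Rightarrow> nat" where
  "R H r k = card {(x :: int, y :: int, z :: int).
     1 \<le> x \<and> real_of_int x \<le> H \<and> 1 \<le> y \<and> real_of_int y \<le> H \<and> 1 \<le> z \<and> real_of_int z \<le> H \<and>
     r_free r (x\<^sup>2 + y\<^sup>2 + z\<^sup>2 + k)}"

definition lam :: "nat \<Rightarrow> int \<Rightarrow> nat" where
  "lam q k = card {(x :: int, y :: int, z :: int).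
     x \<in> {1..int q} \<and> y \<in> {1..int q} \<and> z \<in> {1..int q} \<and>
     [x\<^sup>2 + y\<^sup>2 + z\<^sup>2 + k = 0] (mod int q)}"

text \<open>The product over all primes is an infinite product over the natural numbers, in increasing
  order, in which every index that is not prime contributes the factor 1.\<close>

definition local_factor :: "nat \<Rightarrow> int \<Rightarrow> nat \<Rightarrow> real" where
  "local_factor r k p =
     (if prime p then 1 - real (lam (p ^ r) k) / real p ^ (3 * r) else 1)"

end

theory Submission
  imports Defs "HOL-Number_Theory.Modular_Inverse"
begin

text \<open>
  By Moebius inversion, counting \<open>r\<close>-free values reduces to counting the points of the cube at which
  \<open>q = d^r\<close> divides \<open>x\<^sup>2 + y\<^sup>2 + z\<^sup>2 + k\<close>, for squarefree \<open>d\<close>. For \<open>d > D\<close> one bounds this count by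
  choosing \<open>x\<close> and the cofactor: what is left is a sum of two squares, with few representations.
  For \<open>d \<le> D\<close> one completes the sums. The Fourier coefficients
  \<open>S(q; u, v, w) = \<Sum> e((u x + v y + w z) / q)\<close>, summed over the solutions of the congruence modulo \<open>q\<close>, are
  multiplicative in \<open>q\<close>, and for prime powers they are sums of products of three Gauss sums over a unit \<open>t\<close>.
  Their phase is \<open>k t - (u\<^sup>2 + v\<^sup>2 + w\<^sup>2) / (4 t)\<close>; for \<open>k \<noteq> 0\<close> stationary phase gives square root
  cancellation, for \<open>k = 0\<close> the sum essentially vanishes unless a large \<open>e\<close> divides \<open>u\<^sup>2 + v\<^sup>2 + w\<^sup>2\<close>.
  Such frequencies are rare: given \<open>u\<close> and \<open>v\<close>, the possible \<open>w\<close> lie in few residue classes to moduli at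
  least \<open>sqrt e\<close>. Hence the total error for one \<open>q\<close> is, up to \<open>q\<^sup>\<epsilon>\<close>, at most \<open>H\<^sup>2 sqrt d / q + q\<close>, with an
  additional factor \<open>sqrt d\<close> in the second term if \<open>k = 0\<close> and \<open>r > 2\<close>.
\<close>

section \<open>Complete exponential sums\<close>

text \<open>Fourier coefficients can exceed square root size, and by how much depends on the
  frequency, so a supremum would be useless. Each is bounded, up to one constant per prime, by
  \<open>q * g * sqrt (e * l)\<close>, where \<open>g\<close> divides \<open>u\<close>,
  \<open>v\<close>, \<open>w\<close> and \<open>g^2 * e\<close> divides the sum of their squares:
  \<open>g\<close> and \<open>e\<close> are repaid when the frequencies are summed. Only
  \<open>l\<close>, which divides \<open>d\<close>, can remain unpaid. At \<open>p^s\<close> a loss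
  \<open>l = p\<close> comes from \<open>s = 1\<close>, or from \<open>k = 0\<close> and
  \<open>s \<ge> 3\<close>. Since \<open>r \<ge> 2\<close>, level 1 is reached only after common
  factors \<open>p\<close> have been split off, and then \<open>l\<close> divides \<open>g\<close>.
  So unpaid losses are confined to \<open>k = 0\<close>, \<open>r \<ge> 3\<close>, where they are
  affordable: the error stays within the claimed exponent for \<open>r = 3\<close> and within
  \<open>H^2\<close> for \<open>r \<ge> 4\<close>, up to an arbitrarily small power of
  \<open>H\<close>. For \<open>r = 2\<close> no cut-off would reach the exponent 9/4 with such a
  loss (balancing gives 7/3), hence the separate treatment of the modulus \<open>p^2\<close>. Points
  where the form takes the value 0 are divisible by every \<open>q\<close>; they are not
  \<open>r\<close>-free, their number is bounded in terms of \<open>k\<close>, and they are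
  discarded before Moebius inversion.\<close>

definition ee :: "int \<Rightarrow> int \<Rightarrow> complex" where
  "ee q n = cis (2 * pi * (of_int n / of_int q))"

lemma ee_0 [simp]: "ee q 0 = 1"
  by (simp add: ee_def)

lemma ee_add: "ee q (a + b) = ee q a * ee q b"
  by (simp add: ee_def cis_mult add_divide_distrib ring_distribs)

lemma norm_ee [simp]: "norm (ee q n) = 1"
  by (simp add: ee_def)

lemma cnj_ee: "cnj (ee q n) = ee q (- n)"
  by (simp add: ee_def cis_cnj)

lemma ee_mult_cancel: "c \<noteq> 0 \<Longrightarrow> ee (c * q) (c * n) = ee q n"
  by (simp add: ee_def)

lemma ee_dvd: "q dvd n \<Longrightarrow> ee q n = 1"
  by (cases "q = 0") (auto simp: ee_def dvd_def cis_multiple_2pi simp del: mult.assoc simp flip: mult.assoc)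

lemma ee_cong: "[a = b] (mod q) \<Longrightarrow> ee q a = ee q b"
  using ee_add[of q b "a - b"] ee_dvd[of q "a - b"] by (simp add: cong_iff_dvd_diff)

lemma ee_eq_1_iff:
  assumes "q > 0"
  shows "ee q n = 1 \<longleftrightarrow> q dvd n"
proof
  assume "ee q n = 1"
  then obtain m :: int where "2 * pi * (of_int n / of_int q) = of_int m * (2 * pi)"
    unfolding ee_def cis_conv_exp by (auto simp: exp_eq_1)
  hence "real_of_int n = of_int m * of_int q"
    using assms by (simp add: field_simps)
  hence "n = m * q" by (metis of_int_eq_iff of_int_mult)
  thus "q dvd n" by simp
qed (rule ee_dvd)

section \<open>Sums over complete residue systems\<close>

definition periodic :: "int \<Rightarrow> (int \<Rightarrow> 'a) \<Rightarrow> bool" where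
  "periodic q f \<longleftrightarrow> (\<forall>x y. [x = y] (mod q) \<longrightarrow> f x = f y)"

lemma periodicD: "periodic q f \<Longrightarrow> [x = y] (mod q) \<Longrightarrow> f x = f y"
  by (auto simp: periodic_def)

lemma sum_reindex_mod:
  assumes "q > 0" "periodic q f" "\<And>x y. [g x = g y] (mod q) \<Longrightarrow> [x = y] (mod q)"
  shows "(\<Sum>x=0..<q. f (g x)) = (\<Sum>x=0..<q. f x)"
proof -
  have inj: "inj_on (\<lambda>x. g x mod q) {0..<q}"
  proof (rule inj_onI)
    fix x y assume xy: "x \<in> {0..<q}" "y \<in> {0..<q}" "g x mod q = g y mod q"
    hence "[g x = g y] (mod q)" by (simp add: cong_def)
    hence "[x = y] (mod q)" by (rule assms(3))
    thus "x = y" using xy by (simp add: cong_def)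
  qed
  have "(\<lambda>x. g x mod q) ` {0..<q} = {0..<q}"
    by (rule endo_inj_surj) (use inj assms(1) in auto)
  hence bij: "bij_betw (\<lambda>x. g x mod q) {0..<q} {0..<q}"
    using inj by (auto simp: bij_betw_def)
  have "(\<Sum>x=0..<q. f (g x)) = (\<Sum>x=0..<q. f (g x mod q))"
    by (intro sum.cong refl periodicD[OF assms(2)]) (simp add: cong_def)
  also have "\<dots> = (\<Sum>x=0..<q. f x)"
    by (rule sum.reindex_bij_betw[OF bij])
  finally show ?thesis .
qed

lemma sum_shift_mod:
  assumes "q > 0" "periodic q f"
  shows "(\<Sum>x=0..<q. f (x + a)) = (\<Sum>x=0..<q. f x)"
  by (rule sum_reindex_mod[OF assms]) (metis cong_add_rcancel)

lemma sum_scale_mod: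
  assumes "q > 0" "periodic q f" "coprime c q"
  shows "(\<Sum>x=0..<q. f (c * x)) = (\<Sum>x=0..<q. f x)"
  by (rule sum_reindex_mod[OF assms(1,2)]) (use assms(3) cong_mult_lcancel in blast)

lemma sum_translate_mod:
  assumes "q > 0" "periodic q f"
  shows "(\<Sum>x\<in>{a..<a+q}. f x) = (\<Sum>x=0..<q. f x)"
proof -
  have "(\<Sum>x\<in>{a..<a+q}. f x) = (\<Sum>x=0..<q. f (x + a))"
    by (rule sum.reindex_bij_witness[of _ "\<lambda>x. x + a" "\<lambda>x. x - a"]) auto
  thus ?thesis using sum_shift_mod[OF assms] by simp
qed

lemma sum_split_mod:
  fixes f :: "int \<Rightarrow> 'a :: comm_monoid_add"
  assumes "a > 0" "b > 0"
  shows "(\<Sum>x=0..<a*b. f x) = (\<Sum>i=0..<a. \<Sum>j=0..<b. f (i + a * j))"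
proof -
  have le: "i + a * j < a * b" if "0 \<le> i" "i < a" "0 \<le> j" "j < b" for i j
  proof -
    have "a * (j + 1) \<le> a * b" using assms that by (intro mult_left_mono) auto
    thus ?thesis using that by (simp add: algebra_simps)
  qed
  have d: "x div a < b" if "0 \<le> x" "x < a * b" for x
  proof (rule ccontr)
    assume "\<not> ?thesis"
    hence "a * b \<le> a * (x div a)" using assms by (intro mult_left_mono) auto
    also have "\<dots> \<le> x" using assms by (simp add: minus_mod_eq_mult_div [symmetric])
    finally show False using that by simp
  qed
  have "(\<Sum>x=0..<a*b. f x) = (\<Sum>(i,j)\<in>{0..<a}\<times>{0..<b}. f (i + a * j))"
    by (rule sum.reindex_bij_witness[of _ "\<lambda>(i,j). i + a * j" "\<lambda>x. (x mod a, x div a)"])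
       (use assms le d in \<open>auto simp: pos_imp_zdiv_nonneg_iff\<close>)
  thus ?thesis by (simp add: sum.cartesian_product)
qed

text \<open>The pairs \<open>(i, j)\<close> are listed as the digits \<open>x mod a\<close> and
  \<open>x div a\<close> of one \<open>x\<close> below \<open>a * b\<close>. It remains to see that
  \<open>b * (x mod a) + a * (x div a)\<close> is injective modulo \<open>a * b\<close>: modulo
  \<open>a\<close> it determines the first digit, and then the second term determines the
  rest.\<close>

lemma sum_crt:
  fixes f :: "int \<Rightarrow> 'a :: comm_monoid_add"
  assumes "a > 0" "b > 0" "coprime a b" "periodic (a*b) f"
  shows "(\<Sum>x=0..<a*b. f x) = (\<Sum>i=0..<a. \<Sum>j=0..<b. f (b * i + a * j))"
proof -
  have "(\<Sum>i=0..<a. \<Sum>j=0..<b. f (b * i + a * j)) =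
        (\<Sum>i=0..<a. \<Sum>j=0..<b. f (b * ((i + a * j) mod a) + a * ((i + a * j) div a)))"
    using assms by (intro sum.cong refl) auto
  also have "\<dots> = (\<Sum>x=0..<a*b. f (b * (x mod a) + a * (x div a)))"
    by (rule sum_split_mod[OF assms(1,2), symmetric])
  also have "\<dots> = (\<Sum>x=0..<a*b. f x)"
  proof (rule sum_reindex_mod[OF _ assms(4)])
    fix x y assume xy: "[b * (x mod a) + a * (x div a) = b * (y mod a) + a * (y div a)] (mod a * b)"
    hence "[b * (x mod a) + a * (x div a) = b * (y mod a) + a * (y div a)] (mod a)"
      by (rule cong_modulus_mult)
    hence "[b * (x mod a) = b * (y mod a)] (mod a)"
      by (simp add: cong_def)
    hence "[x mod a = y mod a] (mod a)"
      using assms(3) cong_mult_lcancel coprime_commute by blast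
    hence m: "x mod a = y mod a" by (simp add: cong_def)
    with xy have "[a * (x div a) = a * (y div a)] (mod a * b)"
      by (simp add: cong_add_lcancel)
    hence "[x mod a + a * (x div a) = y mod a + a * (y div a)] (mod a * b)"
      unfolding m by (intro cong_add cong_refl)
    thus "[x = y] (mod a * b)" by (simp only: mod_mult_div_eq)
  qed (use assms in auto)
  finally show ?thesis by simp
qed

lemma periodic_ee: "periodic q (\<lambda>x. ee q (a * x + b))"
  unfolding periodic_def by (intro allI impI ee_cong cong_add cong_mult) auto

lemma sum_ee:
  assumes "q > 0"
  shows "(\<Sum>t=0..<q. ee q (t * n)) = (if q dvd n then of_int q else 0)"
proof (cases "q dvd n")
  case True
  thus ?thesis using assms by (simp add: ee_dvd)
next
  case False
  have "(\<Sum>t=0..<q. ee q (n * (t + 1) + 0)) = (\<Sum>t=0..<q. ee q (n * t + 0))"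
    by (rule sum_shift_mod[OF assms periodic_ee])
  hence "ee q n * (\<Sum>t=0..<q. ee q (t * n)) = (\<Sum>t=0..<q. ee q (t * n))"
    by (simp add: algebra_simps ee_add sum_distrib_left)
  hence "(ee q n - 1) * (\<Sum>t=0..<q. ee q (t * n)) = 0" by (simp add: algebra_simps)
  thus ?thesis using False ee_eq_1_iff[OF assms, of n] by simp
qed

section \<open>Fourier coefficients of the congruence and quadratic Gauss sums\<close>

definition quad_sum :: "int \<Rightarrow> int \<Rightarrow> int \<Rightarrow> int \<Rightarrow> int \<Rightarrow> complex" where
  "quad_sum q k u v w = (\<Sum>x=0..<q. \<Sum>y=0..<q. \<Sum>z=0..<q.
     if q dvd x^2 + y^2 + z^2 + k then ee q (u * x + v * y + w * z) else 0)"

definition gauss_sum :: "int \<Rightarrow> int \<Rightarrow> int \<Rightarrow> complex" where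
  "gauss_sum q t u = (\<Sum>x=0..<q. ee q (t * x^2 + u * x))"

lemma sum_swap4:
  "(\<Sum>t\<in>A. \<Sum>x\<in>B. \<Sum>y\<in>C. \<Sum>z\<in>D. f t x y z) =
   (\<Sum>x\<in>B. \<Sum>y\<in>C. \<Sum>z\<in>D. \<Sum>t\<in>A. f t x y z)"
proof -
  have "(\<Sum>t\<in>A. \<Sum>x\<in>B. \<Sum>y\<in>C. \<Sum>z\<in>D. f t x y z) = (\<Sum>x\<in>B. \<Sum>t\<in>A. \<Sum>y\<in>C. \<Sum>z\<in>D. f t x y z)"
    by (rule sum.swap)
  also have "\<dots> = (\<Sum>x\<in>B. \<Sum>y\<in>C. \<Sum>t\<in>A. \<Sum>z\<in>D. f t x y z)"
    by (rule sum.cong[OF refl], rule sum.swap)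
  also have "\<dots> = (\<Sum>x\<in>B. \<Sum>y\<in>C. \<Sum>z\<in>D. \<Sum>t\<in>A. f t x y z)"
    by (rule sum.cong[OF refl], rule sum.cong[OF refl], rule sum.swap)
  finally show ?thesis .
qed

text \<open>The congruence is detected by summing additive characters over all \<open>t\<close>; for
  fixed \<open>t\<close> the three variables separate.\<close>

lemma quad_sum_eq_gauss:
  assumes "q > 0"
  shows "of_int q * quad_sum q k u v w = (\<Sum>t=0..<q. ee q (t * k) * gauss_sum q t u * gauss_sum q t v
      * gauss_sum q t w)"
proof -
  let ?Q = "{0..<q}"
  have "(\<Sum>t\<in>?Q. ee q (t * k) * gauss_sum q t u * gauss_sum q t v * gauss_sum q t w) =
     (\<Sum>t\<in>?Q. \<Sum>x\<in>?Q. \<Sum>y\<in>?Q. \<Sum>z\<in>?Q. ee q (t * k) * ee q (t * x^2 + u * x) *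
        ee q (t * y^2 + v * y) * ee q (t * z^2 + w * z))"
    unfolding gauss_sum_def
    by (intro sum.cong refl) (simp only: mult.assoc sum_distrib_right, simp only: sum_distrib_left)
  also have "\<dots> = (\<Sum>t\<in>?Q. \<Sum>x\<in>?Q. \<Sum>y\<in>?Q. \<Sum>z\<in>?Q.
       ee q (u * x + v * y + w * z) * ee q (t * (x^2 + y^2 + z^2 + k)))"
    by (intro sum.cong refl) (simp only: ee_add [symmetric], simp add: algebra_simps)
  also have "\<dots> = (\<Sum>x\<in>?Q. \<Sum>y\<in>?Q. \<Sum>z\<in>?Q. \<Sum>t\<in>?Q.
       ee q (u * x + v * y + w * z) * ee q (t * (x^2 + y^2 + z^2 + k)))"
    by (rule sum_swap4)
  also have "\<dots> = of_int q * quad_sum q k u v w"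
    unfolding quad_sum_def sum_distrib_left [symmetric] sum_ee[OF assms]
    by (simp add: sum_distrib_left if_distrib mult.commute cong: if_cong)
  finally show ?thesis by simp
qed

text \<open>Weyl differencing: after \<open>x = h + c\<close> the terms quadratic in
  \<open>c\<close> cancel, and the sum over \<open>c\<close> vanishes unless \<open>q\<close>
  divides \<open>2 * t * h\<close>. Oddness of \<open>q\<close> and coprimality leave only
  \<open>h = 0\<close>.\<close>

lemma norm_gauss_sum_square:
  assumes "q > 0" "odd q" "coprime t q"
  shows "(norm (gauss_sum q t u))^2 = real_of_int q"
proof -
  let ?Q = "{0..<q}"
  have "of_real ((norm (gauss_sum q t u))^2) = gauss_sum q t u * cnj (gauss_sum q t u)"
    by (simp only: complex_norm_square)
  also have "\<dots> = (\<Sum>c\<in>?Q. \<Sum>x\<in>?Q. ee q (t * x^2 + u * x) * ee q (- (t * c^2 + u * c)))"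
    unfolding gauss_sum_def cnj_sum sum_product cnj_ee by (rule sum.swap)
  also have "\<dots> = (\<Sum>c\<in>?Q. \<Sum>h\<in>?Q. ee q (t * (h+c)^2 + u * (h+c)) * ee q (- (t * c^2 + u * c)))"
  proof (rule sum.cong[OF refl])
    fix c
    have "periodic q (\<lambda>x. ee q (t * x^2 + u * x) * ee q (- (t * c^2 + u * c)))"
      unfolding periodic_def
      by (auto intro!: ee_cong cong_add cong_mult cong_pow)
    from sum_shift_mod[OF assms(1) this, of c]
    show "(\<Sum>x\<in>?Q. ee q (t * x^2 + u * x) * ee q (- (t * c^2 + u * c))) =
      (\<Sum>h\<in>?Q. ee q (t * (h+c)^2 + u * (h+c)) * ee q (- (t * c^2 + u * c)))" by simp
  qed
  also have "\<dots> = (\<Sum>c\<in>?Q. \<Sum>h\<in>?Q. ee q (t * h^2 + u * h) * ee q (c * (2 * t * h)))"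
    by (intro sum.cong refl) (simp only: ee_add [symmetric], simp add: algebra_simps power2_eq_square)
  also have "\<dots> = (\<Sum>h\<in>?Q. ee q (t * h^2 + u * h) * (\<Sum>c\<in>?Q. ee q (c * (2 * t * h))))"
    by (subst sum.swap) (simp add: sum_distrib_left)
  also have "\<dots> = (\<Sum>h\<in>?Q. if h = 0 then of_int q else 0)"
  proof (rule sum.cong[OF refl])
    fix h assume h: "h \<in> ?Q"
    have "coprime q (2 * t)" using assms by (simp add: coprime_commute)
    hence "q dvd 2 * t * h \<longleftrightarrow> q dvd h" by (rule coprime_dvd_mult_right_iff)
    also have "\<dots> \<longleftrightarrow> h = 0" using h by (auto dest: zdvd_imp_le)
    finally show "ee q (t * h^2 + u * h) * (\<Sum>c\<in>?Q. ee q (c * (2 * t * h))) =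
        (if h = 0 then of_int q else 0)"
      by (simp add: sum_ee[OF assms(1)])
  qed
  also have "\<dots> = of_int q" using assms(1) by simp
  finally show ?thesis by (metis of_real_eq_iff of_real_of_int_eq)
qed

text \<open>Shifting by \<open>2 * i * u\<close> completes the square: \<open>i\<close> inverts
  \<open>4 * t\<close>, so the linear term is \<open>u * x\<close> and the constant left over is
  \<open>i * u^2\<close>.\<close>

lemma gauss_sum_complete_square:
  assumes "q > 0" "[4 * t * i = 1] (mod q)"
  shows "gauss_sum q t u = ee q (- (i * u^2)) * gauss_sum q t 0"
proof -
  have per: "periodic q (\<lambda>x. ee q (t * x^2))"
    unfolding periodic_def by (auto intro!: ee_cong cong_add cong_mult cong_pow)
  have "gauss_sum q t u = (\<Sum>x=0..<q. ee q (- (i * u^2)) * ee q (t * (x + 2 * i * u)^2))"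
    unfolding gauss_sum_def
  proof (intro sum.cong refl, subst ee_add [symmetric], rule ee_cong)
    fix x
    have "[- (i * u^2) + t * (x + 2 * i * u)^2 = t * x^2 + (4 * t * i) * (u * x) + (4 * t * i - 1) * (i
        * u^2)] (mod q)"
      by (simp add: algebra_simps power2_eq_square)
    also have "[t * x^2 + (4 * t * i) * (u * x) + (4 * t * i - 1) * (i * u^2) = t * x^2 + 1 * (u * x)
        + (1 - 1) * (i * u^2)] (mod q)"
      by (intro cong_add cong_mult cong_diff assms cong_refl)
    finally show "[t * x^2 + u * x = - (i * u^2) + t * (x + 2 * i * u)^2] (mod q)"
      by (simp add: cong_sym)
  qed
  thus ?thesis using sum_shift_mod[OF assms(1) per, of "2 * i * u"]
    by (simp add: gauss_sum_def sum_distrib_left [symmetric])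
qed

section \<open>Prime power moduli\<close>

lemma odd_prime_not_dvd_2: "prime (p::int) \<Longrightarrow> odd p \<Longrightarrow> \<not> p dvd 2"
  using prime_ge_2_int[of p] by (auto dest!: zdvd_imp_le)

lemma coprime_prime_power_iff:
  assumes "prime (p::int)" "r > 0"
  shows "coprime t (p ^ r) \<longleftrightarrow> \<not> p dvd t"
  using assms by (metis coprime_commute coprime_power_right_iff coprime_absorb_left not_prime_unit
      prime_imp_coprime not_gr_zero)

lemma gauss_sum_cong: "[t = t'] (mod q) \<Longrightarrow> gauss_sum q t u = gauss_sum q t' u"
  unfolding gauss_sum_def by (intro sum.cong refl ee_cong cong_add cong_mult) auto

text \<open>Substitution of \<open>s * x\<close> for \<open>x\<close>. The Gauss sum ignores square
  factors of \<open>t\<close>, which is why the averages below use square multipliers.\<close>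

lemma gauss_sum_mult_square:
  assumes "q > 0" "coprime s q"
  shows "gauss_sum q (s^2 * t) 0 = gauss_sum q t 0"
proof -
  have per: "periodic q (\<lambda>x. ee q (t * x^2 + 0 * x))"
    unfolding periodic_def by (auto intro!: ee_cong cong_add cong_mult cong_pow)
  have "gauss_sum q (s^2 * t) 0 = (\<Sum>x=0..<q. ee q (t * (s * x)^2 + 0 * (s * x)))"
    unfolding gauss_sum_def by (intro sum.cong refl arg_cong2[of _ _ _ _ ee]) (simp add: power_mult_distrib)
  also have "\<dots> = gauss_sum q t 0"
    unfolding gauss_sum_def by (rule sum_scale_mod[OF assms(1) per assms(2)])
  finally show ?thesis .
qed

text \<open>Reducing \<open>4 * t\<close> modulo \<open>q\<close> before inverting makes congruent
  arguments give equal values, so that sums over \<open>t\<close> are sums of a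
  \<open>periodic\<close> function.\<close>

definition inv4 :: "int \<Rightarrow> int \<Rightarrow> int" where
  "inv4 q t = modular_inverse q ((4 * t) mod q)"

lemma inv4_cong_1:
  assumes "q > 0" "odd q" "coprime t q"
  shows "[4 * t * inv4 q t = 1] (mod q)"
proof -
  have "coprime (2 * (2 * t)) q" using assms by (simp only: coprime_mult_left_iff) simp
  hence "coprime (4 * t) q" by simp
  hence "coprime ((4 * t) mod q) q" using assms by simp
  from cong_modular_inverse1[OF this] show ?thesis
    by (simp add: inv4_def cong_def mod_mult_left_eq)
qed

lemma inv4_not_dvd:
  assumes "q > 0" "odd q" "coprime t q" "prime p" "p dvd q"
  shows "\<not> p dvd inv4 q t"
proof
  assume "p dvd inv4 q t"
  hence "p dvd 4 * t * inv4 q t" by simp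
  moreover have "[4 * t * inv4 q t = 1] (mod p)"
    using inv4_cong_1[OF assms(1-3)] assms(5) by (rule cong_dvd_modulus)
  ultimately have "p dvd 1" using cong_dvd_iff by blast
  thus False using assms(4) not_prime_unit by blast
qed

lemma inv4_cong: "[t = t'] (mod q) \<Longrightarrow> inv4 q t = inv4 q t'"
  unfolding inv4_def by (metis cong_def cong_scalar_left)

section \<open>The contribution of the units modulo a prime power\<close>

definition unit_sum :: "int \<Rightarrow> int \<Rightarrow> int \<Rightarrow> int \<Rightarrow> int \<Rightarrow> complex" where
  "unit_sum q k u v w = (\<Sum>t=0..<q. if coprime t q then
     ee q (t * k) * gauss_sum q t u * gauss_sum q t v * gauss_sum q t w else 0)"

lemma norm_gauss_sum:
  assumes "q > 0" "odd q" "coprime t q"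
  shows "norm (gauss_sum q t u) = sqrt (real_of_int q)"
  using norm_gauss_sum_square[OF assms, of u] by (metis norm_ge_zero real_sqrt_unique)

lemma norm_unit_sum_le:
  assumes "q > 0" "odd q"
  shows "norm (unit_sum q k u v w) \<le> real_of_int q * sqrt q ^ 3"
proof -
  have "norm (unit_sum q k u v w) \<le> (\<Sum>t=0..<q. sqrt (real_of_int q) ^ 3)"
    unfolding unit_sum_def
    by (rule sum_norm_le) (auto simp: norm_mult norm_gauss_sum[OF assms] power3_eq_cube)
  thus ?thesis using assms by simp
qed

lemma unit_sum_eq_phase:
  assumes "q > 0" "odd q" "F = u^2 + v^2 + w^2"
  shows "unit_sum q k u v w = (\<Sum>t=0..<q. if coprime t q then
     gauss_sum q t 0 ^ 3 * ee q (k * t - inv4 q t * F) else 0)"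
  unfolding unit_sum_def
proof (intro sum.cong refl if_cong)
  fix t assume "coprime t q"
  note i = inv4_cong_1[OF assms(1,2) this]
  have "ee q (k * t - inv4 q t * F) =
     ee q (t * k) * ee q (- (inv4 q t * u^2)) * ee q (- (inv4 q t * v^2)) * ee q (- (inv4 q t * w^2))"
    unfolding assms(3) ee_add [symmetric] by (simp add: algebra_simps)
  thus "ee q (t * k) * gauss_sum q t u * gauss_sum q t v * gauss_sum q t w = gauss_sum q t 0 ^ 3
      * ee q (k * t - inv4 q t * F)"
    unfolding gauss_sum_complete_square[OF assms(1) i, of u] gauss_sum_complete_square[OF assms(1) i, of v]
      gauss_sum_complete_square[OF assms(1) i, of w]
    by (simp add: power3_eq_cube mult_ac)
qed

text \<open>\<open>\<sigma>\<close> has to invert \<open>a\<close> only after multiplication by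
  \<open>F\<close>. A truncated expansion of the inverse therefore suffices, and it may stop earlier
  when \<open>F\<close> is divisible by a power of the prime.\<close>

lemma inv4_mult:
  assumes "q > 0" "odd q" "coprime t q" "coprime a q" "[a * \<sigma> * F = F] (mod q)"
  shows "[inv4 q (a * t) * F = inv4 q t * \<sigma> * F] (mod q)"
proof -
  define i where "i = inv4 q (a * t)"
  define j where "j = inv4 q t"
  have 1: "[4 * (a * t) * i = 1] (mod q)" unfolding i_def
    by (rule inv4_cong_1) (use assms in auto)
  have 2: "[4 * t * j = 1] (mod q)" unfolding j_def by (rule inv4_cong_1) (use assms in auto)
  have "[i * F = i * (a * \<sigma> * F)] (mod q)"
    by (intro cong_mult cong_refl cong_sym[OF assms(5)])
  also have "i * (a * \<sigma> * F) = 1 * (i * a * \<sigma> * F)" by simp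
  also have "[\<dots> = (4 * t * j) * (i * a * \<sigma> * F)] (mod q)"
    by (intro cong_mult cong_refl cong_sym[OF 2])
  also have "(4 * t * j) * (i * a * \<sigma> * F) = (4 * (a * t) * i) * (j * \<sigma> * F)" by simp
  also have "[\<dots> = 1 * (j * \<sigma> * F)] (mod q)"
    by (intro cong_mult cong_refl 1)
  finally show ?thesis by (simp add: i_def j_def)
qed

lemma periodic_phase:
  "periodic q (\<lambda>t. if coprime t q then gauss_sum q t 0 ^ 3 * ee q (k * t - inv4 q t * F) else 0)"
  unfolding periodic_def
proof (intro allI impI if_cong)
  fix x y assume xy: "[x = y] (mod q)"
  show "coprime x q = coprime y q" using xy
    by (metis cong_imp_coprime cong_sym)
  show "gauss_sum q x 0 ^ 3 * ee q (k * x - inv4 q x * F) = gauss_sum q y 0 ^ 3 * ee q (k * y - inv4 q y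
      * F)"
    unfolding inv4_cong[OF xy] gauss_sum_cong[OF xy]
    by (intro arg_cong2[of _ _ _ _ "(*)"] refl ee_cong cong_diff cong_mult xy cong_refl)
qed simp

text \<open>The units are permuted by \<open>t\<close> to \<open>s^2 * t\<close> and the cubed Gauss
  sum does not notice. Only the phase moves: its first term by \<open>s^2\<close>, its second by
  \<open>\<sigma>\<close>, the inverse of \<open>s^2\<close> on multiples of
  \<open>F\<close>.\<close>

lemma unit_sum_twist:
  assumes "q > 0" "odd q" "F = u^2 + v^2 + w^2" "coprime s q" "[s^2 * \<sigma> * F = F] (mod q)"
  shows "unit_sum q k u v w = (\<Sum>t=0..<q. if coprime t q then
     gauss_sum q t 0 ^ 3 * ee q (k * s^2 * t - inv4 q t * \<sigma> * F) else 0)"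
proof -
  have cop: "coprime (s^2) q" using assms(4) by simp
  have "unit_sum q k u v w = (\<Sum>t=0..<q. if coprime (s^2 * t) q then
     gauss_sum q (s^2 * t) 0 ^ 3 * ee q (k * (s^2 * t) - inv4 q (s^2 * t) * F) else 0)"
    unfolding unit_sum_eq_phase[OF assms(1-3)]
    by (rule sum_scale_mod[OF assms(1) periodic_phase cop, symmetric])
  also have "\<dots> = (\<Sum>t=0..<q. if coprime t q then
     gauss_sum q t 0 ^ 3 * ee q (k * s^2 * t - inv4 q t * \<sigma> * F) else 0)"
  proof (intro sum.cong refl if_cong)
    fix t
    show "coprime (s^2 * t) q = coprime t q" using cop by simp
    assume t: "coprime t q"
    have "ee q (k * (s^2 * t) - inv4 q (s^2 * t) * F) = ee q (k * s^2 * t - inv4 q t * \<sigma> * F)"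
      by (intro ee_cong cong_diff inv4_mult assms t cop) (simp add: mult.assoc)
    thus "gauss_sum q (s^2 * t) 0 ^ 3 * ee q (k * (s^2 * t) - inv4 q (s^2 * t) * F) =
      gauss_sum q t 0 ^ 3 * ee q (k * s^2 * t - inv4 q t * \<sigma> * F)"
      by (simp add: gauss_sum_mult_square[OF assms(1,4)])
  qed
  finally show ?thesis .
qed

lemma card_residue_class_le:
  fixes M n a :: int
  assumes "M > 0" "n \<ge> 0"
  shows "card {t \<in> {0..<M*n}. M dvd t - a} \<le> nat n"
proof -
  let ?A = "{t \<in> {0..<M*n}. M dvd t - a}"
  have "card ?A \<le> card {0..<n}"
  proof (rule card_inj_on_le[of "\<lambda>t. t div M"])
    show "inj_on (\<lambda>t. t div M) ?A"
    proof (rule inj_onI)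
      fix x y assume xy: "x \<in> ?A" "y \<in> ?A" "x div M = y div M"
      have "x mod M = a mod M" "y mod M = a mod M" using xy
        by (auto simp: mod_eq_dvd_iff)
      thus "x = y" using xy by (metis div_mod_decomp_int)
    qed
    show "(\<lambda>t. t div M) ` ?A \<subseteq> {0..<n}"
    proof safe
      fix t assume t: "t \<in> {0..<M*n}"
      have "M * (t div M) \<le> t" using assms by (simp add: minus_mod_eq_mult_div [symmetric])
      hence "M * (t div M) < M * n" using t by simp
      thus "t div M \<in> {0..<n}" using assms t by (auto simp: pos_imp_zdiv_nonneg_iff)
    qed
  qed simp
  thus ?thesis by simp
qed

text \<open>Stationary phase: averaging over the multipliers \<open>(1 + p^m b)\<^sup>2\<close> of \<open>t\<close> kills all but the
  critical points of the phase, and these are the zeros modulo \<open>p^m\<close> of a quadratic polynomial.\<close>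

lemma norm_unit_sum_le_stationary:
  fixes p k :: int
  assumes "prime p" "odd p" "\<not> p dvd k" "r \<ge> 2"
  shows "norm (unit_sum (p^r) k u v w) \<le> 2 * real_of_int p ^ (2 * r)"
proof -
  \<comment> \<open>Cutting at half the exponent gives \<open>3 * m \<ge> r\<close>, so cubes of
    multiples of \<open>p^m\<close> vanish modulo \<open>q\<close>, while \<open>n\<close> is
    \<open>m\<close> or \<open>m + 1\<close>.\<close>
  define q m n F where "q = p^r" and "m = r div 2" and "n = r - m" and "F = u^2 + v^2 + w^2"
  have p: "p > 0" "p > 1" using prime_gt_1_int[OF assms(1)] by auto
  have m: "m \<ge> 1" "m + n = r" "3 * m \<ge> r" "n \<ge> m" "n \<le> m + 1"
    using assms(4) by (auto simp: m_def n_def)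
  have q: "q > 0" "odd q" "q = p^m * p^n"
    using p assms(2) m by (auto simp: q_def simp flip: power_add)
  \<comment> \<open>For \<open>x = p^m * b\<close> the inverse of \<open>(1 + x)^2\<close> is
    \<open>1 - 2 * x + 3 * x^2\<close> modulo \<open>q\<close>, so the phase at
    \<open>(1 + x)^2 * t\<close> is the phase at \<open>t\<close> plus
    \<open>2 * x * A t + x^2 * B t\<close>. Thus \<open>A\<close> is the logarithmic derivative
    \<open>t d/dt\<close> of the phase, and its zeros are the critical points.\<close>
  define A where "A = (\<lambda>t. k * t + inv4 q t * F)"
  define B where "B = (\<lambda>t. k * t - 3 * inv4 q t * F)"
  define Z where "Z = (\<lambda>t. \<Sum>b=0..<p^n. ee (p^n) (p^m * B t * b^2 + 2 * A t * b))"
  define T where "T = {t \<in> {0..<q}. coprime t q \<and> p^m dvd A t}"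

  have one: "unit_sum q k u v w = (\<Sum>t=0..<q. if coprime t q then
     gauss_sum q t 0 ^ 3 * ee q (k * t - inv4 q t * F) * ee (p^n) (p^m * B t * b^2 + 2 * A t
         * b) else 0)" for b
  proof -
    define x where "x = p^m * b"
    have "p dvd x" using m by (simp add: x_def dvd_power)
    hence "coprime (1 + x) p"
      by (metis add.commute coprime_1_left coprime_commute dvd_def gcd_add_mult gcd_eq_1_imp_coprime coprime_imp_gcd_eq_1 mult.commute)
    hence cop: "coprime (1 + x) q" by (simp add: q_def)
    have x3: "q dvd x^3"
    proof -
      have "q dvd p^(m*3)" unfolding q_def by (rule le_imp_power_dvd) (use m in simp)
      thus ?thesis by (simp add: x_def power_mult_distrib power_mult)
    qed
    have "(1 + x)^2 * (1 - 2 * x + 3 * x^2) * F - F = x^3 * ((4 + 3 * x) * F)"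
      by algebra
    hence "q dvd (1 + x)^2 * (1 - 2 * x + 3 * x^2) * F - F" using x3 by simp
    hence "[(1 + x)^2 * (1 - 2 * x + 3 * x^2) * F = F] (mod q)" by (simp add: cong_iff_dvd_diff)
    note tw = unit_sum_twist[OF q(1,2) F_def cop this]
    show ?thesis unfolding tw
    proof (intro sum.cong refl if_cong)
      fix t
      have "ee q (k * (1 + x)^2 * t - inv4 q t * (1 - 2 * x + 3 * x^2) * F) =
        ee q ((k * t - inv4 q t * F) + (x^2 * B t + 2 * x * A t))"
        by (rule arg_cong[of _ _ "ee q"]) (simp add: A_def B_def algebra_simps power2_eq_square)
      also have "\<dots> = ee q (k * t - inv4 q t * F) * ee q (x^2 * B t + 2 * x * A t)"
        by (rule ee_add)
      also have "x^2 * B t + 2 * x * A t = p^m * (p^m * B t * b^2 + 2 * A t * b)"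
        by (simp add: x_def algebra_simps power2_eq_square)
      also have "ee q \<dots> = ee (p^n) (p^m * B t * b^2 + 2 * A t * b)"
        unfolding q(3) by (rule ee_mult_cancel) (use p in simp)
      finally show "gauss_sum q t 0 ^ 3 * ee q (k * (1 + x)^2 * t - inv4 q t * (1 - 2 * x + 3 * x^2) * F) =
        gauss_sum q t 0 ^ 3 * ee q (k * t - inv4 q t * F) * ee (p^n) (p^m * B t * b^2 + 2 * A t * b)"
        by simp
    qed
  qed
  have "(\<Sum>b=0..<p^n. unit_sum q k u v w) = (\<Sum>b=0..<p^n. \<Sum>t=0..<q. if coprime t q then
     gauss_sum q t 0 ^ 3 * ee q (k * t - inv4 q t * F) * ee (p^n) (p^m * B t * b^2 + 2 * A t * b) else 0)"
    by (intro sum.cong refl one)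
  also have "\<dots> = (\<Sum>t=0..<q. if coprime t q then gauss_sum q t 0 ^ 3 * ee q (k * t - inv4 q t * F)
      * Z t else 0)"
    unfolding Z_def sum_distrib_left by (subst sum.swap) (intro sum.cong refl, simp)
  finally have avg: "of_int (p^n) * unit_sum q k u v w =
     (\<Sum>t=0..<q. if coprime t q then gauss_sum q t 0 ^ 3 * ee q (k * t - inv4 q t * F) * Z t else 0)"
    using p by simp

  \<comment> \<open>Shifting \<open>b\<close> by \<open>p^(n-m)\<close> changes the quadratic part
    by a multiple of \<open>p^n\<close> and multiplies the sum by \<open>ee (p^m) (2 * A t)\<close>,
    which is not 1 off the critical points.\<close>
  have Z0: "Z t = 0" if "\<not> p^m dvd A t" for t
  proof -
    define c where "c = p^(n-m)"
    have nm: "p^n = c * p^m" using m by (simp add: c_def flip: power_add)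
    have per: "periodic (p^n) (\<lambda>b. ee (p^n) (p^m * B t * b^2 + 2 * A t * b))"
      unfolding periodic_def by (auto intro!: ee_cong cong_add cong_mult cong_pow)
    have "Z t = (\<Sum>b=0..<p^n. ee (p^n) (p^m * B t * (b + c)^2 + 2 * A t * (b + c)))"
      unfolding Z_def by (rule sum_shift_mod[OF _ per, symmetric]) (use p in simp)
    also have "\<dots> = (\<Sum>b=0..<p^n. ee (p^m) (2 * A t) * ee (p^n) (p^m * B t * b^2 + 2 * A t * b))"
    proof (rule sum.cong[OF refl])
      fix b
      have "ee (p^n) (p^m * B t * (b + c)^2 + 2 * A t * (b + c)) =
        ee (p^n) (c * (2 * A t) + ((p^m * B t * b^2 + 2 * A t * b) + p^n * (B t * (2 * b + c))))"
        by (rule arg_cong[of _ _ "ee (p^n)"]) (simp add: nm algebra_simps power2_eq_square)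
      also have "\<dots> = ee (p^m) (2 * A t) * ee (p^n) (p^m * B t * b^2 + 2 * A t * b)"
        unfolding ee_add[of "p^n"] using p
        by (simp add: ee_dvd) (simp add: nm ee_mult_cancel c_def)
      finally show "ee (p^n) (p^m * B t * (b + c)^2 + 2 * A t * (b + c)) = \<dots>" .
    qed
    also have "\<dots> = ee (p^m) (2 * A t) * Z t" by (simp add: Z_def sum_distrib_left)
    finally have "(ee (p^m) (2 * A t) - 1) * Z t = 0" by (simp add: algebra_simps)
    moreover have "\<not> p^m dvd 2 * A t"
    proof
      assume "p^m dvd 2 * A t"
      moreover have "coprime (p^m) 2" using assms(2) by simp
      ultimately show False using that coprime_dvd_mult_right_iff by blast
    qed
    ultimately show ?thesis using ee_eq_1_iff[of "p^m" "2 * A t"] p by simp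
  qed

  \<comment> \<open>For \<open>n = m\<close> the trivial bound is already \<open>sqrt q\<close>. For
    \<open>n = m + 1\<close> the sum collapses to \<open>p^m\<close> copies of a Gauss sum modulo
    \<open>p\<close>, whose leading coefficient is a unit because
    \<open>B t + 3 * A t = 4 * k * t\<close>.\<close>
  have Z1: "norm (Z t) \<le> sqrt q" if dv: "p^m dvd A t" and ct: "coprime t q" for t
  proof (cases "n = m")
    case True
    have "norm (Z t) \<le> (\<Sum>b=0..<p^n. 1)"
      unfolding Z_def by (rule sum_norm_le) simp
    also have "\<dots> = real_of_int (p^n)" using p by simp
    also have "\<dots> = sqrt q" unfolding q(3) True using p by simp
    finally show ?thesis .
  next
    case False
    hence n: "n = m + 1" using m by simp
    obtain A' where A': "A t = p^m * A'" using dv unfolding dvd_def by blast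
    have "Z t = (\<Sum>b=0..<p*p^m. ee p (B t * b^2 + 2 * A' * b))"
      unfolding Z_def n
    proof (intro sum.cong)
      fix b
      have "ee (p^(m+1)) (p^m * B t * b^2 + 2 * A t * b) = ee (p^m * p) (p^m * (B t * b^2 + 2 * A' * b))"
        unfolding A' by (intro arg_cong2[of _ _ _ _ ee]) (auto simp: algebra_simps)
      thus "ee (p^(m+1)) (p^m * B t * b^2 + 2 * A t * b) = ee p (B t * b^2 + 2 * A' * b)"
        using p ee_mult_cancel[of "p^m" p] by simp
    qed simp
    also have "\<dots> = (\<Sum>i=0..<p. \<Sum>j=0..<p^m. ee p (B t * (i + p * j)^2 + 2 * A' * (i + p * j)))"
      by (rule sum_split_mod) (use p in auto)
    also have "\<dots> = (\<Sum>i=0..<p. \<Sum>j=0..<p^m. ee p (B t * i^2 + 2 * A' * i))"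
      by (intro sum.cong refl ee_cong cong_add cong_mult cong_pow) (auto simp: cong_def)
    also have "\<dots> = of_int (p^m) * gauss_sum p (B t) (2 * A')"
      using p by (simp add: gauss_sum_def sum_distrib_left)
    finally have "norm (Z t) = real_of_int p ^ m * norm (gauss_sum p (B t) (2 * A'))"
      using p by (simp add: norm_mult norm_power)
    moreover have "coprime (B t) p"
    proof -
      have "\<not> p dvd B t"
      proof
        assume "p dvd B t"
        moreover have "p dvd A t" using dv m
            by (meson dvd_power dvd_trans order_less_le_trans zero_less_one)
        ultimately have "p dvd B t + 3 * A t" by simp
        also have "B t + 3 * A t = 2 * (2 * (k * t))" by (simp add: A_def B_def)
        finally have "p dvd 2 \<or> p dvd k \<or> p dvd t"
          using assms(1) by (simp only: prime_dvd_mult_iff) blast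
        moreover have "\<not> p dvd 2" by (rule odd_prime_not_dvd_2[OF assms(1,2)])
        moreover have "\<not> p dvd t" using ct coprime_prime_power_iff[of p r t] assms by (simp add: q_def)
        ultimately show False using assms(3) by blast
      qed
      thus ?thesis using assms(1) by (meson coprime_commute prime_imp_coprime)
    qed
    ultimately have "norm (Z t) = real_of_int p ^ m * sqrt p"
      using norm_gauss_sum[OF p(1) assms(2)] by simp
    also have "\<dots> = sqrt q" unfolding q(3) n using p by (simp add: real_sqrt_mult)
    finally show ?thesis by simp
  qed

  \<comment> \<open>A critical point satisfies \<open>4 * k * t^2 + F = 0\<close> modulo
    \<open>p^m\<close>. Given one solution \<open>t1\<close>, every other is \<open>t1\<close> or
    \<open>- t1\<close> modulo \<open>p^m\<close>, since \<open>p\<close> cannot divide both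
    \<open>t - t1\<close> and \<open>t + t1\<close> for a unit \<open>t\<close>.\<close>
  have cardT: "card T \<le> 2 * nat (p^n)"
  proof (cases "T = {}")
    case False
    then obtain t1 where t1: "t1 \<in> T" by blast
    have quad: "p^m dvd 4 * k * t^2 + F" if "t \<in> T" for t
    proof -
      have "[4 * t * inv4 q t = 1] (mod q)" by (rule inv4_cong_1) (use q that in \<open>auto simp: T_def\<close>)
      hence "[4 * t * inv4 q t = 1] (mod p^m)" unfolding q(3) by (rule cong_modulus_mult)
      hence "[4 * k * t^2 + 4 * t * inv4 q t * F = 4 * k * t^2 + 1 * F] (mod p^m)"
        by (intro cong_add cong_mult cong_refl)
      moreover have "4 * k * t^2 + 4 * t * inv4 q t * F = 4 * t * A t"
        by (simp add: A_def algebra_simps power2_eq_square)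
      moreover have "p^m dvd 4 * t * A t" using that by (simp add: T_def)
      ultimately show ?thesis by (metis cong_dvd_iff mult_1)
    qed
    have "T \<subseteq> {t \<in> {0..<p^m*p^n}. p^m dvd t - t1} \<union> {t \<in> {0..<p^m*p^n}. p^m dvd t - (-t1)}"
    proof
      fix t assume t: "t \<in> T"
      have np: "\<not> p dvd t" "\<not> p dvd 2" "\<not> p dvd k"
        using t coprime_prime_power_iff[of p r t] assms odd_prime_not_dvd_2[OF assms(1,2)]
        by (simp_all add: T_def q_def)
      have "p^m dvd (4 * k * t^2 + F) - (4 * k * t1^2 + F)" using quad t t1 by (intro dvd_diff)
      also have "(4 * k * t^2 + F) - (4 * k * t1^2 + F) = (2^2 * k) * ((t - t1) * (t - (-t1)))"
        by (simp add: algebra_simps power2_eq_square)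
      finally have d: "p^m dvd (2^2 * k) * ((t - t1) * (t - (-t1)))" .
      have "coprime p 2" "coprime p k" using prime_imp_coprime[OF assms(1)] np by blast+
      hence "coprime (p^m) (2^2 * k)"
          by (simp only: coprime_mult_right_iff coprime_power_left_iff coprime_power_right_iff) simp
      hence d: "p^m dvd (t - t1) * (t - (-t1))" using d coprime_dvd_mult_right_iff by blast
      have "\<not> (p dvd t - t1 \<and> p dvd t - (-t1))"
      proof
        assume "p dvd t - t1 \<and> p dvd t - (-t1)"
        hence "p dvd (t - t1) + (t - (-t1))" by (intro dvd_add) auto
        hence "p dvd 2 * t" by simp
        thus False using np assms(1) prime_dvd_multD by blast
      qed
      hence "coprime (p^m) (t - t1) \<or> coprime (p^m) (t - (-t1))"
        unfolding coprime_power_left_iff using prime_imp_coprime[OF assms(1)] by blast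
      hence "p^m dvd t - t1 \<or> p^m dvd t - (-t1)" using d
        by (metis coprime_dvd_mult_left_iff coprime_dvd_mult_right_iff)
      thus "t \<in> {t \<in> {0..<p^m*p^n}. p^m dvd t - t1} \<union> {t \<in> {0..<p^m*p^n}. p^m dvd t - (-t1)}"
        using t by (auto simp: T_def q(3))
    qed
    hence "card T \<le> card ({t \<in> {0..<p^m*p^n}. p^m dvd t - t1} \<union> {t \<in> {0..<p^m*p^n}. p^m dvd t - (-t1)})"
      by (rule card_mono[rotated]) (rule finite_subset[of _ "{0..<p^m*p^n}"], auto)
    also have "\<dots> \<le> card {t \<in> {0..<p^m*p^n}. p^m dvd t - t1} + card {t \<in> {0..<p^m*p^n}. p^m dvd t - (-t1)}"
      by (rule card_Un_le)
    also have "\<dots> \<le> nat (p^n) + nat (p^n)"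
      by (intro add_mono card_residue_class_le) (use p in auto)
    finally show ?thesis by simp
  qed simp

  have "real_of_int (p^n) * norm (unit_sum q k u v w) = norm (of_int (p^n) * unit_sum q k u v w)"
    using p by (simp add: norm_mult norm_power)
  also have "\<dots> \<le> (\<Sum>t=0..<q. if t \<in> T then sqrt q ^ 3 * sqrt q else 0)"
    unfolding avg
  proof (rule sum_norm_le)
    fix t assume t: "t \<in> {0..<q}"
    show "norm (if coprime t q then gauss_sum q t 0 ^ 3 * ee q (k * t - inv4 q t * F) * Z t else 0)
       \<le> (if t \<in> T then sqrt q ^ 3 * sqrt q else 0)"
      using t Z0[of t] Z1[of t] q(1)
      by (auto simp: T_def norm_mult norm_power norm_gauss_sum[OF q(1,2)] intro!: mult_left_mono)
  qed
  also have "\<dots> = real (card T) * real_of_int q ^ 2"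
  proof -
    have "sqrt q ^ 3 * sqrt q = (sqrt q ^ 2) ^ 2" by algebra
    also have "\<dots> = real_of_int q ^ 2" using q(1) by (simp only: real_sqrt_pow2 of_int_0_le_iff less_imp_le)
    finally have 1: "sqrt q ^ 3 * sqrt q = real_of_int q ^ 2" .
    have "{0..<q} \<inter> T = T" by (auto simp: T_def)
    thus ?thesis unfolding 1 by (simp add: sum.inter_restrict [symmetric])
  qed
  also have "\<dots> \<le> real_of_int (2 * p^n) * real_of_int q ^ 2"
  proof (rule mult_right_mono)
    have "real (card T) \<le> real (2 * nat (p^n))" using cardT by (simp only: of_nat_le_iff)
    thus "real (card T) \<le> real_of_int (2 * p^n)" using p by simp
  qed simp
  finally have "real_of_int (p^n) * norm (unit_sum q k u v w) \<le> real_of_int (p^n) * (2 * real_of_int q ^ 2)"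
    by (simp add: mult_ac)
  hence "norm (unit_sum q k u v w) \<le> 2 * real_of_int q ^ 2" using p by simp
  thus ?thesis by (simp add: q_def flip: power_mult) (simp add: mult.commute)
qed

section \<open>Unit sums for \<open>k = 0\<close>\<close>

lemma coprime_one_plus:
  fixes p x :: int
  assumes "p dvd x"
  shows "coprime (1 + x) p"
proof (rule coprimeI)
  fix c assume c: "c dvd 1 + x" "c dvd p"
  hence "c dvd (1 + x) - x" using assms by (intro dvd_diff) (auto intro: dvd_trans)
  thus "is_unit c" by simp
qed

text \<open>Only the term \<open>- inv4 q t * F\<close> of the phase is left. If \<open>p^i\<close>
  exactly divides \<open>F\<close> and \<open>i < r - 1\<close>, the multipliers
  \<open>(1 + p^(r-1-i) * b)^2\<close> twist every summand by a nontrivial character of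
  \<open>b\<close> modulo \<open>p\<close>, whose average is 0.\<close>

lemma unit_sum_zero_eq_0:
  fixes p :: int
  assumes "prime p" "odd p" "\<not> p ^ (r - 1) dvd u^2 + v^2 + w^2"
  shows "unit_sum (p^r) 0 u v w = 0"
proof -
  define q F where "q = p^r" and "F = u^2 + v^2 + w^2"
  have p: "p > 0" "p > 1" using prime_gt_1_int[OF assms(1)] by auto
  define i where "i = (LEAST i. \<not> p ^ Suc i dvd F)"
  have "r - 1 \<noteq> 0" using assms(3) by (metis is_unit_power_iff one_dvd power_0)
  then obtain j where j: "r - 1 = Suc j" by (cases "r - 1") auto
  have "\<not> p ^ Suc j dvd F" using assms(3) j by (simp add: F_def)
  hence i: "\<not> p ^ Suc i dvd F" "i \<le> j" unfolding i_def by (rule LeastI, rule Least_le)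
  have iF: "p ^ i dvd F"
  proof (cases i)
    case (Suc i')
    thus ?thesis using not_less_Least[of i' "\<lambda>i. \<not> p ^ Suc i dvd F"] by (auto simp: i_def)
  qed simp
  then obtain F' where F': "F = p^i * F'" by (auto elim: dvdE)
  have nF': "\<not> p dvd F'" using i(1) p by (auto simp: F')
  \<comment> \<open>With this choice \<open>p^m * F\<close> is divisible by \<open>p^(r-1)\<close>
    but not by \<open>p^r\<close>, so the first order change of the phase has denominator exactly
    \<open>p\<close>; the second order change vanishes because
    \<open>2 * m + i \<ge> r\<close>.\<close>
  define m where "m = r - 1 - i"
  have m: "m \<ge> 1" "m + i + 1 = r" using i(2) j by (auto simp: m_def)
  have q: "q > 0" "odd q" using p assms(2) by (auto simp: q_def)
  have one: "unit_sum q 0 u v w = (\<Sum>t=0..<q. if coprime t q then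
     gauss_sum q t 0 ^ 3 * ee q (- inv4 q t * F) * ee p (b * (2 * inv4 q t * F')) else 0)" for b
  proof -
    define x where "x = p^m * b"
    have "p dvd x" using m by (simp add: x_def dvd_power)
    hence "coprime (1 + x) p" by (rule coprime_one_plus)
    hence cop: "coprime (1 + x) q" by (simp add: q_def)
    have "(1 + x)^2 * (1 - 2 * x) * F - F = (x * x * F) * (- 3 - 2 * x)"
      by algebra
    moreover have "q dvd x * x * F"
    proof -
      have "q dvd p^(m+m+i)" unfolding q_def by (rule le_imp_power_dvd) (use m in simp)
      thus ?thesis by (simp add: x_def F' power_add mult_ac)
    qed
    ultimately have "q dvd (1 + x)^2 * (1 - 2 * x) * F - F" by simp
    hence "[(1 + x)^2 * (1 - 2 * x) * F = F] (mod q)" by (simp add: cong_iff_dvd_diff)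
    note tw = unit_sum_twist[OF q(1,2) F_def cop this]
    show ?thesis unfolding tw
    proof (intro sum.cong refl if_cong)
      fix t
      have "ee q (0 * (1 + x)^2 * t - inv4 q t * (1 - 2 * x) * F) = ee q (- inv4 q t * F + 2 * inv4 q t
          * x * F)"
        by (rule arg_cong[of _ _ "ee q"]) (simp add: algebra_simps)
      also have "\<dots> = ee q (- inv4 q t * F) * ee q (2 * inv4 q t * x * F)" by (rule ee_add)
      also have "ee q (2 * inv4 q t * x * F) = ee (p^(m+i) * p) (p^(m+i) * (b * (2 * inv4 q t * F')))"
        unfolding q_def m(2) [symmetric] by (simp add: x_def F' power_add mult_ac)
      also have "\<dots> = ee p (b * (2 * inv4 q t * F'))" using p by (intro ee_mult_cancel) simp
      finally show "gauss_sum q t 0 ^ 3 * ee q (0 * (1 + x)^2 * t - inv4 q t * (1 - 2 * x) * F) =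
        gauss_sum q t 0 ^ 3 * ee q (- inv4 q t * F) * ee p (b * (2 * inv4 q t * F'))" by simp
    qed
  qed
  have "of_int p * unit_sum q 0 u v w = (\<Sum>b=0..<p. unit_sum q 0 u v w)" using p by simp
  also have "\<dots> = (\<Sum>b=0..<p. \<Sum>t=0..<q. if coprime t q then
     gauss_sum q t 0 ^ 3 * ee q (- inv4 q t * F) * ee p (b * (2 * inv4 q t * F')) else 0)"
    by (intro sum.cong refl one)
  also have "\<dots> = (\<Sum>t=0..<q. if coprime t q then
     gauss_sum q t 0 ^ 3 * ee q (- inv4 q t * F) * (\<Sum>b=0..<p. ee p (b * (2 * inv4 q t * F'))) else 0)"
    unfolding sum_distrib_left by (subst sum.swap) (intro sum.cong refl, simp)
  also have "\<dots> = (\<Sum>t=0..<q. 0)"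
  proof (intro sum.cong refl)
    fix t
    show "(if coprime t q then gauss_sum q t 0 ^ 3 * ee q (- inv4 q t * F) *
        (\<Sum>b=0..<p. ee p (b * (2 * inv4 q t * F'))) else 0) = 0"
    proof (cases "coprime t q")
      case True
      have "p dvd q" using m by (simp add: q_def dvd_power)
      with q True assms(1) have "\<not> p dvd inv4 q t" by (intro inv4_not_dvd)
      hence "\<not> p dvd 2 * inv4 q t * F'"
        using nF' odd_prime_not_dvd_2[OF assms(1,2)] assms(1) by (simp add: prime_dvd_mult_iff)
      thus ?thesis using p by (simp add: sum_ee)
    qed simp
  qed
  finally show ?thesis using p by (simp add: q_def)
qed

text \<open>For \<open>x = i + p * j\<close> the square is linear in \<open>j\<close> up to
  multiples of \<open>p^2\<close>, and the sum over \<open>j\<close> vanishes unless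
  \<open>i = 0\<close>. No quadratic symbol of \<open>t\<close> survives.\<close>

lemma gauss_sum_square_modulus:
  fixes p :: int
  assumes "prime p" "odd p" "\<not> p dvd t"
  shows "gauss_sum (p^2) t 0 = of_int p"
proof -
  have p: "p > 0" using prime_gt_1_int[OF assms(1)] by auto
  have "gauss_sum (p^2) t 0 = (\<Sum>x=0..<p*p. ee (p*p) (t * x^2))"
    by (simp add: gauss_sum_def power2_eq_square)
  also have "\<dots> = (\<Sum>i=0..<p. \<Sum>j=0..<p. ee (p*p) (t * (i + p * j)^2))"
    by (rule sum_split_mod) (use p in auto)
  also have "\<dots> = (\<Sum>i=0..<p. \<Sum>j=0..<p. ee (p*p) (t * i^2) * ee p (j * (2 * t * i)))"
  proof (intro sum.cong refl)
    fix i j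
    have "ee (p*p) (t * (i + p * j)^2) = ee (p*p) (t * i^2 + (p * (j * (2 * t * i)) + (p * p) * (t * j^2)))"
      by (rule arg_cong[of _ _ "ee (p*p)"]) (simp add: algebra_simps power2_eq_square)
    also have "\<dots> = ee (p*p) (t * i^2) * (ee (p*p) (p * (j * (2 * t * i))) * ee (p*p) ((p * p) * (t * j^2)))"
      by (simp only: ee_add)
    also have "\<dots> = ee (p*p) (t * i^2) * ee p (j * (2 * t * i))"
      using p by (simp only: ee_mult_cancel) (simp add: ee_dvd ee_mult_cancel)
    finally show "ee (p*p) (t * (i + p * j)^2) = \<dots>" .
  qed
  also have "\<dots> = (\<Sum>i=0..<p. if i = 0 then of_int p else 0)"
    unfolding sum_distrib_left [symmetric]
  proof (intro sum.cong refl)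
    fix i assume i: "i \<in> {0..<p}"
    have "p dvd 2 * t * i \<longleftrightarrow> p dvd i"
      using assms odd_prime_not_dvd_2[OF assms(1,2)] by (simp add: prime_dvd_mult_iff)
    also have "\<dots> \<longleftrightarrow> i = 0" using i by (auto dest: zdvd_imp_le)
    finally show "ee (p*p) (t * i^2) * (\<Sum>j=0..<p. ee p (j * (2 * t * i))) = (if i = 0 then of_int p else 0)"
      using p by (simp add: sum_ee)
  qed
  also have "\<dots> = of_int p" using p by simp
  finally show ?thesis .
qed

text \<open>Modulo \<open>p\<^sup>2\<close> the Gauss sum \<open>gauss_sum (p^2) t 0\<close> does not depend on \<open>t\<close>, so \<open>t\<close> may be multiplied
  by arbitrary units, not only by squares; averaging over them produces a Ramanujan sum.\<close>

lemma norm_unit_sum_zero_le: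
  fixes p :: int
  assumes "prime p" "odd p" "\<not> p ^ 2 dvd u^2 + v^2 + w^2"
  shows "norm (unit_sum (p^2) 0 u v w) \<le> real_of_int p ^ 4"
proof (cases "p dvd u^2 + v^2 + w^2")
  case False
  thus ?thesis using unit_sum_zero_eq_0[OF assms(1,2), of 2 u v w] by simp
next
  case True
  define q F where "q = p^2" and "F = u^2 + v^2 + w^2"
  have p: "p > 0" "p > 1" using prime_gt_1_int[OF assms(1)] by auto
  have q: "q > 0" "odd q" using p assms(2) by (auto simp: q_def)
  obtain F' where F': "F = p * F'" using True unfolding F_def dvd_def by blast
  have "\<not> p * p dvd p * F'"
    using assms(3) unfolding F_def [symmetric] F' power2_eq_square[of p] .
  hence nF': "\<not> p dvd F'" using p by simp
  have cop: "coprime t q \<longleftrightarrow> \<not> p dvd t" for t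
    using coprime_prime_power_iff[OF assms(1), of 2 t] by (simp add: q_def)
  \<comment> \<open>Here \<open>s\<close> inverts \<open>\<sigma>\<close>, so passing from
    \<open>t\<close> to \<open>s * t\<close> multiplies the phase by \<open>\<sigma>\<close>; as
    \<open>F = p * F'\<close>, the phase then depends on \<open>\<sigma>\<close> only modulo
    \<open>p\<close>.\<close>
  have one: "unit_sum q 0 u v w = (\<Sum>t=0..<q. if coprime t q then of_int p ^ 3 * ee p (\<sigma> * (- inv4 q t
      * F')) else 0)"
    if "\<sigma> \<in> {1..<p}" for \<sigma>
  proof -
    have "coprime \<sigma> q" using cop[of \<sigma>] that by (auto dest: zdvd_imp_le)
    then obtain s where s: "[\<sigma> * s = 1] (mod q)" using cong_solve_coprime_int by blast
    have cs: "coprime s q" using s by (metis coprime_iff_invertible_int mult.commute)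
    have sF: "[s * \<sigma> * F = F] (mod q)"
      using cong_mult[OF s cong_refl[of F q]] by (simp add: mult_ac)
    have "unit_sum q 0 u v w = (\<Sum>t=0..<q. if coprime (s * t) q then
     gauss_sum q (s * t) 0 ^ 3 * ee q (0 * (s * t) - inv4 q (s * t) * F) else 0)"
      unfolding unit_sum_eq_phase[OF q F_def]
      by (rule sum_scale_mod[OF q(1) periodic_phase cs, symmetric])
    also have "\<dots> = (\<Sum>t=0..<q. if coprime t q then of_int p ^ 3 * ee p (\<sigma> * (- inv4 q t * F')) else 0)"
    proof (intro sum.cong refl if_cong)
      fix t
      show eq: "coprime (s * t) q = coprime t q" using cs by simp
      assume t: "coprime t q"
      hence "gauss_sum q (s * t) 0 = of_int p"
        using eq cop[of "s * t"] gauss_sum_square_modulus[OF assms(1,2)] by (simp add: q_def)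
      moreover have "ee q (0 * (s * t) - inv4 q (s * t) * F) = ee q (0 - inv4 q t * \<sigma> * F)"
        by (intro ee_cong cong_diff inv4_mult q t cs sF) simp
      moreover have "0 - inv4 q t * \<sigma> * F = p * (\<sigma> * (- inv4 q t * F'))" by (simp add: F')
      moreover have "ee q (p * (\<sigma> * (- inv4 q t * F'))) = ee p (\<sigma> * (- inv4 q t * F'))"
        unfolding q_def power2_eq_square using p by (intro ee_mult_cancel) simp
      ultimately show "gauss_sum q (s * t) 0 ^ 3 * ee q (0 * (s * t) - inv4 q (s * t) * F) =
         of_int p ^ 3 * ee p (\<sigma> * (- inv4 q t * F'))" by (simp only:)
    qed
    finally show ?thesis .
  qed
  define U where "U = {t\<in>{0..<q}. coprime t q}"
  have "of_int (p - 1) * unit_sum q 0 u v w = (\<Sum>\<sigma>=1..<p. unit_sum q 0 u v w)" using p by simp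
  also have "\<dots> = (\<Sum>\<sigma>=1..<p. \<Sum>t=0..<q. if coprime t q then of_int p ^ 3 * ee p (\<sigma> * (- inv4 q t
      * F')) else 0)"
    by (intro sum.cong refl one)
  also have "\<dots> = (\<Sum>t=0..<q. if coprime t q then of_int p ^ 3 * (\<Sum>\<sigma>=1..<p. ee p (\<sigma> * (- inv4 q t
      * F'))) else 0)"
    unfolding sum_distrib_left by (subst sum.swap) (intro sum.cong refl, simp)
  also have "\<dots> = (\<Sum>t=0..<q. if coprime t q then - (of_int p ^ 3) else 0)"
  proof (intro sum.cong refl if_cong)
    fix t assume t: "coprime t q"
    have "p dvd q" by (simp add: q_def)
    with q t assms(1) have "\<not> p dvd inv4 q t" by (intro inv4_not_dvd)
    hence "\<not> p dvd (- inv4 q t * F')"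
      using nF' assms(1) by (simp add: prime_dvd_mult_iff)
    hence "(\<Sum>\<sigma>=0..<p. ee p (\<sigma> * (- inv4 q t * F'))) = 0"
      unfolding sum_ee[OF p(1)] by (simp only: if_False)
    moreover have "{0..<p} = insert 0 {1..<p}" using p by auto
    ultimately have "(\<Sum>\<sigma>=1..<p. ee p (\<sigma> * (- inv4 q t * F'))) = -1"
      by (simp add: eq_neg_iff_add_eq_0 add.commute)
    thus "of_int p ^ 3 * (\<Sum>\<sigma>=1..<p. ee p (\<sigma> * (- inv4 q t * F'))) = - (of_int p ^ 3)" by simp
  qed
  also have "\<dots> = - (of_nat (card U) * of_int p ^ 3)"
    by (simp add: U_def sum.If_cases Int_def)
  finally have eq: "of_int (p - 1) * unit_sum q 0 u v w = - (of_nat (card U) * of_int p ^ 3)" .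
  \<comment> \<open>There are at most \<open>p * (p - 1)\<close> units, so dividing by
    \<open>p - 1\<close> leaves \<open>p * p^3\<close>, against \<open>p^5\<close> from the trivial
    estimate.\<close>
  have "U \<subseteq> {0..<q} - (\<lambda>j. p * j) ` {0..<p}" by (auto simp: U_def cop)
  hence "card U \<le> card ({0..<q} - (\<lambda>j. p * j) ` {0..<p})" by (intro card_mono) auto
  also have "\<dots> = card {0..<q} - card ((\<lambda>j. p * j) ` {0..<p})"
    by (rule card_Diff_subset) (use p in \<open>auto simp: q_def power2_eq_square\<close>)
  also have "card ((\<lambda>j. p * j) ` {0..<p}) = card {0..<p}"
    by (rule card_image) (use p in \<open>auto simp: inj_on_def\<close>)
  finally have "card U \<le> nat q - nat p" by simp
  moreover have "p * 1 \<le> q" unfolding q_def power2_eq_square by (rule mult_left_mono) (use p in auto)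
  ultimately have "int (card U) \<le> q - p" using p by linarith
  hence "int (card U) \<le> p * (p - 1)"
    by (simp add: q_def power2_eq_square algebra_simps)
  hence cU: "real (card U) \<le> real_of_int (p * (p - 1))" by linarith
  have "real_of_int (p - 1) * norm (unit_sum q 0 u v w) = norm (of_int (p - 1) * unit_sum q 0 u v w)"
    using p by (simp add: norm_mult flip: of_int_diff)
  also have "\<dots> = real (card U) * real_of_int p ^ 3"
    unfolding eq using p by (simp add: norm_mult norm_power)
  also have "\<dots> \<le> real_of_int (p * (p - 1)) * real_of_int p ^ 3"
    by (intro mult_right_mono cU) (use p in auto)
  also have "\<dots> = real_of_int (p - 1) * real_of_int p ^ 4" by (simp add: power_numeral_reduce)
  finally show ?thesis using p by (simp add: q_def)
qed

section \<open>From unit sums to Fourier coefficients at prime powers\<close>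

lemma norm_quad_sum_le:
  assumes "q > 0"
  shows "norm (quad_sum q k u v w) \<le> real_of_int q ^ 3"
proof -
  have "norm (quad_sum q k u v w) \<le> (\<Sum>x=0..<q. \<Sum>y=0..<q. \<Sum>z=0..<q. 1)"
    unfolding quad_sum_def by (intro sum_norm_le) auto
  thus ?thesis using assms by (simp add: power3_eq_cube)
qed

text \<open>Write \<open>x = i + p^s * j\<close>: as \<open>p\<close> divides the quadratic
  coefficient, \<open>j\<close> enters only through the character \<open>ee p (j * u)\<close>, and
  its sum is 0 unless \<open>p\<close> divides \<open>u\<close>.\<close>

lemma gauss_sum_multiple:
  fixes p :: int
  assumes "p > 0"
  shows "gauss_sum (p ^ Suc s) (p * t) u = (if p dvd u then of_int p * gauss_sum (p^s) t (u div p) else 0)"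
proof -
  have "gauss_sum (p ^ Suc s) (p * t) u = (\<Sum>x=0..<p^s*p. ee (p^s*p) (p * t * x^2 + u * x))"
    by (simp add: gauss_sum_def mult.commute)
  also have "\<dots> = (\<Sum>i=0..<p^s. \<Sum>j=0..<p. ee (p^s*p) (p * t * (i + p^s * j)^2 + u * (i + p^s * j)))"
    by (rule sum_split_mod) (use assms in auto)
  also have "\<dots> = (\<Sum>i=0..<p^s. \<Sum>j=0..<p. ee (p^s*p) (p * t * i^2 + u * i) * ee p (j * u))"
  proof (intro sum.cong refl)
    fix i j
    have "ee (p^s*p) (p * t * (i + p^s * j)^2 + u * (i + p^s * j)) =
       ee (p^s*p) ((p * t * i^2 + u * i) + (p^s * (j * u) + (p^s*p) * (t * j * (2 * i + p^s * j))))"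
      by (rule arg_cong[of _ _ "ee (p^s*p)"]) (simp add: algebra_simps power2_eq_square)
    also have "\<dots> = ee (p^s*p) (p * t * i^2 + u * i) * (ee (p^s*p) (p^s * (j * u)) * ee (p^s*p) ((p^s*p)
        * (t * j * (2 * i + p^s * j))))"
      by (simp only: ee_add)
    also have "\<dots> = ee (p^s*p) (p * t * i^2 + u * i) * ee p (j * u)"
      using assms ee_mult_cancel[of "p^s" p "j * u"] ee_dvd[of "p^s*p" "(p^s*p) * (t * j * (2 * i + p^s
          * j))"] by simp
    finally show "ee (p^s*p) (p * t * (i + p^s * j)^2 + u * (i + p^s * j)) = \<dots>" .
  qed
  also have "\<dots> = (\<Sum>i=0..<p^s. ee (p^s*p) (p * t * i^2 + u * i) * (if p dvd u then of_int p else 0))"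
    unfolding sum_distrib_left [symmetric] sum_ee[OF assms] ..
  also have "\<dots> = (if p dvd u then of_int p * gauss_sum (p^s) t (u div p) else 0)"
  proof (cases "p dvd u")
    case True
    then obtain u' where u': "u = p * u'" by blast
    have "ee (p^s*p) (p * t * i^2 + u * i) = ee (p^s) (t * i^2 + u' * i)" for i
      using ee_mult_cancel[of p "p^s" "t * i^2 + u' * i"] assms by (simp add: u' algebra_simps)
    thus ?thesis using True assms u' by (simp add: gauss_sum_def sum_distrib_left mult.commute)
  qed simp
  finally show ?thesis .
qed

text \<open>In the expansion by Gauss sums the \<open>t\<close> prime to \<open>p\<close> give
  \<open>unit_sum\<close>; the multiples of \<open>p\<close> reproduce the expansion one level
  lower, each of the three Gauss sums contributing a factor \<open>p\<close>. This descent is the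
  source of the common divisor \<open>g\<close>.\<close>

lemma quad_sum_prime_power_Suc:
  fixes p :: int
  assumes "prime p"
  shows "of_int (p ^ Suc s) * quad_sum (p ^ Suc s) k u v w = unit_sum (p ^ Suc s) k u v w +
     (if p dvd u \<and> p dvd v \<and> p dvd w
      then of_int (p ^ (s + 3)) * quad_sum (p^s) k (u div p) (v div p) (w div p) else 0)"
proof -
  have p: "p > 0" using prime_gt_1_int[OF assms] by auto
  define f where "f = (\<lambda>t. ee (p ^ Suc s) (t * k) * gauss_sum (p ^ Suc s) t u
      * gauss_sum (p ^ Suc s) t v * gauss_sum (p ^ Suc s) t w)"
  have cop: "coprime t (p ^ Suc s) \<longleftrightarrow> \<not> p dvd t" for t
    using coprime_prime_power_iff[OF assms, of "Suc s" t] by simp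
  have "of_int (p ^ Suc s) * quad_sum (p ^ Suc s) k u v w = (\<Sum>t=0..<p ^ Suc s. f t)"
    unfolding f_def by (rule quad_sum_eq_gauss) (use p in simp)
  also have "\<dots> = (\<Sum>t=0..<p ^ Suc s. (if coprime t (p ^ Suc s) then f t else 0)
      + (if p dvd t then f t else 0))"
    by (intro sum.cong refl) (simp only: cop, simp)
  also have "\<dots> = unit_sum (p ^ Suc s) k u v w + (\<Sum>t=0..<p*p^s. if p dvd t then f t else 0)"
    unfolding sum.distrib unit_sum_def by (simp only: f_def power_Suc)
  also have "(\<Sum>t=0..<p*p^s. if p dvd t then f t else 0) =
     (\<Sum>i=0..<p. \<Sum>j=0..<p^s. if p dvd i + p * j then f (i + p * j) else 0)"
    by (rule sum_split_mod) (use p in auto)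
  also have "\<dots> = (\<Sum>i=0..<p. if i = 0 then (\<Sum>j=0..<p^s. f (p * j)) else 0)"
  proof (intro sum.cong refl)
    fix i assume i: "i \<in> {0..<p}"
    have "p dvd i + p * j \<longleftrightarrow> i = 0" for j using i by (auto dest: zdvd_imp_le simp: dvd_add_left_iff)
    thus "(\<Sum>j=0..<p^s. if p dvd i + p * j then f (i + p * j) else 0) = (if i = 0 then (\<Sum>j=0..<p^s. f (p
        * j)) else 0)"
      by simp
  qed
  also have "\<dots> = (\<Sum>j=0..<p^s. f (p * j))" using p by simp
  also have "\<dots> = (if p dvd u \<and> p dvd v \<and> p dvd w
      then of_int (p ^ 3) * (\<Sum>t=0..<p^s. ee (p^s) (t * k) * gauss_sum (p^s) t (u div p)
          * gauss_sum (p^s) t (v div p) * gauss_sum (p^s) t (w div p)) else 0)"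
  proof (cases "p dvd u \<and> p dvd v \<and> p dvd w")
    case True
    have "f (p * j) = of_int (p ^ 3) * (ee (p^s) (j * k) * gauss_sum (p^s) j (u div p)
        * gauss_sum (p^s) j (v div p) * gauss_sum (p^s) j (w div p))" for j
      using True p ee_mult_cancel[of p "p^s" "j * k"]
      by (simp add: f_def gauss_sum_multiple[OF p] power3_eq_cube mult.assoc del: power_Suc) (simp add: mult_ac)
    thus ?thesis using True by (simp add: sum_distrib_left)
  qed (auto simp: f_def gauss_sum_multiple[OF p] simp del: power_Suc)
  also have "(\<Sum>t=0..<p^s. ee (p^s) (t * k) * gauss_sum (p^s) t (u div p) * gauss_sum (p^s) t (v div p)
      * gauss_sum (p^s) t (w div p)) =
     of_int (p^s) * quad_sum (p^s) k (u div p) (v div p) (w div p)"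
    by (rule quad_sum_eq_gauss [symmetric]) (use p in simp)
  finally show ?thesis by (simp add: power_add mult_ac cong: if_cong)
qed

text \<open>The shape of the local bound: \<open>g\<close> records a common divisor of the frequencies, \<open>e\<close> a divisor of
  \<open>(u\<^sup>2 + v\<^sup>2 + w\<^sup>2) / g\<^sup>2\<close>, and \<open>l \<in> {1, p}\<close> a loss of \<open>sqrt p\<close>. Dividing by \<open>\<bar>u v w\<bar>\<close> and summing over the
  frequencies gains \<open>g^(-3) e^(-1/2)\<close>, so a loss with \<open>l dvd g\<close> is harmless.\<close>

lemma unit_sum_bound:
  fixes p k :: int
  assumes "prime p" "odd p" "k = 0 \<or> \<not> p dvd k" "s \<ge> 1"
  shows "\<exists>e l :: int. e > 0 \<and> l > 0 \<and> e dvd p^s \<and> e dvd u^2 + v^2 + w^2 \<and> l dvd p \<and>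
     ((k \<noteq> 0 \<and> s \<ge> 2) \<or> s = 2 \<longrightarrow> l = 1) \<and>
     norm (unit_sum (p^s) k u v w) \<le> 2 * real_of_int p ^ (2 * s) * sqrt (real_of_int (e * l))"
proof -
  have p: "p > 0" "p > 1" using prime_gt_1_int[OF assms(1)] by auto
  have q: "p^s > 0" "odd (p^s)" using p assms(2) by auto
  have triv: "norm (unit_sum (p^s) k u v w) \<le> 2 * real_of_int p ^ (2 * s) * sqrt (real_of_int p ^ s)"
  proof -
    have "norm (unit_sum (p^s) k u v w) \<le> real_of_int (p^s) * sqrt (real_of_int (p^s)) ^ 3"
      by (rule norm_unit_sum_le[OF q])
    also have "\<dots> = real_of_int p ^ s * (sqrt (real_of_int p ^ s) ^ 2 * sqrt (real_of_int p ^ s))"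
      by (simp only: power3_eq_cube power2_eq_square of_int_power)
    also have "sqrt (real_of_int p ^ s) ^ 2 = real_of_int p ^ s"
      using p by (simp only: real_sqrt_pow2 zero_le_power of_int_0_le_iff less_imp_le)
    also have "real_of_int p ^ s * (real_of_int p ^ s * sqrt (real_of_int p ^ s)) =
       real_of_int p ^ (2 * s) * sqrt (real_of_int p ^ s)"
      by (simp add: mult_2 power_add)
    also have "\<dots> \<le> 2 * (real_of_int p ^ (2 * s) * sqrt (real_of_int p ^ s))" using p by simp
    finally show ?thesis by simp
  qed
  \<comment> \<open>A loss \<open>l = p\<close> is needed in two situations only: modulus
    \<open>p\<close>, and \<open>k = 0\<close> with exponent at least 3, where divisibility of the
    sum of squares is known by \<open>p^(s-1)\<close> but not by \<open>p^s\<close>.\<close>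
  consider (nz) "k \<noteq> 0" "s \<ge> 2" | (one) "s = 1" | (sq) "k = 0" "s = 2" "p ^ 2 dvd u^2 + v^2 + w^2"
    | (nsq) "k = 0" "s = 2" "\<not> p ^ 2 dvd u^2 + v^2 + w^2"
    | (high) "k = 0" "s \<noteq> 2" "p ^ (s - 1) dvd u^2 + v^2 + w^2"
    | (zero) "k = 0" "s \<noteq> 2" "\<not> p ^ (s - 1) dvd u^2 + v^2 + w^2"
    using assms(4) by linarith
  thus ?thesis
  proof cases
    case nz
    hence "\<not> p dvd k" using assms(3) by auto
    from norm_unit_sum_le_stationary[OF assms(1,2) this nz(2), of u v w]
    show ?thesis by (intro exI[of _ 1] exI[of _ 1]) simp
  next
    case one
    thus ?thesis using triv p by (intro exI[of _ 1] exI[of _ p]) simp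
  next
    case sq
    thus ?thesis using triv p by (intro exI[of _ "p^2"] exI[of _ 1]) simp
  next
    case nsq
    have "norm (unit_sum (p^2) 0 u v w) \<le> real_of_int p ^ 4"
      by (rule norm_unit_sum_zero_le[OF assms(1,2) nsq(3)])
    also have "\<dots> \<le> 2 * real_of_int p ^ 4" by simp
    finally show ?thesis using nsq by (intro exI[of _ 1] exI[of _ 1]) simp
  next
    case high
    have "p ^ (s - 1) * p = p ^ s" using assms(4) by (simp add: power_eq_if)
    moreover have "p ^ (s - 1) dvd p ^ s" by (simp add: le_imp_power_dvd)
    ultimately show ?thesis using triv p high by (intro exI[of _ "p^(s-1)"] exI[of _ p]) simp
  next
    case zero
    thus ?thesis using unit_sum_zero_eq_0[OF assms(1,2) zero(3)] p by (intro exI[of _ 1] exI[of _ 1]) simp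
  qed
qed

text \<open>Induction along the descent. A descent step multiplies \<open>g\<close> by
  \<open>p\<close>, so a loss \<open>l\<close> inherited from a lower level divides the new
  \<open>g\<close>. Of the two contributions the larger one supplies the data; each level adds 2 to
  the constant.\<close>

lemma quad_sum_good_prime_bound:
  fixes p k :: int
  assumes "prime p" "odd p" "k = 0 \<or> \<not> p dvd k"
  shows "\<exists>g e l :: int. g > 0 \<and> e > 0 \<and> l > 0 \<and> g * e dvd p^s \<and> g dvd u \<and> g dvd v \<and> g dvd w \<and>
     g^2 * e dvd u^2 + v^2 + w^2 \<and> l dvd p \<and> ((k \<noteq> 0 \<and> s \<ge> 2) \<or> s = 2 \<longrightarrow> l dvd g) \<and>
     norm (quad_sum (p^s) k u v w) \<le> (2 * real s + 1) * real_of_int p ^ s * (real_of_int g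
         * sqrt (real_of_int (e * l)))"
proof (induction s arbitrary: u v w)
  case 0
  have "norm (quad_sum 1 k u v w) \<le> 1" using norm_quad_sum_le[of 1 k u v w] by simp
  thus ?case by (intro exI[of _ 1]) simp
next
  case (Suc s)
  have p: "p > 0" "p > 1" using prime_gt_1_int[OF assms(1)] by auto
  obtain e l where el: "e > 0" "l > 0" "e dvd p^Suc s" "e dvd u^2 + v^2 + w^2" "l dvd p"
     "(k \<noteq> 0 \<and> Suc s \<ge> 2) \<or> Suc s = 2 \<longrightarrow> l = 1"
     "norm (unit_sum (p^Suc s) k u v w) \<le> 2 * real_of_int p ^ (2 * Suc s) * sqrt (real_of_int (e * l))"
    using unit_sum_bound[OF assms, of "Suc s" u v w] by auto
  define X where "X = sqrt (real_of_int (e * l))"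
  have X: "X \<ge> 0" using el by (simp add: X_def)
  show ?case
  proof (cases "p dvd u \<and> p dvd v \<and> p dvd w")
    case False
    have "real_of_int p ^ Suc s * norm (quad_sum (p ^ Suc s) k u v w) = norm (of_int (p ^ Suc s)
        * quad_sum (p ^ Suc s) k u v w)"
      using p by (simp add: norm_mult norm_power)
    also have "\<dots> = norm (unit_sum (p^Suc s) k u v w)" using False
      by (subst quad_sum_prime_power_Suc[OF assms(1)]) auto
    also have "\<dots> \<le> 2 * real_of_int p ^ (2 * Suc s) * X" using el(7) by (simp only: X_def)
    also have "real_of_int p ^ (2 * Suc s) = real_of_int p ^ Suc s * real_of_int p ^ Suc s"
      by (simp only: power_add [symmetric] mult_2)
    also have "2 * (real_of_int p ^ Suc s * real_of_int p ^ Suc s) * X =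
        real_of_int p ^ Suc s * (2 * real_of_int p ^ Suc s * X)" by (simp only: mult_ac)
    finally have "norm (quad_sum (p ^ Suc s) k u v w) \<le> 2 * real_of_int p ^ Suc s * X"
      using p by (simp only: mult_le_cancel_left_pos zero_less_power of_int_0_less_iff)
    also have "\<dots> \<le> (2 * real (Suc s) + 1) * real_of_int p ^ Suc s * X"
      using X p by (intro mult_right_mono) auto
    finally show ?thesis using el by (intro exI[of _ 1] exI[of _ e] exI[of _ l]) (auto simp: X_def)
  next
    case True
    then obtain u' v' w' where u': "u = p * u'" "v = p * v'" "w = p * w'" by (auto elim!: dvdE)
    obtain g' e' l' where IH: "g' > 0" "e' > 0" "l' > 0" "g' * e' dvd p^s" "g' dvd u'" "g' dvd v'"
        "g' dvd w'"
      "g'^2 * e' dvd u'^2 + v'^2 + w'^2" "l' dvd p"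
      "norm (quad_sum (p^s) k u' v' w') \<le> (2 * real s + 1) * real_of_int p ^ s * (real_of_int g'
          * sqrt (real_of_int (e' * l')))"
      using Suc.IH[of u' v' w'] by auto
    define Y where "Y = real_of_int (p * g') * sqrt (real_of_int (e' * l'))"
    have Y: "Y \<ge> 0" using IH p by (simp add: Y_def)
    have "real_of_int p ^ Suc s * norm (quad_sum (p ^ Suc s) k u v w) = norm (of_int (p ^ Suc s)
        * quad_sum (p ^ Suc s) k u v w)"
      using p by (simp add: norm_mult norm_power)
    also have "\<dots> = norm (unit_sum (p^Suc s) k u v w + of_int (p ^ (s + 3)) * quad_sum (p^s) k u' v' w')"
        using p
      by (subst quad_sum_prime_power_Suc[OF assms(1)]) (simp add: u')
    also have "\<dots> \<le> norm (unit_sum (p^Suc s) k u v w) + norm (of_int (p ^ (s + 3))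
        * quad_sum (p^s) k u' v' w')"
      by (rule norm_triangle_ineq)
    also have "\<dots> = norm (unit_sum (p^Suc s) k u v w) + real_of_int p ^ (s + 3)
        * norm (quad_sum (p^s) k u' v' w')"
      using p by (simp add: norm_mult norm_power)
    also have "\<dots> \<le> 2 * real_of_int p ^ (2 * Suc s) * X + real_of_int p ^ (s + 3) *
        ((2 * real s + 1) * real_of_int p ^ s * (real_of_int g' * sqrt (real_of_int (e' * l'))))"
      using el(7) IH(10) p by (intro add_mono mult_left_mono) (auto simp: X_def)
    also have "\<dots> = real_of_int p ^ Suc s * (real_of_int p ^ Suc s * (2 * X + (2 * real s + 1) * Y))"
    proof -
      have "real_of_int p ^ (2 * Suc s) = real_of_int p ^ Suc s * real_of_int p ^ Suc s"
        by (simp only: power_add [symmetric] mult_2)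
      moreover have "real_of_int p ^ (s + 3) * real_of_int p ^ s = real_of_int p ^ Suc s
          * real_of_int p ^ Suc s * real_of_int p"
        by (simp add: power_add power3_eq_cube)
      moreover have "2 * Q * X + a * (c * b * (g * h)) = P * (P * (2 * X + c * (x * g * h)))"
        if "Q = P * P" "a * b = P * P * x" for P Q a b c g h x :: real
        using that by algebra
      ultimately show ?thesis unfolding Y_def of_int_mult by blast
    qed
    finally have *: "norm (quad_sum (p ^ Suc s) k u v w) \<le> real_of_int p ^ Suc s * (2 * X + (2 * real s
        + 1) * Y)"
      using p by (simp only: mult_le_cancel_left_pos zero_less_power of_int_0_less_iff)
    show ?thesis
    proof (cases "X \<ge> Y")
      case True
      have "2 * X + (2 * real s + 1) * Y \<le> 2 * X + (2 * real s + 1) * X"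
        using True by (intro add_mono mult_left_mono) auto
      also have "\<dots> = (2 * real (Suc s) + 1) * X" by (simp add: algebra_simps)
      finally have "norm (quad_sum (p ^ Suc s) k u v w) \<le> real_of_int p ^ Suc s * ((2 * real (Suc s)
          + 1) * X)"
        using p by (intro order.trans[OF *] mult_left_mono) auto
      thus ?thesis using el
        by (intro exI[of _ 1] exI[of _ e] exI[of _ l]) (auto simp: X_def mult_ac)
    next
      case False
      have "2 * X + (2 * real s + 1) * Y \<le> 2 * Y + (2 * real s + 1) * Y"
        using False by (intro add_mono mult_left_mono) auto
      also have "\<dots> = (2 * real (Suc s) + 1) * Y" by (simp add: algebra_simps)
      finally have n: "norm (quad_sum (p ^ Suc s) k u v w) \<le> real_of_int p ^ Suc s * ((2 * real (Suc s)
          + 1) * Y)"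
        using p by (intro order.trans[OF *] mult_left_mono) auto
      have "u^2 + v^2 + w^2 = p^2 * (u'^2 + v'^2 + w'^2)" by (simp add: u' power_mult_distrib algebra_simps)
      moreover have "(p * g')^2 * e' = p^2 * (g'^2 * e')" by (simp add: power_mult_distrib)
      ultimately have "(p * g')^2 * e' dvd u^2 + v^2 + w^2" using IH(8)
          by (simp only: mult_dvd_mono dvd_refl)
      moreover have "l' dvd p * g'" using IH(9) by (rule dvd_mult2)
      ultimately show ?thesis using IH p n u'
        by (intro exI[of _ "p * g'"] exI[of _ e'] exI[of _ l']) (auto simp: Y_def mult_ac)
    qed
  qed
qed

text \<open>Meant for the zero frequency. The normalised unit sum is estimated crudely by
  \<open>q^2\<close>, the same power that the recursion passes up from the lower level, so every
  level costs the same and only the factor \<open>s + 1\<close> accumulates.\<close>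

lemma norm_quad_sum_le_power:
  fixes p :: int
  assumes "prime p" "odd p"
  shows "norm (quad_sum (p^s) k u v w) \<le> (real s + 1) * real_of_int p ^ (2 * s)"
proof (induction s arbitrary: u v w)
  case 0
  show ?case using norm_quad_sum_le[of 1 k u v w] by simp
next
  case (Suc s)
  have p: "p > 0" "p > 1" using prime_gt_1_int[OF assms(1)] by auto
  define q where "q = p ^ Suc s"
  have q: "q > 0" "odd q" using p assms(2) by (auto simp: q_def)
  hence "q \<ge> 1" by simp
  note q = q this
  have sq: "sqrt (real_of_int q) ^ 3 \<le> real_of_int q ^ 2"
  proof -
    have "sqrt (real_of_int q) ^ 3 \<le> sqrt (real_of_int q) ^ 4" by (rule power_increasing) (use q in auto)
    also have "\<dots> = (sqrt (real_of_int q) ^ 2) ^ 2" by simp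
    also have "sqrt (real_of_int q) ^ 2 = real_of_int q" using q(1)
        by (simp only: real_sqrt_pow2 of_int_0_le_iff less_imp_le)
    finally show ?thesis .
  qed
  have "real_of_int q * norm (quad_sum q k u v w) = norm (of_int q * quad_sum q k u v w)"
    using q by (simp add: norm_mult)
  also have "\<dots> \<le> norm (unit_sum q k u v w) + norm (if p dvd u \<and> p dvd v \<and> p dvd w
      then of_int (p ^ (s + 3)) * quad_sum (p^s) k (u div p) (v div p) (w div p) else 0)"
    unfolding q_def quad_sum_prime_power_Suc[OF assms(1)] by (rule norm_triangle_ineq)
  also have "\<dots> \<le> real_of_int q * real_of_int q ^ 2 + real_of_int p ^ (s + 3) * ((real s + 1)
      * real_of_int p ^ (2 * s))"
  proof (rule add_mono)
    have "norm (unit_sum q k u v w) \<le> real_of_int q * sqrt (real_of_int q) ^ 3"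
        by (rule norm_unit_sum_le[OF q(1,2)])
    also have "\<dots> \<le> real_of_int q * real_of_int q ^ 2" using q by (intro mult_left_mono sq) auto
    finally show "norm (unit_sum q k u v w) \<le> real_of_int q * real_of_int q ^ 2" .
    show "norm (if p dvd u \<and> p dvd v \<and> p dvd w then of_int (p ^ (s + 3))
        * quad_sum (p^s) k (u div p) (v div p) (w div p) else 0)
       \<le> real_of_int p ^ (s + 3) * ((real s + 1) * real_of_int p ^ (2 * s))"
      using p Suc.IH by (auto simp: norm_mult norm_power intro!: mult_left_mono)
  qed
  also have "\<dots> = real_of_int q * ((real (Suc s) + 1) * real_of_int p ^ (2 * Suc s))"
  proof -
    have "real_of_int p ^ (2 * Suc s) = real_of_int q ^ 2"
      by (simp only: q_def of_int_power power_mult [symmetric] mult.commute)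
    moreover have "real_of_int p ^ (s + 3) * real_of_int p ^ (2 * s) = real_of_int q * real_of_int q ^ 2"
      unfolding q_def of_int_power power_mult [symmetric] power_add [symmetric]
      by (rule arg_cong[of _ _ "(^) (real_of_int p)"]) simp
    ultimately show ?thesis by (simp add: algebra_simps)
  qed
  finally show ?case using q by (simp only: q_def [symmetric] mult_le_cancel_left_pos of_int_0_less_iff)
qed

text \<open>The summand \<open>(\<bar>k\<bar> + 2)^(2 * r)\<close> pays for the trivial bound at the bad primes (2 and the divisors
  of \<open>k \<noteq> 0\<close>), so that the local estimates hold at all primes with one constant.\<close>

definition loc_const :: "nat \<Rightarrow> int \<Rightarrow> real" where
  "loc_const r k = real_of_int (\<bar>k\<bar> + 2) ^ (2 * r) + 2 * real r + 1"

lemma loc_const_ge_1: "loc_const r k \<ge> 1"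
  by (simp add: loc_const_def)

lemma not_good_prime_le:
  fixes p k :: int
  assumes "prime p" "\<not> (odd p \<and> (k = 0 \<or> \<not> p dvd k))"
  shows "p \<le> \<bar>k\<bar> + 2"
proof (cases "odd p")
  case True
  hence "k \<noteq> 0" "p dvd k" using assms by auto
  hence "p dvd \<bar>k\<bar>" "\<bar>k\<bar> > 0" by auto
  hence "p \<le> \<bar>k\<bar>" by (rule zdvd_imp_le)
  thus ?thesis by simp
next
  case False
  hence "p \<le> 2" using assms(1) prime_odd_int[of p] by force
  thus ?thesis by simp
qed

lemma quad_sum_prime_power_bound:
  fixes p k :: int
  assumes "prime p" "r \<ge> 2"
  shows "\<exists>g e l :: int. g > 0 \<and> e > 0 \<and> l > 0 \<and> g * e dvd p^r \<and> g dvd u \<and> g dvd v \<and> g dvd w \<and>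
     g^2 * e dvd u^2 + v^2 + w^2 \<and> l dvd p \<and> (k \<noteq> 0 \<or> r = 2 \<longrightarrow> l dvd g) \<and>
     norm (quad_sum (p^r) k u v w) \<le> loc_const r k * real_of_int p ^ r * (real_of_int g
         * sqrt (real_of_int (e * l)))"
proof (cases "odd p \<and> (k = 0 \<or> \<not> p dvd k)")
  case True
  have p: "p > 0" using prime_gt_1_int[OF assms(1)] by auto
  obtain g e l where *: "g > 0" "e > 0" "l > 0" "g * e dvd p^r" "g dvd u" "g dvd v" "g dvd w"
     "g^2 * e dvd u^2 + v^2 + w^2" "l dvd p" "k \<noteq> 0 \<or> r = 2 \<longrightarrow> l dvd g"
     "norm (quad_sum (p^r) k u v w) \<le> (2 * real r + 1) * real_of_int p ^ r * (real_of_int g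
         * sqrt (real_of_int (e * l)))"
    using quad_sum_good_prime_bound[of p k r u v w] True assms by auto
  note *(11)
  also have "(2 * real r + 1) * real_of_int p ^ r * (real_of_int g * sqrt (real_of_int (e * l))) \<le>
    loc_const r k * real_of_int p ^ r * (real_of_int g * sqrt (real_of_int (e * l)))"
    using *(1-3) p by (intro mult_right_mono) (auto simp: loc_const_def)
  finally show ?thesis using * by blast
next
  case False
  have p: "p > 0" using prime_gt_1_int[OF assms(1)] by auto
  have "norm (quad_sum (p^r) k u v w) \<le> real_of_int (p^r) ^ 3" using norm_quad_sum_le[of "p^r"] p by simp
  also have "\<dots> = real_of_int p ^ (2 * r) * real_of_int p ^ r"
    by (simp add: mult_2 power_add power3_eq_cube)
  also have "\<dots> \<le> loc_const r k * real_of_int p ^ r"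
  proof (rule mult_right_mono)
    have "real_of_int p ^ (2 * r) \<le> real_of_int (\<bar>k\<bar> + 2) ^ (2 * r)"
      using not_good_prime_le[OF assms(1) False] p by (intro power_mono) auto
    thus "real_of_int p ^ (2 * r) \<le> loc_const r k" by (simp add: loc_const_def)
  qed (use p in auto)
  finally show ?thesis by (intro exI[of _ 1]) simp
qed

text \<open>Only \<open>p = 2\<close> is exceptional here, as the bound for odd primes holds whether
  or not \<open>p\<close> divides \<open>k\<close>. At 2 the trivial bound \<open>p^(3 * r)\<close>
  is absorbed by \<open>loc_const\<close>.\<close>

lemma norm_quad_sum_prime_power_le:
  fixes p k :: int
  assumes "prime p"
  shows "norm (quad_sum (p^r) k 0 0 0) \<le> loc_const r k * real_of_int p ^ (2 * r)"
proof (cases "odd p")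
  case True
  have p: "p > 0" using prime_gt_1_int[OF assms(1)] by auto
  have "norm (quad_sum (p^r) k 0 0 0) \<le> (real r + 1) * real_of_int p ^ (2 * r)"
    by (rule norm_quad_sum_le_power[OF assms True])
  also have "\<dots> \<le> loc_const r k * real_of_int p ^ (2 * r)"
  proof (rule mult_right_mono)
    have "(0::real) \<le> real_of_int (\<bar>k\<bar> + 2) ^ (2 * r)" by simp
    thus "real r + 1 \<le> loc_const r k" unfolding loc_const_def by linarith
  qed (use p in auto)
  finally show ?thesis .
next
  case False
  have p: "p > 0" using prime_gt_1_int[OF assms(1)] by auto
  have "norm (quad_sum (p^r) k 0 0 0) \<le> real_of_int (p^r) ^ 3" using norm_quad_sum_le[of "p^r"] p by simp
  also have "\<dots> = real_of_int p ^ r * real_of_int p ^ (2 * r)"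
    by (simp add: mult_2 power_add power3_eq_cube)
  also have "\<dots> \<le> loc_const r k * real_of_int p ^ (2 * r)"
  proof (rule mult_right_mono)
    have "real_of_int p ^ r \<le> real_of_int p ^ (2 * r)" using p by (intro power_increasing) auto
    also have "\<dots> \<le> real_of_int (\<bar>k\<bar> + 2) ^ (2 * r)"
      using not_good_prime_le[OF assms(1), of k] False p by (intro power_mono) auto
    finally show "real_of_int p ^ r \<le> loc_const r k" by (simp add: loc_const_def)
  qed (use p in auto)
  finally show ?thesis .
qed

section \<open>Powers of squarefree moduli\<close>

lemma periodic_gauss_sums: "periodic q (\<lambda>t. ee q (t * k) * gauss_sum q t u * gauss_sum q t v
    * gauss_sum q t w)"
  unfolding periodic_def
proof (intro allI impI)
  fix x y assume xy: "[x = y] (mod q)"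
  have "ee q (x * k) = ee q (y * k)" by (intro ee_cong cong_mult xy cong_refl)
  thus "ee q (x * k) * gauss_sum q x u * gauss_sum q x v * gauss_sum q x w = ee q (y * k)
      * gauss_sum q y u * gauss_sum q y v * gauss_sum q y w"
    using gauss_sum_cong[OF xy] by simp
qed

text \<open>With the variable written as \<open>b * i + a * j\<close>, all cross terms are multiples
  of \<open>a * b\<close>. The factor \<open>b^2\<close> left in front of \<open>s\<close> is
  removed by \<open>i\<close> to \<open>b' * i\<close>, at the price of the unit \<open>b'\<close>
  in the frequency.\<close>

lemma gauss_sum_crt:
  assumes "a > 0" "b > 0" "coprime a b" "[b * b' = 1] (mod a)" "[a * a' = 1] (mod b)"
  shows "gauss_sum (a * b) (b * s + a * t) u = gauss_sum a s (b' * u) * gauss_sum b t (a' * u)"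
proof -
  have twist: "(\<Sum>i=0..<a. ee a (b^2 * s * i^2 + u * i)) = gauss_sum a s (b' * u)"
    if "a > 0" "[b * b' = 1] (mod a)" for a b b' s
  proof -
    have per: "periodic a (\<lambda>i. ee a (b^2 * s * i^2 + u * i))"
      unfolding periodic_def by (auto intro!: ee_cong cong_add cong_mult cong_pow)
    have "coprime b' a" using that(2) by (metis coprime_iff_invertible_int mult.commute)
    from sum_scale_mod[OF that(1) per this]
    have "(\<Sum>i=0..<a. ee a (b^2 * s * i^2 + u * i)) = (\<Sum>i=0..<a. ee a (b^2 * s * (b' * i)^2 + u * (b' * i)))"
      by simp
    also have "\<dots> = gauss_sum a s (b' * u)"
      unfolding gauss_sum_def
    proof (intro sum.cong refl ee_cong cong_add)
      fix i
      have "[(b * b')^2 * (s * i^2) = 1^2 * (s * i^2)] (mod a)"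
        by (intro cong_mult cong_pow that cong_refl)
      thus "[b^2 * s * (b' * i)^2 = s * i^2] (mod a)" by (simp add: power_mult_distrib mult_ac)
    qed (simp add: mult_ac)
    finally show ?thesis .
  qed
  have per: "periodic (a*b) (\<lambda>x. ee (a*b) ((b * s + a * t) * x^2 + u * x))"
    unfolding periodic_def by (auto intro!: ee_cong cong_add cong_mult cong_pow)
  have "gauss_sum (a * b) (b * s + a * t) u =
     (\<Sum>i=0..<a. \<Sum>j=0..<b. ee (a*b) ((b * s + a * t) * (b * i + a * j)^2 + u * (b * i + a * j)))"
    unfolding gauss_sum_def by (rule sum_crt[OF assms(1-3) per])
  also have "\<dots> = (\<Sum>i=0..<a. \<Sum>j=0..<b. ee a (b^2 * s * i^2 + u * i) * ee b (a^2 * t * j^2 + u * j))"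
  proof (intro sum.cong refl)
    fix i j
    have "ee (a*b) ((b * s + a * t) * (b * i + a * j)^2 + u * (b * i + a * j)) =
      ee (a*b) ((b * (b^2 * s * i^2 + u * i) + a * (a^2 * t * j^2 + u * j)) +
        (a * b) * (2 * (b * s + a * t) * i * j + a * s * j^2 + b * t * i^2))"
      by (rule arg_cong[of _ _ "ee (a*b)"]) algebra
    also have "\<dots> = ee (a*b) (b * (b^2 * s * i^2 + u * i)) * ee (a*b) (a * (a^2 * t * j^2 + u * j)) *
       ee (a*b) ((a * b) * (2 * (b * s + a * t) * i * j + a * s * j^2 + b * t * i^2))"
      by (simp only: ee_add)
    also have "ee (a*b) ((a * b) * (2 * (b * s + a * t) * i * j + a * s * j^2 + b * t * i^2)) = 1"
      by (rule ee_dvd) simp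
    also have "ee (a*b) (b * (b^2 * s * i^2 + u * i)) = ee a (b^2 * s * i^2 + u * i)"
      unfolding mult.commute[of a b] by (rule ee_mult_cancel) (use assms in simp)
    also have "ee (a*b) (a * (a^2 * t * j^2 + u * j)) = ee b (a^2 * t * j^2 + u * j)"
      by (rule ee_mult_cancel) (use assms in simp)
    finally show "ee (a*b) ((b * s + a * t) * (b * i + a * j)^2 + u * (b * i + a * j)) =
       ee a (b^2 * s * i^2 + u * i) * ee b (a^2 * t * j^2 + u * j)" by simp
  qed
  also have "\<dots> = (\<Sum>i=0..<a. ee a (b^2 * s * i^2 + u * i)) * (\<Sum>j=0..<b. ee b (a^2 * t * j^2 + u * j))"
    by (simp only: sum_product)
  also have "\<dots> = gauss_sum a s (b' * u) * gauss_sum b t (a' * u)"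
    using twist[OF assms(1,4)] twist[OF assms(2,5)] by simp
  finally show ?thesis .
qed

lemma quad_sum_crt:
  assumes "a > 0" "b > 0" "coprime a b" "[b * b' = 1] (mod a)" "[a * a' = 1] (mod b)"
  shows "quad_sum (a * b) k u v w = quad_sum a k (b' * u) (b' * v) (b' * w) * quad_sum b k (a' * u) (a'
      * v) (a' * w)"
proof -
  have ab: "a * b > 0" using assms by simp
  define f where "f = (\<lambda>s. ee a (s * k) * gauss_sum a s (b' * u) * gauss_sum a s (b' * v)
      * gauss_sum a s (b' * w))"
  define g where "g = (\<lambda>s. ee b (s * k) * gauss_sum b s (a' * u) * gauss_sum b s (a' * v)
      * gauss_sum b s (a' * w))"
  have "of_int (a * b) * quad_sum (a * b) k u v w =
     (\<Sum>t=0..<a*b. ee (a*b) (t * k) * gauss_sum (a*b) t u * gauss_sum (a*b) t v * gauss_sum (a*b) t w)"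
    by (rule quad_sum_eq_gauss[OF ab])
  also have "\<dots> = (\<Sum>s=0..<a. \<Sum>t=0..<b. ee (a*b) ((b * s + a * t) * k) * gauss_sum (a*b) (b * s + a * t) u *
      gauss_sum (a*b) (b * s + a * t) v * gauss_sum (a*b) (b * s + a * t) w)"
    by (rule sum_crt[OF assms(1-3) periodic_gauss_sums])
  also have "\<dots> = (\<Sum>s=0..<a. \<Sum>t=0..<b. f s * g t)"
  proof (intro sum.cong refl)
    fix s t
    have "ee (a*b) ((b * s + a * t) * k) = ee (a*b) (b * (s * k)) * ee (a*b) (a * (t * k))"
      unfolding ee_add [symmetric] by (simp add: algebra_simps)
    also have "ee (a*b) (b * (s * k)) = ee a (s * k)"
      unfolding mult.commute[of a b] by (rule ee_mult_cancel) (use assms in simp)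
    also have "ee (a*b) (a * (t * k)) = ee b (t * k)"
      by (rule ee_mult_cancel) (use assms in simp)
    finally show "ee (a*b) ((b * s + a * t) * k) * gauss_sum (a*b) (b * s + a * t) u *
      gauss_sum (a*b) (b * s + a * t) v * gauss_sum (a*b) (b * s + a * t) w = f s * g t"
      by (simp add: gauss_sum_crt[OF assms] f_def g_def)
  qed
  also have "\<dots> = (\<Sum>s=0..<a. f s) * (\<Sum>t=0..<b. g t)" by (simp only: sum_product)
  also have "(\<Sum>s=0..<a. f s) = of_int a * quad_sum a k (b' * u) (b' * v) (b' * w)"
    unfolding f_def by (rule quad_sum_eq_gauss[OF assms(1), symmetric])
  also have "(\<Sum>t=0..<b. g t) = of_int b * quad_sum b k (a' * u) (a' * v) (a' * w)"
    unfolding g_def by (rule quad_sum_eq_gauss[OF assms(2), symmetric])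
  finally show ?thesis using assms by simp
qed

text \<open>Multiplicativity of \<open>quad_sum\<close> multiplies the frequencies by units. This
  does not affect divisibility by \<open>g\<close> and \<open>g^2 * e\<close>, which are built from
  divisors of \<open>q\<close>.\<close>

lemma bounding_data_unscale:
  fixes g e q c u v w :: int
  assumes "g * e dvd q" "coprime c q" "g dvd c * u" "g dvd c * v" "g dvd c * w"
    "g^2 * e dvd (c * u)^2 + (c * v)^2 + (c * w)^2"
  shows "g dvd u" "g dvd v" "g dvd w" "g^2 * e dvd u^2 + v^2 + w^2"
proof -
  have cg: "coprime g c" using assms(1,2)
    by (metis coprime_commute coprime_divisors dvd_mult_left dvd_refl)
  show "g dvd u" "g dvd v" "g dvd w" using assms(3-5) cg coprime_dvd_mult_right_iff by blast+
  have ce: "coprime e c" using assms(1,2)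
    by (metis coprime_commute coprime_divisors dvd_mult_right dvd_refl)
  have "coprime (g^2 * e) (c^2)" using cg ce by simp
  moreover have "(c * u)^2 + (c * v)^2 + (c * w)^2 = c^2 * (u^2 + v^2 + w^2)" by algebra
  ultimately show "g^2 * e dvd u^2 + v^2 + w^2" using assms(6) coprime_dvd_mult_right_iff by metis
qed

lemma coprime_prime_prod:
  fixes p :: nat
  assumes "finite A" "prime p" "\<And>q. q \<in> A \<Longrightarrow> prime q" "p \<notin> A"
  shows "coprime p (\<Prod>A)"
  using assms by (intro prod_coprime_right) (metis primes_coprime)

text \<open>The local triples \<open>(g, e, l)\<close> are multiplied together. Divisors of coprime
  moduli are coprime, so their divisibility conditions combine; one factor \<open>loc_const\<close>
  is spent per prime.\<close>

lemma quad_sum_squarefree_bound: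
  fixes A :: "nat set"
  assumes "finite A" "\<And>p. p \<in> A \<Longrightarrow> prime p" "r \<ge> 2"
  shows "\<exists>g e l :: int. g > 0 \<and> e > 0 \<and> l > 0 \<and> g * e dvd int (\<Prod>A)^r \<and> g dvd u \<and> g dvd v \<and> g dvd w \<and>
     g^2 * e dvd u^2 + v^2 + w^2 \<and> l dvd int (\<Prod>A) \<and> (k \<noteq> 0 \<or> r = 2 \<longrightarrow> l dvd g) \<and>
     norm (quad_sum (int (\<Prod>A)^r) k u v w) \<le> loc_const r k ^ card A * real (\<Prod>A) ^ r *
       (real_of_int g * sqrt (real_of_int (e * l)))"
  using assms(1,2)
proof (induction A arbitrary: u v w rule: finite_induct)
  case empty
  thus ?case using norm_quad_sum_le[of 1 k u v w] by (intro exI[of _ 1]) simp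
next
  case (insert p A)
  define d where "d = \<Prod>A"
  define a where "a = int p ^ r"
  define b where "b = int d ^ r"
  have p: "prime p" "prime (int p)" "p > 0" using insert.prems by (auto simp: prime_gt_0_nat)
  have A: "\<And>q. q \<in> A \<Longrightarrow> prime q" using insert.prems by auto
  hence d0: "d > 0" unfolding d_def by (intro prod_pos) (auto simp: prime_gt_0_nat)
  have "coprime p d" unfolding d_def by (rule coprime_prime_prod) (use insert p A in auto)
  hence cpd: "coprime (int p) (int d)" by simp
  hence cop: "coprime a b" by (simp add: a_def b_def)
  have pos: "a > 0" "b > 0" using p d0 by (auto simp: a_def b_def)
  obtain b' where b': "[b * b' = 1] (mod a)" using cong_solve_coprime_int cop coprime_commute by blast
  obtain a' where a': "[a * a' = 1] (mod b)" using cong_solve_coprime_int cop coprime_commute by blast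
  have cb': "coprime b' a" using b' by (metis coprime_iff_invertible_int mult.commute)
  have ca': "coprime a' b" using a' by (metis coprime_iff_invertible_int mult.commute)
  obtain g1 e1 l1 where 1: "g1 > 0" "e1 > 0" "l1 > 0" "g1 * e1 dvd a"
     "g1 dvd b' * u" "g1 dvd b' * v" "g1 dvd b' * w"
     "g1^2 * e1 dvd (b' * u)^2 + (b' * v)^2 + (b' * w)^2" "l1 dvd int p" "k \<noteq> 0 \<or> r = 2 \<longrightarrow> l1 dvd g1"
     "norm (quad_sum a k (b' * u) (b' * v) (b' * w)) \<le> loc_const r k * real_of_int (int p) ^ r
         * (real_of_int g1 * sqrt (real_of_int (e1 * l1)))"
    unfolding a_def using quad_sum_prime_power_bound[OF p(2) assms(3), of "b' * u" "b' * v" "b' * w" k]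
        by blast
  obtain g2 e2 l2 where 2: "g2 > 0" "e2 > 0" "l2 > 0" "g2 * e2 dvd b"
     "g2 dvd a' * u" "g2 dvd a' * v" "g2 dvd a' * w"
     "g2^2 * e2 dvd (a' * u)^2 + (a' * v)^2 + (a' * w)^2" "l2 dvd int d" "k \<noteq> 0 \<or> r = 2 \<longrightarrow> l2 dvd g2"
     "norm (quad_sum b k (a' * u) (a' * v) (a' * w)) \<le> loc_const r k ^ card A * real d ^ r
         * (real_of_int g2 * sqrt (real_of_int (e2 * l2)))"
    unfolding b_def d_def using insert.IH[OF A, of "a' * u" "a' * v" "a' * w"] by blast
  note u1 = bounding_data_unscale[OF 1(4) cb' 1(5-8)]
  note u2 = bounding_data_unscale[OF 2(4) ca' 2(5-8)]
  have cge: "coprime (g1 * e1) (g2 * e2)" using coprime_divisors[OF 1(4) 2(4) cop] .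
  hence cg: "coprime g1 g2" "coprime (g1^2 * e1) (g2^2 * e2)" by auto
  have prod: "\<Prod>(insert p A) = p * d" using insert by (simp add: d_def)
  have card: "card (insert p A) = Suc (card A)" using insert by simp
  define g e l where "g = g1 * g2" and "e = e1 * e2" and "l = l1 * l2"
  have "norm (quad_sum (int (p * d) ^ r) k u v w) = norm (quad_sum a k (b' * u) (b' * v) (b' * w))
      * norm (quad_sum b k (a' * u) (a' * v) (a' * w))"
    using quad_sum_crt[OF pos cop b' a', of k u v w] by (simp add: a_def b_def power_mult_distrib norm_mult)
  also have "\<dots> \<le> (loc_const r k * real_of_int (int p) ^ r * (real_of_int g1 * sqrt (real_of_int (e1
      * l1)))) *
     (loc_const r k ^ card A * real d ^ r * (real_of_int g2 * sqrt (real_of_int (e2 * l2))))"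
    using 1 2 loc_const_ge_1[of r k] by (intro mult_mono) (auto intro!: mult_nonneg_nonneg zero_le_power)
  also have "\<dots> = loc_const r k ^ Suc (card A) * real (p * d) ^ r * (real_of_int g * sqrt (real_of_int (e
      * l)))"
    by (simp add: g_def e_def l_def power_mult_distrib real_sqrt_mult mult_ac)
  finally have n: "norm (quad_sum (int (p * d) ^ r) k u v w) \<le> \<dots>" .
  have "g * e dvd int (p * d) ^ r"
    using mult_dvd_mono[OF 1(4) 2(4)] by (simp add: g_def e_def a_def b_def power_mult_distrib mult_ac)
  moreover have "g dvd u" "g dvd v" "g dvd w" unfolding g_def
    using u1 u2 cg by (auto intro: divides_mult)
  moreover have "g^2 * e dvd u^2 + v^2 + w^2"
    using divides_mult[OF u1(4) u2(4) cg(2)] by (simp add: g_def e_def power_mult_distrib mult_ac)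
  moreover have "l dvd int (p * d)" using mult_dvd_mono[OF 1(9) 2(9)] by (simp add: l_def)
  moreover have "k \<noteq> 0 \<or> r = 2 \<longrightarrow> l dvd g" using 1(10) 2(10) by (auto simp: l_def g_def)
  moreover have "g > 0" "e > 0" "l > 0" using 1 2 by (auto simp: g_def e_def l_def)
  ultimately show ?case unfolding prod card using n by blast
qed

section \<open>The zero frequency and the solution counts\<close>

lemma quad_sum_eq_lam:
  assumes "q > 0"
  shows "quad_sum (int q) k 0 0 0 = of_nat (lam q k)"
proof -
  let ?P = "\<lambda>x y z. int q dvd x^2 + y^2 + z^2 + k"
  let ?f = "\<lambda>x y z. if ?P x y z then 1 else (0::complex)"
  have c: "?P x y z = ?P x' y' z'" if "[x = x'] (mod int q)" "[y = y'] (mod int q)" "[z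
      = z'] (mod int q)" for x y z x' y' z'
    by (rule cong_dvd_iff) (intro cong_add cong_pow that cong_refl)
  have "quad_sum (int q) k 0 0 0 = (\<Sum>x=0..<int q. \<Sum>y=0..<int q. \<Sum>z=0..<int q. ?f x y z)"
    by (simp add: quad_sum_def cong: if_cong)
  also have "\<dots> = (\<Sum>x=1..<1+int q. \<Sum>y=1..<1+int q. \<Sum>z=1..<1+int q. ?f x y z)"
  proof -
    have "(\<Sum>z=0..<int q. ?f x y z) = (\<Sum>z=1..<1+int q. ?f x y z)" for x y
      by (rule sum_translate_mod[symmetric], use assms in simp, unfold periodic_def,
          intro allI impI sum.cong if_cong c refl cong_refl)
    moreover have "(\<Sum>y=0..<int q. \<Sum>z=1..<1+int q. ?f x y z) = (\<Sum>y=1..<1+int q. \<Sum>z=1..<1+int q.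
        ?f x y z)" for x
      by (rule sum_translate_mod[symmetric], use assms in simp, unfold periodic_def,
          intro allI impI sum.cong if_cong c refl cong_refl)
    moreover have "(\<Sum>x=0..<int q. \<Sum>y=1..<1+int q. \<Sum>z=1..<1+int q. ?f x y z) =
       (\<Sum>x=1..<1+int q. \<Sum>y=1..<1+int q. \<Sum>z=1..<1+int q. ?f x y z)"
      by (rule sum_translate_mod[symmetric], use assms in simp, unfold periodic_def,
          intro allI impI sum.cong if_cong c refl cong_refl)
    ultimately show ?thesis by simp
  qed
  also have "{1..<1+int q} = {1..int q}" by auto
  also have "(\<Sum>x\<in>{1..int q}. \<Sum>y\<in>{1..int q}. \<Sum>z\<in>{1..int q}. ?f x y z) =
     (\<Sum>(x,y,z)\<in>{1..int q}\<times>{1..int q}\<times>{1..int q}. ?f x y z)"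
    by (simp add: sum.cartesian_product)
  also have "\<dots> = of_nat (card {(x,y,z). (x,y,z) \<in> {1..int q}\<times>{1..int q}\<times>{1..int q} \<and> ?P x y z})"
    by (simp add: sum.If_cases case_prod_unfold Int_def) (rule arg_cong[of _ _ card], auto)
  also have "{(x,y,z). (x,y,z) \<in> {1..int q}\<times>{1..int q}\<times>{1..int q} \<and> ?P x y z} = {(x :: int, y :: int,
      z :: int).
     x \<in> {1..int q} \<and> y \<in> {1..int q} \<and> z \<in> {1..int q} \<and> [x\<^sup>2 + y\<^sup>2 + z\<^sup>2 + k = 0] (mod int q)}"
    by (auto simp: cong_0_iff)
  finally show ?thesis by (simp add: lam_def)
qed

text \<open>Multiplicativity of \<open>quad_sum\<close> at the zero frequency, where the unit
  factors in the frequencies disappear.\<close>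

lemma lam_prod_primes:
  fixes A :: "nat set"
  assumes "finite A" "\<And>p. p \<in> A \<Longrightarrow> prime p"
  shows "lam ((\<Prod>A) ^ r) k = (\<Prod>p\<in>A. lam (p ^ r) k)"
  using assms
proof (induction A rule: finite_induct)
  case empty
  have "quad_sum (int 1) k 0 0 0 = of_nat (lam 1 k)" by (rule quad_sum_eq_lam) simp
  moreover have "quad_sum (int 1) k 0 0 0 = 1" by (simp add: quad_sum_def)
  ultimately have "lam 1 k = 1" by (metis of_nat_eq_1_iff)
  thus ?case by simp
next
  case (insert p A)
  define d where "d = \<Prod>A"
  have p: "prime p" "p > 0" using insert.prems by (auto simp: prime_gt_0_nat)
  have A: "\<And>q. q \<in> A \<Longrightarrow> prime q" using insert.prems by auto
  hence d0: "d > 0" unfolding d_def by (intro prod_pos) (auto simp: prime_gt_0_nat)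
  have "coprime p d" unfolding d_def by (rule coprime_prime_prod) (use insert p A in auto)
  hence cop: "coprime (int (p^r)) (int (d^r))" by simp
  obtain b' where b': "[int (d^r) * b' = 1] (mod int (p^r))"
      using cong_solve_coprime_int cop coprime_commute by blast
  obtain a' where a': "[int (p^r) * a' = 1] (mod int (d^r))"
      using cong_solve_coprime_int cop coprime_commute by blast
  have "of_nat (lam ((p * d)^r) k) = quad_sum (int ((p * d)^r)) k 0 0 0"
    using p d0 by (intro quad_sum_eq_lam [symmetric]) simp
  also have "\<dots> = quad_sum (int (p^r)) k 0 0 0 * quad_sum (int (d^r)) k 0 0 0"
    using quad_sum_crt[OF _ _ cop b' a', of k 0 0 0] p d0 by (simp add: power_mult_distrib)
  also have "\<dots> = of_nat (lam (p^r) k) * of_nat (lam (d^r) k)"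
    using p d0 by (simp only: quad_sum_eq_lam zero_less_power)
  finally have "lam ((p * d)^r) k = lam (p^r) k * lam (d^r) k"
    by (metis of_nat_eq_iff of_nat_mult)
  thus ?case using insert A by (simp add: d_def)
qed

lemma lam_prime_power_le:
  assumes "prime p"
  shows "real (lam (p ^ r) k) \<le> loc_const r k * real p ^ (2 * r)"
proof -
  have "p > 0" using assms by (simp add: prime_gt_0_nat)
  hence "real (lam (p ^ r) k) = norm (quad_sum (int p ^ r) k 0 0 0)"
    using quad_sum_eq_lam[of "p^r" k] by (simp add: norm_of_nat)
  also have "\<dots> \<le> loc_const r k * real_of_int (int p) ^ (2 * r)"
    by (rule norm_quad_sum_prime_power_le) (use assms in simp)
  finally show ?thesis by simp
qed

section \<open>Completion\<close>

definition pdivs :: "int \<Rightarrow> int set" where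
  "pdivs n = {d. 0 < d \<and> d dvd n}"

lemma finite_pdivs: "n > 0 \<Longrightarrow> finite (pdivs n)"
  unfolding pdivs_def by (rule finite_subset[of _ "{1..n}"]) (auto dest: zdvd_imp_le)

lemma card_pdivs_mono: "m dvd n \<Longrightarrow> n > 0 \<Longrightarrow> card (pdivs m) \<le> card (pdivs n)"
  by (rule card_mono[OF finite_pdivs]) (auto simp: pdivs_def intro: dvd_trans)

lemma sum_inverse_le_ln:
  assumes "X \<ge> 1"
  shows "(\<Sum>j\<in>{1..X}. 1 / real_of_int j) \<le> 1 + ln (real_of_int X)"
proof -
  have "(\<Sum>j\<in>{1..X}. 1 / real_of_int j) = harm (nat X)"
    unfolding harm_def
    by (rule sum.reindex_bij_witness[of _ int nat]) (use assms in \<open>auto simp: field_simps\<close>)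
  also have "\<dots> \<le> 1 + ln (real (nat X))"
    using euler_mascheroni_sequence_decreasing[of 1 "nat X"] assms by (force simp: harm_expand)
  finally show ?thesis using assms by simp
qed

text \<open>The least element contributes at most \<open>1 / W0\<close>. The others exceed it by
  \<open>f * j\<close> with distinct \<open>j \<ge> 1\<close>, so their reciprocals are dominated by
  a harmonic sum divided by \<open>f\<close>.\<close>

lemma sum_inverse_class_le:
  fixes B :: "int set"
  assumes "finite B" "f > 0" "W0 > 0" "X \<ge> 1"
    and W0: "\<And>w. w \<in> B \<Longrightarrow> W0 \<le> real_of_int w" and X: "\<And>w. w \<in> B \<Longrightarrow> w \<le> X"
    and cls: "\<And>w w'. w \<in> B \<Longrightarrow> w' \<in> B \<Longrightarrow> f dvd w - w'"
  shows "(\<Sum>w\<in>B. 1 / real_of_int w) \<le> 1 / W0 + (1 + ln (real_of_int X)) / real_of_int f"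
proof (cases "B = {}")
  case True
  thus ?thesis using assms by simp
next
  case False
  define w0 where "w0 = Min B"
  have w0: "w0 \<in> B" "\<And>w. w \<in> B \<Longrightarrow> w0 \<le> w" using assms(1) False by (auto simp: w0_def)
  have w0pos: "w0 > 0" using W0[OF w0(1)] assms(3) by linarith
  have j: "w = w0 + f * ((w - w0) div f)" if "w \<in> B" for w
    using cls[OF that w0(1)] by simp
  have "(\<Sum>w\<in>B - {w0}. 1 / real_of_int w) \<le> (\<Sum>j\<in>{1..X}. 1 / real_of_int (f * j))"
  proof (rule sum_le_included[where i = "\<lambda>j. w0 + f * j"])
    show "\<forall>w\<in>B - {w0}. \<exists>y\<in>{1..X}. w0 + f * y = w \<and> 1 / real_of_int w \<le> 1 / real_of_int (f * y)"
    proof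
      fix w assume w: "w \<in> B - {w0}"
      define y where "y = (w - w0) div f"
      have wy: "w = w0 + f * y" using j w by (auto simp: y_def)
      have "w0 < w" using w0(2)[of w] w by auto
      hence "f * y > 0" using wy by simp
      hence y: "y > 0" using assms(2) by (simp add: zero_less_mult_iff)
      have "1 * y \<le> f * y" using assms(2) y by (intro mult_right_mono) auto
      also have "\<dots> \<le> X" using X[of w] w wy w0pos by simp
      finally have "y \<le> X" by simp
      moreover have "1 / real_of_int w \<le> 1 / real_of_int (f * y)"
        using wy w0pos \<open>f * y > 0\<close> by (intro divide_left_mono) (auto simp del: of_int_mult)
      ultimately show "\<exists>y\<in>{1..X}. w0 + f * y = w \<and> 1 / real_of_int w \<le> 1 / real_of_int (f * y)"
        using y wy by (intro bexI[of _ y]) auto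
    qed
  qed (use assms in auto)
  also have "\<dots> = (\<Sum>j\<in>{1..X}. 1 / real_of_int j) / real_of_int f"
    by (simp add: sum_divide_distrib mult.commute)
  also have "\<dots> \<le> (1 + ln (real_of_int X)) / real_of_int f"
    by (intro divide_right_mono sum_inverse_le_ln) (use assms in auto)
  finally have 1: "(\<Sum>w\<in>B - {w0}. 1 / real_of_int w) \<le> (1 + ln (real_of_int X)) / real_of_int f" .
  have "1 / real_of_int w0 \<le> 1 / W0" using W0[OF w0(1)] assms(3) w0pos by (intro divide_left_mono) auto
  thus ?thesis using 1 by (simp add: sum.remove[OF assms(1) w0(1)])
qed

text \<open>If \<open>w\<close> and \<open>w1\<close> are two square roots of the same residue modulo \<open>e\<close>, then \<open>e\<close> divides
  \<open>(w - w1) * (w + w1)\<close>, so \<open>w\<close> lies in one of \<open>\<tau>(e)\<close> residue classes, each to a modulus at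
  least \<open>sqrt e\<close>.\<close>

lemma sum_inverse_roots_le:
  fixes B :: "int set" and c e X :: int
  assumes "finite B" "e > 0" "W0 > 0" "X \<ge> 1"
    and W0: "\<And>w. w \<in> B \<Longrightarrow> W0 \<le> real_of_int w" and X: "\<And>w. w \<in> B \<Longrightarrow> w \<le> X"
    and e: "\<And>w. w \<in> B \<Longrightarrow> e dvd w^2 + c"
  shows "(\<Sum>w\<in>B. 1 / real_of_int w) \<le>
    real (card (pdivs e)) * (1 / W0 + (1 + ln (real_of_int X)) / sqrt (real_of_int e))"
proof (cases "B = {}")
  case True
  thus ?thesis using assms by simp
next
  case False
  then obtain w1 where w1: "w1 \<in> B" by blast
  define C where "C = (\<lambda>x. {w \<in> B. x dvd w - w1 \<and> e div x dvd w + w1})"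
  have fin: "finite (pdivs e)" by (rule finite_pdivs) fact
  have pos: "real_of_int w > 0" if "w \<in> B" for w using W0[OF that] assms(3) by linarith
  have "(\<Sum>w\<in>B. 1 / real_of_int w) \<le> (\<Sum>w\<in>B. \<Sum>x\<in>pdivs e. if w \<in> C x then 1 / real_of_int w else 0)"
  proof (rule sum_mono)
    fix w assume w: "w \<in> B"
    \<comment> \<open>With \<open>x\<close> the gcd, \<open>e div x\<close> is coprime to
      \<open>(w - w1) div x\<close> and must therefore divide \<open>w + w1\<close>.\<close>
    define x where "x = gcd e (w - w1)"
    have x: "x > 0" "x dvd e" "x dvd w - w1" using assms(2) by (auto simp: x_def)
    have "e dvd (w^2 + c) - (w1^2 + c)" using e w w1 by (intro dvd_diff)
    hence "e dvd (w - w1) * (w + w1)" by (simp add: algebra_simps power2_eq_square)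
    hence "x * (e div x) dvd x * ((w - w1) div x * (w + w1))"
      using x by (simp add: mult.assoc [symmetric])
    hence "e div x dvd (w - w1) div x * (w + w1)" using x(1) by simp
    moreover have "coprime (e div x) ((w - w1) div x)" using assms(2)
      unfolding x_def by (intro div_gcd_coprime) auto
    ultimately have "e div x dvd w + w1" using coprime_dvd_mult_right_iff by blast
    hence "w \<in> C x" using w x by (simp add: C_def)
    moreover have "x \<in> pdivs e" using x by (simp add: pdivs_def)
    ultimately show "1 / real_of_int w \<le> (\<Sum>x\<in>pdivs e. if w \<in> C x then 1 / real_of_int w else 0)"
      using fin pos[OF w] member_le_sum[of x "pdivs e" "\<lambda>x. if w \<in> C x then 1 / real_of_int w else 0"]
      by auto
  qed
  also have "\<dots> = (\<Sum>x\<in>pdivs e. \<Sum>w\<in>B. if w \<in> C x then 1 / real_of_int w else 0)"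
    by (rule sum.swap)
  also have "\<dots> = (\<Sum>x\<in>pdivs e. \<Sum>w\<in>C x. 1 / real_of_int w)"
  proof (rule sum.cong[OF refl])
    fix x
    have "B \<inter> C x = C x" by (auto simp: C_def)
    thus "(\<Sum>w\<in>B. if w \<in> C x then 1 / real_of_int w else 0) = (\<Sum>w\<in>C x. 1 / real_of_int w)"
      using sum.inter_restrict[OF assms(1), of "\<lambda>w. 1 / real_of_int w" "C x"] by simp
  qed
  also have "\<dots> \<le> (\<Sum>x\<in>pdivs e. 1 / W0 + (1 + ln (real_of_int X)) / sqrt (real_of_int e))"
  proof (rule sum_mono)
    fix x assume "x \<in> pdivs e"
    hence x: "x > 0" "x dvd e" by (auto simp: pdivs_def)
    define y where "y = e div x"
    have y: "e = x * y" "y > 0" using x assms(2)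
      by (auto simp: y_def pos_imp_zdiv_pos_iff zdvd_imp_le)
    \<comment> \<open>Only the larger of the two moduli \<open>x\<close> and \<open>e div x\<close>
      is used; their product is \<open>e\<close>, so it is at least \<open>sqrt e\<close>.\<close>
    define f where "f = max x y"
    have f: "f > 0" using x by (simp add: f_def)
    have "e \<le> f * f" unfolding y(1) f_def using x y by (intro mult_mono) auto
    hence "real_of_int e \<le> real_of_int f ^ 2" by (simp add: power2_eq_square flip: of_int_mult)
    hence sq: "sqrt (real_of_int e) \<le> real_of_int f" using f by (intro real_le_lsqrt) auto
    have "(\<Sum>w\<in>C x. 1 / real_of_int w) \<le> 1 / W0 + (1 + ln (real_of_int X)) / real_of_int f"
    proof (rule sum_inverse_class_le)
      fix w w' assume w: "w \<in> C x" "w' \<in> C x"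
      have "x dvd (w - w1) - (w' - w1)" by (rule dvd_diff) (use w in \<open>simp_all add: C_def\<close>)
      moreover have "y dvd (w + w1) - (w' + w1)" by (rule dvd_diff) (use w in \<open>simp_all add: C_def y_def\<close>)
      ultimately show "f dvd w - w'" by (auto simp: f_def max_def)
    qed (use assms f in \<open>auto simp: C_def\<close>)
    also have "\<dots> \<le> 1 / W0 + (1 + ln (real_of_int X)) / sqrt (real_of_int e)"
      using sq assms f by (intro add_left_mono divide_left_mono) (auto intro: add_nonneg_nonneg)
    finally show "(\<Sum>w\<in>C x. 1 / real_of_int w) \<le> \<dots>" .
  qed
  finally show ?thesis by simp
qed

text \<open>Frequencies are absolutely least residues: then \<open>u\<^sup>2 + v\<^sup>2 + w\<^sup>2\<close> is a nonzero integer, and if it is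
  divisible by \<open>e\<close>, the largest frequency is at least \<open>sqrt (e / 3)\<close>.\<close>

definition sres :: "int \<Rightarrow> int set" where
  "sres q = {- ((q - 1) div 2)..< - ((q - 1) div 2) + q}"

lemma finite_sres [simp]: "finite (sres q)"
  by (simp add: sres_def)

lemma sres_bound: "u \<in> sres q \<Longrightarrow> 2 * \<bar>u\<bar> \<le> q"
  by (auto simp: sres_def abs_if)

lemma sum_sres: "q > 0 \<Longrightarrow> periodic q f \<Longrightarrow> (\<Sum>u\<in>sres q. f u) = (\<Sum>u=0..<q. f u)"
  unfolding sres_def by (rule sum_translate_mod)

section \<open>Fourier inversion for the counting function\<close>

definition exp_sum :: "int \<Rightarrow> nat \<Rightarrow> int \<Rightarrow> complex" where
  "exp_sum q h u = (\<Sum>x\<in>{1..int h}. ee q (- u * x))"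

text \<open>Majorant of \<open>exp_sum\<close> on \<open>sres q\<close>: the number of terms at
  frequency 0, the geometric series bound elsewhere.\<close>

definition weight :: "int \<Rightarrow> nat \<Rightarrow> int \<Rightarrow> real" where
  "weight q h u = (if u = 0 then real h else 2 * real_of_int q / real_of_int \<bar>u\<bar>)"

lemma weight_nonneg: "q \<ge> 0 \<Longrightarrow> weight q h u \<ge> 0"
  by (simp add: weight_def)

text \<open>A crude Jordan inequality: on this range \<open>\<bar>x\<bar> \<le> 2\<close>, so the
  cubic Taylor remainder is at most two thirds of \<open>\<bar>x\<bar>\<close>.\<close>

lemma abs_sin_ge:
  fixes x :: real
  assumes "\<bar>x\<bar> \<le> pi / 2"
  shows "\<bar>sin x\<bar> \<ge> \<bar>x\<bar> / 3"
proof -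
  have "\<bar>x\<bar> \<le> 2" using assms pi_less_4 by linarith
  hence "\<bar>x\<bar> ^ 2 \<le> 2 ^ 2" by (intro power_mono) auto
  hence "\<bar>x\<bar> * \<bar>x\<bar> ^ 2 \<le> \<bar>x\<bar> * 4" by (intro mult_left_mono) auto
  hence "\<bar>x\<bar> ^ 3 \<le> 4 * \<bar>x\<bar>" by (simp add: power3_eq_cube power2_eq_square)
  moreover have "\<bar>sin x - x\<bar> \<le> \<bar>x\<bar> ^ 3 / 6"
    using Maclaurin_sin_bound[of x 3] by (simp add: sin_coeff_def eval_nat_numeral field_simps)
  ultimately have "\<bar>sin x - x\<bar> \<le> 2 / 3 * \<bar>x\<bar>" by linarith
  thus ?thesis by linarith
qed

lemma norm_cis_minus_1: "norm (cis x - 1) = 2 * \<bar>sin (x / 2)\<bar>"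
proof -
  have "(norm (cis x - 1))^2 = (cos x - 1)^2 + sin x ^ 2"
    by (simp add: cmod_def)
  also have "\<dots> = 2 - 2 * cos (2 * (x / 2))"
    using sin_cos_squared_add[of x] by (simp add: power2_diff)
  also have "\<dots> = (2 * \<bar>sin (x / 2)\<bar>)^2"
    unfolding cos_double_sin by (simp add: power_mult_distrib)
  finally show ?thesis by (rule power2_eq_imp_eq) auto
qed

lemma norm_exp_sum_le:
  assumes "q > 0" "u \<in> sres q"
  shows "norm (exp_sum q h u) \<le> weight q h u"
proof (cases "u = 0")
  case True
  thus ?thesis by (simp add: exp_sum_def weight_def)
next
  case False
  define z where "z = ee q (- u)"
  have "z * exp_sum q h u = (\<Sum>x\<in>{1..int h}. ee q (- u * (x + 1)))"
    by (simp add: exp_sum_def z_def sum_distrib_left algebra_simps flip: ee_add)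
  also have "\<dots> = (\<Sum>x\<in>{2..int h + 1}. ee q (- u * x))"
    by (rule sum.reindex_bij_witness[of _ "\<lambda>x. x - 1" "\<lambda>x. x + 1"]) auto
  \<comment> \<open>The sum over \<open>1..h+1\<close> is split once at its first and once at its
    last term, which sums the geometric series.\<close>
  finally have "z * exp_sum q h u + ee q (- u * 1) = (\<Sum>x\<in>insert 1 {2..int h + 1}. ee q (- u * x))"
    by simp
  also have "insert 1 {2..int h + 1} = insert (int h + 1) {1..int h}" by auto
  also have "(\<Sum>x\<in>\<dots>. ee q (- u * x)) = ee q (- u * (int h + 1)) + exp_sum q h u"
    by (simp add: exp_sum_def)
  finally have "(z - 1) * exp_sum q h u = ee q (- u * (int h + 1)) - ee q (- u * 1)"
    by (simp add: algebra_simps)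
  hence "norm (z - 1) * norm (exp_sum q h u) = norm (ee q (- u * (int h + 1)) - ee q (- u * 1))"
    by (metis norm_mult)
  also have "\<dots> \<le> norm (ee q (- u * (int h + 1))) + norm (ee q (- u * 1))"
    by (rule norm_triangle_ineq4)
  finally have le: "norm (z - 1) * norm (exp_sum q h u) \<le> 2" by simp
  define x where "x = pi * (real_of_int (- u) / real_of_int q)"
  have "norm (z - 1) = 2 * \<bar>sin x\<bar>"
    using norm_cis_minus_1[of "2 * x"] by (simp add: z_def ee_def x_def mult.assoc)
  moreover have t0: "real_of_int \<bar>u\<bar> / real_of_int q \<ge> 0" using assms(1) by simp
  have xa: "\<bar>x\<bar> = pi * (real_of_int \<bar>u\<bar> / real_of_int q)"
    using assms(1) by (simp add: x_def abs_mult)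
  have "\<bar>x\<bar> \<le> pi / 2"
  proof -
    have "real_of_int \<bar>u\<bar> / real_of_int q \<le> 1 / 2"
      using sres_bound[OF assms(2)] assms(1) by (simp add: field_simps)
    hence "pi * (real_of_int \<bar>u\<bar> / real_of_int q) \<le> pi * (1 / 2)" by (intro mult_left_mono) auto
    thus ?thesis using xa by simp
  qed
  hence "\<bar>sin x\<bar> \<ge> \<bar>x\<bar> / 3" by (rule abs_sin_ge)
  moreover have "2 * (real_of_int \<bar>u\<bar> / real_of_int q) \<le> \<bar>x\<bar>" unfolding xa
    using assms(1) pi_ge_two by (intro mult_right_mono) auto
  ultimately have "norm (z - 1) \<ge> real_of_int \<bar>u\<bar> / real_of_int q"
    using t0 by linarith
  hence "real_of_int \<bar>u\<bar> / real_of_int q * norm (exp_sum q h u) \<le> 2"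
    using le by (meson mult_right_mono norm_ge_zero order_trans)
  thus ?thesis using False assms(1) by (simp add: weight_def field_simps)
qed

definition count_dvd :: "nat \<Rightarrow> int \<Rightarrow> int \<Rightarrow> nat" where
  "count_dvd h q k = card {(x,y,z) \<in> {1..int h} \<times> {1..int h} \<times> {1..int h}. q dvd x^2 + y^2 + z^2 + k}"

lemma sum_triple_prod:
  fixes f g h :: "_ \<Rightarrow> 'a :: comm_semiring_1"
  shows "(\<Sum>(x,y,z)\<in>A \<times> B \<times> C. f x * g y * h z) = sum f A * sum g B * sum h C"
  by (simp add: sum.cartesian_product [symmetric] sum_distrib_left [symmetric] sum_distrib_right [symmetric] mult.assoc)

lemma sum_sres_ee:
  assumes "q > 0"
  shows "(\<Sum>u\<in>sres q. ee q (u * n)) = (if q dvd n then of_int q else 0)"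
  using sum_sres[OF assms, of "\<lambda>u. ee q (u * n)"] periodic_ee[of q n 0] sum_ee[OF assms, of n]
  by (simp add: mult.commute)

text \<open>Summing over the frequencies first, orthogonality in each coordinate leaves, for each
  point of the cube, only its own residue class modulo \<open>q\<close>.\<close>

lemma count_dvd_fourier:
  assumes "q > 0"
  shows "of_int q ^ 3 * of_nat (count_dvd h q k) =
    (\<Sum>(u,v,w)\<in>sres q \<times> sres q \<times> sres q. quad_sum q k u v w * exp_sum q h u * exp_sum q h v * exp_sum q h w)"
proof -
  let ?T = "sres q \<times> sres q \<times> sres q" and ?Q = "{0..<q} \<times> {0..<q} \<times> {0..<q}"
  let ?H = "{1..int h} \<times> {1..int h} \<times> {1..int h}"
  define P :: "int \<times> int \<times> int \<Rightarrow> complex"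
    where "P = (\<lambda>(x,y,z). if q dvd x^2 + y^2 + z^2 + k then 1 else 0)"
  have quad_sum: "quad_sum q k u v w = (\<Sum>(a,b,c)\<in>?Q. P (a,b,c) * ee q (u * a + v * b + w * c))" for u v w
    unfolding quad_sum_def P_def by (simp add: sum.cartesian_product if_distrib cong: if_cong)
      (intro sum.cong, auto)
  have EEE: "exp_sum q h u * exp_sum q h v * exp_sum q h w = (\<Sum>(x,y,z)\<in>?H. ee q (- u * x) * ee q (- v
      * y) * ee q (- w * z))" for u v w
    unfolding exp_sum_def by (rule sum_triple_prod [symmetric])
  have "(\<Sum>(u,v,w)\<in>?T. quad_sum q k u v w * exp_sum q h u * exp_sum q h v * exp_sum q h w) =
    (\<Sum>(u,v,w)\<in>?T. quad_sum q k u v w * (exp_sum q h u * exp_sum q h v * exp_sum q h w))"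
    by (simp add: mult.assoc)
  also have "\<dots> = (\<Sum>(u,v,w)\<in>?T. \<Sum>(a,b,c)\<in>?Q. \<Sum>(x,y,z)\<in>?H.
       P (a,b,c) * (ee q (u * (a - x)) * ee q (v * (b - y)) * ee q (w * (c - z))))"
    unfolding EEE quad_sum
    by (intro sum.cong refl)
       (auto simp: sum_product case_prod_unfold algebra_simps simp flip: ee_add intro!: sum.cong)
  also have "\<dots> = (\<Sum>(x,y,z)\<in>?H. \<Sum>(a,b,c)\<in>?Q. P (a,b,c) *
       (\<Sum>(u,v,w)\<in>?T. ee q (u * (a - x)) * ee q (v * (b - y)) * ee q (w * (c - z))))"
    unfolding case_prod_unfold sum_distrib_left
    by (subst sum.swap, subst (2) sum.swap, subst sum.swap, rule refl)
  also have "\<dots> = (\<Sum>(x,y,z)\<in>?H. of_int q ^ 3 * P (x,y,z))"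
  proof (intro sum.cong refl, clarify)
    fix x y z
    let ?m = "(x mod q, y mod q, z mod q)"
    have "(\<Sum>(a,b,c)\<in>?Q. P (a,b,c) *
       (\<Sum>(u,v,w)\<in>?T. ee q (u * (a - x)) * ee q (v * (b - y)) * ee q (w * (c - z)))) =
       (\<Sum>t\<in>?Q. if t = ?m then of_int q ^ 3 * P ?m else 0)"
    proof (intro sum.cong refl, clarify)
      fix a b c assume abc: "a \<in> {0..<q}" "b \<in> {0..<q}" "c \<in> {0..<q}"
      have d: "q dvd a - x \<longleftrightarrow> a = x mod q" if "a \<in> {0..<q}" for a x
        using that mod_eq_dvd_iff[of a q x] by auto
      show "P (a,b,c) * (\<Sum>(u,v,w)\<in>?T. ee q (u * (a - x)) * ee q (v * (b - y)) * ee q (w * (c - z))) =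
        (if (a,b,c) = ?m then of_int q ^ 3 * P ?m else 0)"
        unfolding sum_triple_prod sum_sres_ee[OF assms] using d abc by (auto simp: power3_eq_cube)
    qed
    also have "\<dots> = of_int q ^ 3 * P ?m" using assms by simp
    also have "P ?m = P (x,y,z)"
    proof -
      have "q dvd (x mod q)^2 + (y mod q)^2 + (z mod q)^2 + k \<longleftrightarrow> q dvd x^2 + y^2 + z^2 + k"
        by (intro cong_dvd_iff cong_add cong_pow) (auto simp: cong_def)
      thus ?thesis by (simp add: P_def)
    qed
    finally show "(\<Sum>(a,b,c)\<in>?Q. P (a,b,c) *
       (\<Sum>(u,v,w)\<in>?T. ee q (u * (a - x)) * ee q (v * (b - y)) * ee q (w * (c - z)))) = of_int q ^ 3
           * P (x,y,z)" .
  qed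
  also have "\<dots> = of_int q ^ 3 * (\<Sum>t\<in>?H. P t)" by (simp add: sum_distrib_left case_prod_unfold)
  also have "(\<Sum>t\<in>?H. P t) = of_nat (count_dvd h q k)"
    unfolding P_def count_dvd_def
    by (simp add: case_prod_unfold sum.If_cases Int_def) (rule arg_cong[of _ _ card], auto)
  finally show ?thesis by simp
qed

lemma count_dvd_error:
  assumes "q > 0"
  shows "\<bar>real q ^ 3 * real (count_dvd h (int q) k) - real (lam q k) * real h ^ 3\<bar> \<le>
    (\<Sum>(u,v,w)\<in>sres q \<times> sres q \<times> sres q - {(0,0,0)}.
       norm (quad_sum (int q) k u v w) * weight q h u * weight q h v * weight q h w)"
proof -
  let ?T = "sres (int q) \<times> sres (int q) \<times> sres (int q)"
  let ?f = "\<lambda>(u,v,w). quad_sum (int q) k u v w * exp_sum q h u * exp_sum q h v * exp_sum q h w"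
  have q: "int q > 0" using assms by simp
  have "0 \<in> sres (int q)" using q by (auto simp: sres_def)
  hence "(\<Sum>t\<in>?T. ?f t) = ?f (0,0,0) + (\<Sum>t\<in>?T - {(0,0,0)}. ?f t)"
    by (intro sum.remove) auto
  moreover have "?f (0,0,0) = of_nat (lam q k) * of_nat h ^ 3"
    using quad_sum_eq_lam[OF assms] by (simp add: exp_sum_def power3_eq_cube)
  ultimately have "of_real (real q ^ 3 * real (count_dvd h (int q) k) - real (lam q k) * real h ^ 3) =
     (\<Sum>t\<in>?T - {(0,0,0)}. ?f t)"
    using count_dvd_fourier[OF q, of h k] by (simp add: case_prod_unfold)
  hence "\<bar>real q ^ 3 * real (count_dvd h (int q) k) - real (lam q k) * real h ^ 3\<bar> = norm
      (\<Sum>t\<in>?T - {(0,0,0)}. ?f t)"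
    by (metis norm_of_real)
  also have "\<dots> \<le> (\<Sum>(u,v,w)\<in>?T - {(0,0,0)}. norm (quad_sum (int q) k u v w) * weight q h u * weight q h v
      * weight q h w)"
  proof (rule sum_norm_le)
    fix t assume t: "t \<in> ?T - {(0,0,0)}"
    then obtain u v w where tt: "t = (u,v,w)" and uvw: "u \<in> sres (int q)" "v \<in> sres (int q)" "w
        \<in> sres (int q)"
      by auto
    show "norm (?f t) \<le> (case t of (u,v,w) \<Rightarrow> norm (quad_sum (int q) k u v w) * weight (int q) h u
        * weight (int q) h v * weight (int q) h w)"
      unfolding tt prod.case norm_mult
      by (intro mult_mono norm_exp_sum_le q uvw order_refl mult_nonneg_nonneg norm_ge_zero weight_nonneg)
         (use q in auto)
  qed
  finally show ?thesis .
qed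

section \<open>Summation over the frequencies\<close>

lemma sum_multiples_le:
  fixes W B :: "int set"
  assumes "finite W" "finite B" "g > 0" "q > 0"
    and W: "\<And>w. w \<in> W \<Longrightarrow> w \<noteq> 0 \<and> g dvd w \<and> \<bar>w\<bar> div g \<in> B"
    and B: "\<And>b. b \<in> B \<Longrightarrow> b > 0"
  shows "(\<Sum>w\<in>W. weight q h w) \<le> 4 * (real_of_int q / real_of_int g) * (\<Sum>b\<in>B. 1 / real_of_int b)"
proof -
  \<comment> \<open>A frequency is recovered from \<open>\<bar>w\<bar> div g\<close> and its sign;
    the two signs double the constant 2 of \<open>weight\<close>.\<close>
  have "(\<Sum>w\<in>W. weight q h w) \<le> (\<Sum>(b,s)\<in>B \<times> {1,-1::int}. 2 * real_of_int q / (real_of_int g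
      * real_of_int b))"
  proof (rule sum_le_included[where i = "\<lambda>(b,s). s * g * b"])
    show "\<forall>w\<in>W. \<exists>y\<in>B \<times> {1,-1}. (case y of (b,s) \<Rightarrow> s * g * b) = w \<and>
       weight q h w \<le> (case y of (b,s) \<Rightarrow> 2 * real_of_int q / (real_of_int g * real_of_int b))"
    proof
      fix w assume w: "w \<in> W"
      define b where "b = \<bar>w\<bar> div g"
      have gb: "g * b = \<bar>w\<bar>" using W[OF w] by (simp add: b_def)
      have w': "sgn w * g * b = w" using gb by (simp add: mult.assoc sgn_mult_abs)
      have "weight q h w = 2 * real_of_int q / (real_of_int g * real_of_int b)"
        using W[OF w] unfolding weight_def gb [symmetric] by simp
      moreover have "sgn w \<in> {1,-1}" using W[OF w] by (simp add: sgn_if)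
      moreover have "b \<in> B" using W[OF w] by (simp add: b_def)
      ultimately show "\<exists>y\<in>B \<times> {1,-1}. (case y of (b,s) \<Rightarrow> s * g * b) = w \<and>
         weight q h w \<le> (case y of (b,s) \<Rightarrow> 2 * real_of_int q / (real_of_int g * real_of_int b))"
        using w' by (intro bexI[of _ "(b, sgn w)"]) auto
    qed
  qed (use assms B in \<open>auto intro!: divide_nonneg_nonneg mult_nonneg_nonneg less_imp_le\<close>)
  also have "\<dots> = (\<Sum>b\<in>B. 4 * (real_of_int q / real_of_int g) * (1 / real_of_int b))"
    by (simp add: sum.cartesian_product [symmetric])
  finally show ?thesis by (simp add: sum_distrib_left)
qed

definition log1 :: "int \<Rightarrow> real" where
  "log1 q = 1 + ln (real_of_int q)"

lemma log1_ge_1: "q > 0 \<Longrightarrow> log1 q \<ge> 1"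
  by (simp add: log1_def)

lemma sum_weight_multiples_le:
  assumes "q > 0" "g > 0"
  shows "(\<Sum>u\<in>sres q. if g dvd u then weight q h u else 0) \<le>
    real h + 4 * (real_of_int q / real_of_int g) * log1 q"
proof -
  define W where "W = {u \<in> sres q. g dvd u \<and> u \<noteq> 0}"
  have 0: "0 \<in> sres q" using assms by (auto simp: sres_def)
  have "(\<Sum>u\<in>sres q. if g dvd u then weight q h u else 0) = (\<Sum>u\<in>insert 0 W. weight q h u)"
    by (rule sum.mono_neutral_cong_right) (use 0 in \<open>auto simp: W_def\<close>)
  also have "\<dots> = real h + (\<Sum>u\<in>W. weight q h u)"
    by (subst sum.insert) (auto simp: W_def weight_def)
  also have "(\<Sum>u\<in>W. weight q h u) \<le> 4 * (real_of_int q / real_of_int g) * (\<Sum>b\<in>{1..q}. 1 / real_of_int b)"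
  proof (rule sum_multiples_le)
    fix w assume w: "w \<in> W"
    then obtain w' where w': "w = g * w'" by (auto simp: W_def)
    have "w' \<noteq> 0" using w w' by (auto simp: W_def)
    moreover have "\<bar>w\<bar> div g = \<bar>w'\<bar>" using assms w' by (simp add: abs_mult)
    moreover have "1 * \<bar>w'\<bar> \<le> g * \<bar>w'\<bar>" using assms by (intro mult_right_mono) auto
    moreover have "g * \<bar>w'\<bar> = \<bar>w\<bar>" using assms w' by (simp add: abs_mult)
    moreover have "2 * \<bar>w\<bar> \<le> q" using w sres_bound by (auto simp: W_def)
    ultimately show "w \<noteq> 0 \<and> g dvd w \<and> \<bar>w\<bar> div g \<in> {1..q}" using w w' assms
      by (auto simp: W_def)
  qed (use assms in \<open>auto simp: W_def\<close>)
  also have "\<dots> \<le> 4 * (real_of_int q / real_of_int g) * log1 q"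
    unfolding log1_def by (intro mult_left_mono sum_inverse_le_ln) (use assms in auto)
  finally show ?thesis by simp
qed

text \<open>After division by \<open>g\<close>, maximality of \<open>\<bar>w\<bar>\<close> gives
  \<open>e \<le> 3 * (w div g)^2\<close>. This supplies the lower bound \<open>sqrt (e / 3)\<close>
  in \<open>sum_inverse_roots_le\<close> and makes its first term no worse than the second. The
  constant is 12 = 4 * (2 + 1), with \<open>sqrt 3 \<le> 2\<close>.\<close>

lemma sum_weight_max_le:
  fixes q g e u v :: int
  assumes "q > 0" "g > 0" "e > 0" "g dvd u" "g dvd v"
  shows "(\<Sum>w\<in>{w\<in>sres q. w \<noteq> 0 \<and> g dvd w \<and> \<bar>u\<bar> \<le> \<bar>w\<bar> \<and> \<bar>v\<bar> \<le> \<bar>w\<bar> \<and> g^2 * e dvd u^2 + v^2 + w^2}.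
      weight q h w)
     \<le> 12 * (real_of_int q / real_of_int g) * real (card (pdivs e)) * log1 q / sqrt (real_of_int e)"
proof -
  define W where "W = {w\<in>sres q. w \<noteq> 0 \<and> g dvd w \<and> \<bar>u\<bar> \<le> \<bar>w\<bar> \<and> \<bar>v\<bar> \<le> \<bar>w\<bar> \<and> g^2 * e dvd u^2 + v^2 + w^2}"
  obtain u' v' where u': "u = g * u'" and v': "v = g * v'" using assms by (auto elim!: dvdE)
  define c where "c = u'^2 + v'^2"
  define B where "B = {b\<in>{1..q}. sqrt (real_of_int e / 3) \<le> real_of_int b \<and> e dvd b^2 + c}"
  have finB: "finite B" by (rule finite_subset[of _ "{1..q}"]) (auto simp: B_def)
  have "(\<Sum>w\<in>W. weight q h w) \<le> 4 * (real_of_int q / real_of_int g) * (\<Sum>b\<in>B. 1 / real_of_int b)"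
  proof (rule sum_multiples_le)
    fix w assume w: "w \<in> W"
    then obtain w' where w': "w = g * w'" by (auto simp: W_def)
    have w0: "w' \<noteq> 0" using w w' by (auto simp: W_def)
    have b: "\<bar>w\<bar> div g = \<bar>w'\<bar>" using assms w' by (simp add: abs_mult)
    have "1 * \<bar>w'\<bar> \<le> g * \<bar>w'\<bar>" using assms by (intro mult_right_mono) auto
    moreover have "g * \<bar>w'\<bar> = \<bar>w\<bar>" using assms w' by (simp add: abs_mult)
    moreover have "2 * \<bar>w\<bar> \<le> q" using w sres_bound by (auto simp: W_def)
    ultimately have in1: "\<bar>w'\<bar> \<in> {1..q}" using w0 assms(1) by auto
    have "g^2 * e dvd g^2 * (u'^2 + v'^2 + w'^2)" using w
      by (auto simp: W_def u' v' w' power_mult_distrib distrib_left)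
    hence d: "e dvd u'^2 + v'^2 + w'^2" using assms(2) by simp
    have abs: "\<bar>u'\<bar> \<le> \<bar>w'\<bar>" "\<bar>v'\<bar> \<le> \<bar>w'\<bar>" using w assms(2)
      by (auto simp: W_def u' v' w' abs_mult)
    hence sq: "u'^2 \<le> w'^2" "v'^2 \<le> w'^2" by (auto simp: abs_le_square_iff)
    have "w'^2 > 0" using w0 by simp
    hence "u'^2 + v'^2 + w'^2 > 0" using zero_le_power2[of u'] zero_le_power2[of v'] by linarith
    hence "e \<le> u'^2 + v'^2 + w'^2" using d by (rule zdvd_imp_le[rotated])
    hence "e \<le> 3 * \<bar>w'\<bar>^2" using sq by simp
    hence "real_of_int e \<le> real_of_int (3 * \<bar>w'\<bar>^2)" by (simp only: of_int_le_iff)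
    hence "real_of_int e / 3 \<le> real_of_int \<bar>w'\<bar> ^ 2" by simp
    hence "sqrt (real_of_int e / 3) \<le> real_of_int \<bar>w'\<bar>" by (intro real_le_lsqrt) (auto simp: assms)
    moreover have "e dvd \<bar>w'\<bar>^2 + c" using d by (simp add: c_def add_ac)
    ultimately show "w \<noteq> 0 \<and> g dvd w \<and> \<bar>w\<bar> div g \<in> B" using w w' b in1
      by (auto simp: W_def B_def)
  qed (use assms finB in \<open>auto simp: W_def B_def\<close>)
  also have "\<dots> \<le> 4 * (real_of_int q / real_of_int g) * (real (card (pdivs e)) *
     (1 / sqrt (real_of_int e / 3) + (1 + ln (real_of_int q)) / sqrt (real_of_int e)))"
    by (intro mult_left_mono sum_inverse_roots_le[where c = c]) (use assms finB in \<open>auto simp: B_def\<close>)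
  also have "\<dots> \<le> 4 * (real_of_int q / real_of_int g) * (real (card (pdivs e)) * (3
      * log1 q / sqrt (real_of_int e)))"
  proof (intro mult_left_mono)
    have "1 / sqrt (real_of_int e / 3) = sqrt 3 / sqrt (real_of_int e)"
      by (simp add: real_sqrt_divide)
    moreover have "sqrt 3 \<le> 2" by (rule real_le_lsqrt) auto
    ultimately have "1 / sqrt (real_of_int e / 3) \<le> 2 * log1 q / sqrt (real_of_int e)"
      using log1_ge_1[OF assms(1)] assms(3) by (auto intro!: divide_right_mono)
    thus "1 / sqrt (real_of_int e / 3) + (1 + ln (real_of_int q)) / sqrt (real_of_int e) \<le> 3
        * log1 q / sqrt (real_of_int e)"
      by (simp add: log1_def field_simps add_divide_distrib)
  qed (use assms in auto)
  finally show ?thesis unfolding W_def by (simp add: mult_ac)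
qed

text \<open>By symmetry \<open>w\<close> is the largest frequency; the root count is applied to \<open>w\<close> and costs
  nothing in the two other variables.\<close>

lemma sum_weights_le:
  fixes q g e :: int
  assumes "q > 0" "g > 0" "e > 0"
  defines "x \<equiv> real_of_int q / real_of_int g"
  shows "(\<Sum>(u,v,w)\<in>sres q \<times> sres q \<times> sres q - {(0,0,0)}.
     if g dvd u \<and> g dvd v \<and> g dvd w \<and> g^2 * e dvd u^2 + v^2 + w^2 then weight q h u * weight q h v
         * weight q h w else 0)
     \<le> 1152 * real (card (pdivs e)) * log1 q ^ 3 * x * (real h ^ 2 + x ^ 2) / sqrt (real_of_int e)"
proof -
  let ?I = "sres q"
  let ?m = "weight q h"
  define cond where "cond = (\<lambda>u v w. g dvd u \<and> g dvd v \<and> g dvd w \<and> g^2 * e dvd u^2 + v^2 + w^2)"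
  define P where "P = (\<lambda>u v w. if cond u v w \<and> w \<noteq> 0 \<and> \<bar>u\<bar> \<le> \<bar>w\<bar> \<and> \<bar>v\<bar> \<le> \<bar>w\<bar> then ?m u * ?m v
      * ?m w else 0)"
  have m: "?m u \<ge> 0" for u using assms by (intro weight_nonneg) auto
  have P0: "P u v w \<ge> 0" for u v w using m by (simp add: P_def)
  have sym: "cond u w v = cond u v w" "cond w v u = cond u v w" for u v w
    by (auto simp: cond_def add_ac)
  have x0: "x > 0" using assms by simp
  have L1: "log1 q \<ge> 1" by (rule log1_ge_1) fact
  \<comment> \<open>\<open>J\<close> bounds the sum over the largest frequency, \<open>M\<close> the
    sum over each of the others. The final 1152 is 3 * 16 * 2 * 12: three choices of the largest
    variable, the square of \<open>4 * log1 q\<close>, the inequality for \<open>(h + x)^2\<close>,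
    and the 12 of \<open>J\<close>.\<close>
  define J where "J = 12 * x * real (card (pdivs e)) * log1 q / sqrt (real_of_int e)"
  have J0: "J \<ge> 0" using x0 L1 assms by (simp add: J_def)
  define M where "M = (\<Sum>u\<in>?I. if g dvd u then ?m u else 0)"
  have M0: "M \<ge> 0" unfolding M_def by (intro sum_nonneg) (use m in auto)
  have "(\<Sum>(u,v,w)\<in>?I \<times> ?I \<times> ?I - {(0,0,0)}. if cond u v w then ?m u * ?m v * ?m w else 0)
    \<le> (\<Sum>(u,v,w)\<in>?I \<times> ?I \<times> ?I - {(0,0,0)}. P u v w + P u w v + P w v u)"
  proof (rule sum_mono)
    fix t assume t: "t \<in> ?I \<times> ?I \<times> ?I - {(0,0,0)}"
    obtain u v w where tt: "t = (u,v,w)" by (cases t)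
    have "(if cond u v w then ?m u * ?m v * ?m w else 0) \<le> P u v w + P u w v + P w v u"
    proof (cases "cond u v w")
      case True
      consider "w \<noteq> 0 \<and> \<bar>u\<bar> \<le> \<bar>w\<bar> \<and> \<bar>v\<bar> \<le> \<bar>w\<bar>" | "v \<noteq> 0 \<and> \<bar>u\<bar> \<le> \<bar>v\<bar> \<and> \<bar>w\<bar> \<le> \<bar>v\<bar>"
        | "u \<noteq> 0 \<and> \<bar>w\<bar> \<le> \<bar>u\<bar> \<and> \<bar>v\<bar> \<le> \<bar>u\<bar>"
        using t tt by fastforce
      thus ?thesis
      proof cases
        case 1
        hence "P u v w = ?m u * ?m v * ?m w" using True by (simp add: P_def)
        thus ?thesis using P0[of u w v] P0[of w v u] True by simp
      next
        case 2
        moreover have "cond u w v" using True sym(1) by blast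
        ultimately have "P u w v = ?m u * ?m v * ?m w" by (simp add: P_def)
        thus ?thesis using P0[of u v w] P0[of w v u] True by simp
      next
        case 3
        moreover have "cond w v u" using True sym(2) by blast
        ultimately have "P w v u = ?m u * ?m v * ?m w" by (simp add: P_def)
        thus ?thesis using P0[of u v w] P0[of u w v] True by simp
      qed
    qed (use P0 in simp)
    thus "(case t of (u,v,w) \<Rightarrow> if cond u v w then ?m u * ?m v * ?m w else 0) \<le>
      (case t of (u,v,w) \<Rightarrow> P u v w + P u w v + P w v u)" by (simp add: tt)
  qed
  also have "\<dots> \<le> (\<Sum>(u,v,w)\<in>?I \<times> ?I \<times> ?I. P u v w + P u w v + P w v u)"
    by (rule sum_mono2) (use P0 in \<open>auto intro!: add_nonneg_nonneg\<close>)
  also have "\<dots> = (\<Sum>u\<in>?I. \<Sum>v\<in>?I. \<Sum>w\<in>?I. P u v w + P u w v + P w v u)"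
    by (simp add: sum.cartesian_product)
  also have "\<dots> = (\<Sum>u\<in>?I. \<Sum>v\<in>?I. \<Sum>w\<in>?I. P u v w) + (\<Sum>u\<in>?I. \<Sum>v\<in>?I. \<Sum>w\<in>?I. P u w v)
      + (\<Sum>u\<in>?I. \<Sum>v\<in>?I. \<Sum>w\<in>?I. P w v u)"
    by (simp add: sum.distrib)
  also have "(\<Sum>u\<in>?I. \<Sum>v\<in>?I. \<Sum>w\<in>?I. P u w v) = (\<Sum>u\<in>?I. \<Sum>v\<in>?I. \<Sum>w\<in>?I. P u v w)"
    by (rule sum.cong[OF refl], rule sum.swap)
  also have "(\<Sum>u\<in>?I. \<Sum>v\<in>?I. \<Sum>w\<in>?I. P w v u) = (\<Sum>u\<in>?I. \<Sum>v\<in>?I. \<Sum>w\<in>?I. P u v w)"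
  proof -
    have "(\<Sum>u\<in>?I. \<Sum>v\<in>?I. \<Sum>w\<in>?I. P w v u) = (\<Sum>v\<in>?I. \<Sum>u\<in>?I. \<Sum>w\<in>?I. P w v u)" by (rule sum.swap)
    also have "\<dots> = (\<Sum>v\<in>?I. \<Sum>w\<in>?I. \<Sum>u\<in>?I. P w v u)" by (rule sum.cong[OF refl], rule sum.swap)
    also have "\<dots> = (\<Sum>w\<in>?I. \<Sum>v\<in>?I. \<Sum>u\<in>?I. P w v u)" by (rule sum.swap)
    finally show ?thesis .
  qed
  also have "(\<Sum>u\<in>?I. \<Sum>v\<in>?I. \<Sum>w\<in>?I. P u v w) \<le> (\<Sum>u\<in>?I. \<Sum>v\<in>?I. (if g dvd u then ?m u else 0)
      * (if g dvd v then ?m v else 0) * J)"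
  proof (intro sum_mono)
    fix u v
    show "(\<Sum>w\<in>?I. P u v w) \<le> (if g dvd u then ?m u else 0) * (if g dvd v then ?m v else 0) * J"
    proof (cases "g dvd u \<and> g dvd v")
      case True
      let ?W = "{w\<in>sres q. w \<noteq> 0 \<and> g dvd w \<and> \<bar>u\<bar> \<le> \<bar>w\<bar> \<and> \<bar>v\<bar> \<le> \<bar>w\<bar> \<and> g^2 * e dvd u^2 + v^2 + w^2}"
      have "(\<Sum>w\<in>?I. P u v w) = (\<Sum>w\<in>?W. ?m u * ?m v * ?m w)"
        by (rule sum.mono_neutral_cong_right) (use True in \<open>auto simp: P_def cond_def\<close>)
      also have "\<dots> = ?m u * ?m v * (\<Sum>w\<in>?W. ?m w)" by (simp add: sum_distrib_left)
      also have "\<dots> \<le> ?m u * ?m v * J" unfolding J_def x_def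
        by (intro mult_left_mono sum_weight_max_le) (use assms True m in auto)
      finally show ?thesis using True by simp
    next
      case False
      hence "P u v w = 0" for w by (auto simp: P_def cond_def)
      thus ?thesis using m J0 by simp
    qed
  qed
  also have "\<dots> = M * M * J" by (simp only: M_def sum_product, simp only: sum_distrib_right)
  finally have main: "(\<Sum>(u,v,w)\<in>?I \<times> ?I \<times> ?I - {(0,0,0)}. if cond u v w then ?m u * ?m v * ?m w else 0)
      \<le> 3 * (M * M * J)"
    by linarith
  have "M \<le> real h + 4 * x * log1 q"
    unfolding M_def x_def by (rule sum_weight_multiples_le) (use assms in auto)
  also have "\<dots> \<le> 4 * log1 q * (real h + x)"
  proof -
    have "1 * real h \<le> (4 * log1 q) * real h" using L1 by (intro mult_right_mono) auto
    thus ?thesis by (simp add: algebra_simps)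
  qed
  finally have "M * M \<le> (4 * log1 q * (real h + x)) * (4 * log1 q * (real h + x))"
    using M0 by (intro mult_mono) auto
  also have "\<dots> = 16 * log1 q ^ 2 * (real h + x)^2" by (simp add: power2_eq_square)
  also have "\<dots> \<le> 16 * log1 q ^ 2 * (2 * (real h ^ 2 + x ^ 2))"
    by (intro mult_left_mono) (use sum_squares_bound[of "real h" x] in \<open>auto simp: power2_sum\<close>)
  finally have "3 * (M * M * J) \<le> 3 * (16 * log1 q ^ 2 * (2 * (real h ^ 2 + x ^ 2)) * J)"
    using J0 by (intro mult_left_mono mult_right_mono) auto
  also have "\<dots> = 1152 * real (card (pdivs e)) * log1 q ^ 3 * x * (real h ^ 2
      + x ^ 2) / sqrt (real_of_int e)"
    by (simp add: J_def power2_eq_square power3_eq_cube)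
  finally show ?thesis using main unfolding cond_def by linarith
qed

text \<open>The data \<open>(g, e, l)\<close> vary with the frequency, so each coefficient is
  majorised by a sum over all triples of divisors of \<open>q\<close>, and for each triple the
  frequencies are summed. Triples and root counting together cost the fourth power of the divisor
  function. In each term \<open>sqrt e\<close> cancels, and \<open>g * x = q\<close>.\<close>

lemma count_dvd_asymp:
  fixes A :: "nat set" and k :: int
  assumes "finite A" "\<And>p. p \<in> A \<Longrightarrow> prime p" "r \<ge> 2"
  defines "d \<equiv> \<Prod>A" and "q \<equiv> (\<Prod>A) ^ r" and "\<sigma> \<equiv> (if k \<noteq> 0 \<or> r = 2 then 1 else sqrt (real (\<Prod>A)))"
  shows "\<bar>real (count_dvd h (int q) k) - real (lam q k) / real q ^ 3 * real h ^ 3\<bar> \<le>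
    1152 * loc_const r k ^ card A * real (card (pdivs (int q))) ^ 4 * log1 (int q) ^ 3 *
      (sqrt (real d) * real h ^ 2 / real q + real q * \<sigma>)"
proof -
  have d: "d > 0" unfolding d_def by (intro prod_pos) (use assms(2) in \<open>auto simp: prime_gt_0_nat\<close>)
  have qd: "q = d ^ r" by (simp add: q_def d_def)
  have q: "q > 0" "int q > 0" using d by (auto simp: qd)
  let ?D = "pdivs (int q)"
  let ?D3 = "?D \<times> ?D \<times> ?D"
  let ?T = "sres (int q) \<times> sres (int q) \<times> sres (int q) - {(0,0,0)}"
  let ?m = "weight (int q) h"
  define C where "C = loc_const r k ^ card A"
  define t where "t = real (card ?D)"
  define L where "L = log1 (int q)"
  define ok where "ok = (\<lambda>(g::int,e::int,l::int). l dvd int d \<and> (k \<noteq> 0 \<or> r = 2 \<longrightarrow> l dvd g))"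
  define cond where "cond = (\<lambda>(g::int,e::int,l::int) (u::int,v::int,w::int). g dvd u \<and> g dvd v \<and> g dvd w
      \<and> g^2 * e dvd u^2 + v^2 + w^2)"
  define B where "B = (\<lambda>(g::int,e::int,l::int). C * real q * (real_of_int g * sqrt (real_of_int (e * l))))"
  have C: "C \<ge> 1" unfolding C_def using loc_const_ge_1 by (rule one_le_power)
  have L: "L \<ge> 1" unfolding L_def by (rule log1_ge_1) fact
  have fin: "finite ?D" by (rule finite_pdivs) fact
  have m: "?m u \<ge> 0" for u using q by (intro weight_nonneg) auto
  have B0: "B y \<ge> 0" if "y \<in> ?D3" for y
    using that C by (auto simp: B_def pdivs_def split: prod.splits intro!: mult_nonneg_nonneg)
  have Sb: "norm (quad_sum (int q) k u v w) \<le> (\<Sum>y\<in>?D3. if ok y \<and> cond y (u,v,w) then B y else 0)" for u v w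
  proof -
    obtain g e l where gel: "g > 0" "e > 0" "l > 0" "g * e dvd int d^r" "g dvd u" "g dvd v" "g dvd w"
     "g^2 * e dvd u^2 + v^2 + w^2" "l dvd int d" "(k \<noteq> 0 \<or> r = 2 \<longrightarrow> l dvd g)"
     "norm (quad_sum (int d^r) k u v w) \<le> C * real d ^ r * (real_of_int g * sqrt (real_of_int (e * l)))"
      using quad_sum_squarefree_bound[OF assms(1-3), of u v w k] unfolding d_def C_def by blast
    have "int d dvd int d ^ r" using assms(3) by (simp add: dvd_power)
    hence "(g,e,l) \<in> ?D3" using gel
        by (auto simp: pdivs_def qd intro: dvd_mult_left dvd_mult_right dvd_trans)
    moreover have "ok (g,e,l) \<and> cond (g,e,l) (u,v,w)" using gel by (simp add: ok_def cond_def)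
    ultimately have "B (g,e,l) \<le> (\<Sum>y\<in>?D3. if ok y \<and> cond y (u,v,w) then B y else 0)"
      using member_le_sum[of "(g,e,l)" ?D3 "\<lambda>y. if ok y \<and> cond y (u,v,w) then B y else 0"] fin B0 by auto
    thus ?thesis using gel(11) by (simp add: B_def qd)
  qed
  have "\<bar>real q ^ 3 * real (count_dvd h (int q) k) - real (lam q k) * real h ^ 3\<bar> \<le>
    (\<Sum>(u,v,w)\<in>?T. norm (quad_sum (int q) k u v w) * ?m u * ?m v * ?m w)"
    using count_dvd_error[OF q(1)] by simp
  also have "\<dots> \<le> (\<Sum>(u,v,w)\<in>?T. (\<Sum>y\<in>?D3. if ok y \<and> cond y (u,v,w) then B y else 0) * ?m u * ?m v * ?m w)"
    by (intro sum_mono) (auto intro!: mult_right_mono Sb m)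
  also have "\<dots> = (\<Sum>y\<in>?D3. \<Sum>(u,v,w)\<in>?T. (if ok y \<and> cond y (u,v,w) then B y else 0) * ?m u * ?m v * ?m w)"
    unfolding case_prod_unfold sum_distrib_right by (rule sum.swap)
  also have "\<dots> = (\<Sum>y\<in>?D3. if ok y then B y * (\<Sum>(u,v,w)\<in>?T. if cond y (u,v,w) then ?m u * ?m v
      * ?m w else 0) else 0)"
  proof (rule sum.cong[OF refl])
    fix y
    show "(\<Sum>(u,v,w)\<in>?T. (if ok y \<and> cond y (u,v,w) then B y else 0) * ?m u * ?m v * ?m w) =
      (if ok y then B y * (\<Sum>(u,v,w)\<in>?T. if cond y (u,v,w) then ?m u * ?m v * ?m w else 0) else 0)"
    proof (cases "ok y")
      case True
      show ?thesis unfolding sum_distrib_left case_prod_unfold if_P[OF True]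
        by (rule sum.cong[OF refl]) (use True in simp)
    qed simp
  qed
  also have "\<dots> \<le> (\<Sum>y\<in>?D3. 1152 * C * t * L ^ 3 * real q ^ 2 * (sqrt (real d) * real h ^ 2 + real q ^ 2
      * \<sigma>))"
  proof (rule sum_mono)
    fix y assume y: "y \<in> ?D3"
    obtain g e l where yy: "y = (g,e,l)" by (cases y)
    have pos: "g > 0" "e > 0" "l > 0" "e dvd int q" using y yy by (auto simp: pdivs_def)
    define R where "R = 1152 * C * t * L ^ 3 * real q ^ 2 * (sqrt (real d) * real h ^ 2 + real q ^ 2 * \<sigma>)"
    have sig: "\<sigma> \<ge> 0" by (simp add: \<sigma>_def prod_nonneg)
    have R0: "R \<ge> 0" unfolding R_def using C L sig
        by (intro mult_nonneg_nonneg add_nonneg_nonneg) (auto simp: t_def)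
    show "(if ok y then B y * (\<Sum>(u,v,w)\<in>?T. if cond y (u,v,w) then ?m u * ?m v * ?m w else 0) else 0) \<le>
      1152 * C * t * L ^ 3 * real q ^ 2 * (sqrt (real d) * real h ^ 2 + real q ^ 2 * \<sigma>)"
    proof (cases "ok y")
      case True
      define x where "x = real q / real_of_int g"
      have l: "l dvd int d" "k \<noteq> 0 \<or> r = 2 \<longrightarrow> l dvd g" using True by (auto simp: ok_def yy)
      have "l \<le> int d" using l(1) d by (auto dest: zdvd_imp_le)
      hence ld: "sqrt (real_of_int l) \<le> sqrt (real d)"
          by (metis of_int_le_iff of_int_of_nat_eq real_sqrt_le_iff)
      have g1: "real_of_int g \<ge> 1" using pos by simp
      have g2: "real_of_int g \<le> real_of_int g ^ 2" using g1 by (simp add: power2_eq_square)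
      \<comment> \<open>In the term with \<open>x^2 = (q / g)^2\<close> two powers of
        \<open>g\<close> are to spare: they absorb \<open>sqrt l\<close> if \<open>l\<close> divides
        \<open>g\<close>; otherwise \<open>sqrt d\<close> is lost through \<open>\<sigma>\<close>.
        The term with \<open>h^2\<close> has no power of \<open>g\<close> left, and there
        \<open>sqrt d\<close> is accepted.\<close>
      have ls: "sqrt (real_of_int l) \<le> real_of_int g ^ 2 * \<sigma>"
      proof (cases "k \<noteq> 0 \<or> r = 2")
        case True
        hence "l \<le> g" using l(2) pos by (auto dest: zdvd_imp_le)
        hence "real_of_int l \<le> real_of_int g ^ 2" using g2 by linarith
        hence "sqrt (real_of_int l) \<le> real_of_int g" using pos by (intro real_le_lsqrt) auto
        hence "sqrt (real_of_int l) \<le> real_of_int g ^ 2 * 1" using g2 by linarith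
        thus ?thesis using True by (simp only: \<sigma>_def if_True)
      next
        case False
        have "1 * sqrt (real d) \<le> real_of_int g ^ 2 * sqrt (real d)" using g1 g2
            by (intro mult_right_mono) auto
        hence "sqrt (real_of_int l) \<le> real_of_int g ^ 2 * sqrt (real d)" using ld by linarith
        thus ?thesis unfolding \<sigma>_def d_def if_not_P[OF False] .
      qed
      have "(\<Sum>(u,v,w)\<in>?T. if cond y (u,v,w) then ?m u * ?m v * ?m w else 0) \<le>
        1152 * real (card (pdivs e)) * L ^ 3 * x * (real h ^ 2 + x ^ 2) / sqrt (real_of_int e)"
        using sum_weights_le[OF q(2) pos(1,2), of h] by (simp add: yy cond_def x_def L_def)
      also have "\<dots> \<le> 1152 * t * L ^ 3 * x * (real h ^ 2 + x ^ 2) / sqrt (real_of_int e)"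
        unfolding t_def using card_pdivs_mono[OF pos(4) q(2)] pos q L
        by (intro divide_right_mono mult_right_mono mult_left_mono) (auto simp: x_def)
      finally have "B y * (\<Sum>(u,v,w)\<in>?T. if cond y (u,v,w) then ?m u * ?m v * ?m w else 0) \<le>
        B y * (1152 * t * L ^ 3 * x * (real h ^ 2 + x ^ 2) / sqrt (real_of_int e))"
        using B0[OF y] by (intro mult_left_mono)
      also have "\<dots> = 1152 * C * t * L ^ 3 * real q ^ 2 * (sqrt (real_of_int l) * real h ^ 2
          + sqrt (real_of_int l) * x ^ 2)"
      proof -
        have "B y = C * real q * (real_of_int g * (sqrt (real_of_int e) * sqrt (real_of_int l)))"
          by (simp add: B_def yy real_sqrt_mult)
        moreover have gx: "real_of_int g * x = real q" using pos by (simp add: x_def)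
        moreover have "sqrt (real_of_int e) \<noteq> 0" using pos by simp
        moreover have "C * real q * (y * (a * b)) * (1152 * t * z * x * w / a) = 1152 * C * t * z
            * (real q * (y * x)) * (b * w)"
          if "a \<noteq> 0" for a b y z w :: real
          using that by (simp add: field_simps)
        ultimately have "B y * (1152 * t * L ^ 3 * x * (real h ^ 2 + x ^ 2) / sqrt (real_of_int e)) =
          1152 * C * t * L ^ 3 * (real q * (real_of_int g * x)) * (sqrt (real_of_int l) * (real h ^ 2
              + x ^ 2))"
          by simp
        thus ?thesis unfolding gx by (simp only: power2_eq_square distrib_left)
      qed
      also have "\<dots> \<le> R"
        unfolding R_def
      proof (intro mult_left_mono add_mono)
        show "sqrt (real_of_int l) * real h ^ 2 \<le> sqrt (real d) * real h ^ 2"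
          by (intro mult_right_mono ld) auto
        have "sqrt (real_of_int l) * x ^ 2 \<le> real_of_int g ^ 2 * \<sigma> * x ^ 2"
            by (intro mult_right_mono ls) auto
        also have "\<dots> = real q ^ 2 * \<sigma>" using pos by (simp add: x_def power_divide)
        finally show "sqrt (real_of_int l) * x ^ 2 \<le> real q ^ 2 * \<sigma>" .
      qed (use C L in \<open>auto simp: t_def\<close>)
      finally show ?thesis using True by (simp add: R_def)
    qed (use R0 in \<open>simp add: R_def\<close>)
  qed
  also have "\<dots> = 1152 * C * t ^ 4 * L ^ 3 * real q ^ 2 * (sqrt (real d) * real h ^ 2 + real q ^ 2 * \<sigma>)"
    using fin by (simp add: card_cartesian_product t_def power4_eq_xxxx)
  finally have main: "\<bar>real q ^ 3 * real (count_dvd h (int q) k) - real (lam q k) * real h ^ 3\<bar> \<le> \<dots>" .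
  have "real q ^ 3 * \<bar>real (count_dvd h (int q) k) - real (lam q k) / real q ^ 3 * real h ^ 3\<bar> =
     \<bar>real q ^ 3 * (real (count_dvd h (int q) k) - real (lam q k) / real q ^ 3 * real h ^ 3)\<bar>"
    by (simp add: abs_mult)
  also have "\<dots> = \<bar>real q ^ 3 * real (count_dvd h (int q) k) - real (lam q k) * real h ^ 3\<bar>"
    using q by (simp add: right_diff_distrib)
  also note main
  also have "1152 * C * t ^ 4 * L ^ 3 * real q ^ 2 * (sqrt (real d) * real h ^ 2 + real q ^ 2 * \<sigma>) =
     real q ^ 3 * (1152 * C * t ^ 4 * L ^ 3 * (sqrt (real d) * real h ^ 2 / real q + real q * \<sigma>))"
    using q by (simp add: field_simps power2_eq_square power3_eq_cube)
  finally show ?thesis using q by (simp add: C_def t_def L_def)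
qed

section \<open>Divisor bounds and sums of two squares\<close>

lemma card_divisors_mult_prime_power_le:
  fixes p m :: nat
  assumes "prime p" "m > 0"
  shows "card {d. d dvd p ^ a * m} \<le> (a + 1) * card {d. d dvd m}"
proof -
  have "{d. d dvd p ^ a * m} \<subseteq> (\<lambda>(i,x). p ^ i * x) ` ({..a} \<times> {d. d dvd m})"
  proof
    fix d assume "d \<in> {d. d dvd p ^ a * m}"
    then obtain b c where bc: "d = b * c" "b dvd p ^ a" "c dvd m" using division_decomp by blast
    obtain i where "i \<le> a" "b = p ^ i" using bc(2) divides_primepow_nat[OF assms(1)] by auto
    thus "d \<in> (\<lambda>(i,x). p ^ i * x) ` ({..a} \<times> {d. d dvd m})" using bc by (intro image_eqI[of _ _
        "(i,c)"]) auto
  qed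
  hence "card {d. d dvd p ^ a * m} \<le> card ((\<lambda>(i,x). p ^ i * x) ` ({..a} \<times> {d. d dvd m}))"
    using assms by (intro card_mono) auto
  also have "\<dots> \<le> card ({..a} \<times> {d. d dvd m})" using assms by (intro card_image_le) auto
  finally show ?thesis by (simp add: card_cartesian_product)
qed

text \<open>Comparison prime by prime: \<open>a + 1 \<le> 2^a \<le> p powr (\<epsilon> * a)\<close>
  as soon as \<open>p powr \<epsilon> \<ge> 2\<close>, and each of the boundedly many smaller primes
  costs at most a factor \<open>M\<close>.\<close>

lemma card_divisors_powr:
  fixes \<epsilon> :: real
  assumes "\<epsilon> > 0"
  obtains K where "K \<ge> 1" "\<And>n::nat. n > 0 \<Longrightarrow> real (card {d. d dvd n}) \<le> K * real n powr \<epsilon>"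
proof -
  define P0 where "P0 = nat \<lceil>2 powr (1 / \<epsilon>)\<rceil>"
  \<comment> \<open>Chosen so that \<open>M * (1 + \<epsilon> * a * ln 2)\<close> contains the
    summand \<open>a\<close>; the bracket is at most \<open>2 powr (\<epsilon> * a)\<close>.\<close>
  define M where "M = 1 + 1 / (\<epsilon> * ln 2)"
  have M: "M \<ge> 1" using assms by (simp add: M_def)
  have big: "real p powr \<epsilon> \<ge> 2" if "p \<ge> P0" for p
  proof -
    have "2 powr (1 / \<epsilon>) \<le> real p" using that by (simp add: P0_def)
    hence "(2 powr (1 / \<epsilon>)) powr \<epsilon> \<le> real p powr \<epsilon>" using assms by (intro powr_mono2) auto
    thus ?thesis using assms by (simp add: powr_powr)
  qed
  have loc: "real (a + 1) \<le> (if p < P0 then M else 1) * real (p ^ a) powr \<epsilon>" if p: "prime p" for p a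
  proof (cases "p < P0")
    case True
    have p2: "real p \<ge> 2" using prime_ge_2_nat[OF p] by simp
    have "1 + \<epsilon> * real a * ln 2 \<le> exp (\<epsilon> * real a * ln 2)" by (rule exp_ge_add_one_self)
    also have "\<dots> = 2 powr (\<epsilon> * real a)" by (simp add: powr_def)
    also have "\<dots> \<le> real p powr (\<epsilon> * real a)" using p2 assms by (intro powr_mono2) auto
    also have "\<dots> = real (p ^ a) powr \<epsilon>" using p2
        by (simp add: powr_powr powr_realpow [symmetric] mult.commute)
    finally have "M * (1 + \<epsilon> * real a * ln 2) \<le> M * real (p ^ a) powr \<epsilon>" using M
        by (intro mult_left_mono) auto
    moreover have "real (a + 1) \<le> M * (1 + \<epsilon> * real a * ln 2)"
    proof -
      have pos: "\<epsilon> * ln 2 > 0" using assms by simp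
      have "M * (1 + \<epsilon> * real a * ln 2) = 1 + real a + 1 / (\<epsilon> * ln 2) + \<epsilon> * real a * ln 2"
        unfolding M_def using assms by (simp add: field_simps)
      moreover have "1 / (\<epsilon> * ln 2) \<ge> 0" "\<epsilon> * real a * ln 2 \<ge> 0" using assms by auto
      ultimately show ?thesis by simp
    qed
    ultimately show ?thesis using True by simp
  next
    case False
    have "real (a + 1) \<le> 2 ^ a"
      using Bernoulli_inequality[of 1 a] by simp
    also have "\<dots> \<le> (real p powr \<epsilon>) ^ a" using big[of p] False by (intro power_mono) auto
    also have "\<dots> = real (p ^ a) powr \<epsilon>"
      using prime_gt_0_nat[OF p] by (simp add: powr_powr powr_realpow [symmetric] mult.commute)
    finally show ?thesis using False by simp
  qed
  have main: "real (card {d. d dvd n}) \<le> M ^ card {p. prime p \<and> p dvd n \<and> p < P0} * real n powr \<epsilon>" if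
      "n > 0" for n :: nat
    using that
  proof (induction n rule: less_induct)
    case (less n)
    show ?case
    proof (cases "n = 1")
      case True
      have "M ^ card {p. prime p \<and> p dvd n \<and> p < P0} \<ge> 1" using M by (rule one_le_power)
      thus ?thesis using True by simp
    next
      case False
      then obtain p where p: "prime p" "p dvd n" using prime_factor_nat by blast
      define a where "a = multiplicity p n"
      obtain m where m: "n = p ^ a * m" "\<not> p dvd m"
        using multiplicity_decompose'[of n p] less.prems p(1) unfolding a_def
            by (metis not_prime_unit mult.commute less_not_refl)
      have m0: "m > 0" using less.prems m by (cases "m = 0") auto
      have a0: "a > 0" using p less.prems by (simp add: a_def prime_multiplicity_gt_zero_iff)
      have "p ^ a > 1" using prime_gt_1_nat[OF p(1)] a0 by (rule one_less_power)
      hence mn: "m < n" using m m0 by simp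
      define Q where "Q = (\<lambda>n. {q. prime q \<and> q dvd n \<and> q < P0})"
      have finQ: "finite (Q x)" for x by (rule finite_subset[of _ "{..<P0}"]) (auto simp: Q_def)
      have Qn: "Q n = Q m \<union> {q. q = p \<and> p < P0}"
        using p m a0 by (auto simp: Q_def prime_dvd_mult_iff prime_dvd_power_iff dest: primes_dvd_imp_eq)
      have pQ: "p \<notin> Q m" using m by (simp add: Q_def)
      have cQ: "M ^ card (Q n) = (if p < P0 then M else 1) * M ^ card (Q m)"
        using pQ finQ by (auto simp: Qn)
      have "real (card {d. d dvd n}) \<le> real ((a + 1) * card {d. d dvd m})"
        unfolding m(1) by (simp only: of_nat_le_iff card_divisors_mult_prime_power_le[OF p(1) m0])
      also have "\<dots> = real (a + 1) * real (card {d. d dvd m})" by (rule of_nat_mult)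
      also have "\<dots> \<le> ((if p < P0 then M else 1) * real (p ^ a) powr \<epsilon>) * (M ^ card (Q m) * real m powr \<epsilon>)"
        using loc[OF p(1), of a] less.IH[OF mn m0] M unfolding Q_def
        by (intro mult_mono) auto
      also have "\<dots> = M ^ card (Q n) * real n powr \<epsilon>"
      proof -
        have "real n powr \<epsilon> = real (p ^ a) powr \<epsilon> * real m powr \<epsilon>"
          unfolding m(1) of_nat_mult by (rule powr_mult)
        thus ?thesis by (simp only: cQ mult_ac)
      qed
      finally show ?thesis by (simp add: Q_def)
    qed
  qed
  have "real (card {d. d dvd n}) \<le> M ^ P0 * real n powr \<epsilon>" if "n > 0" for n :: nat
  proof -
    have "card {p. prime p \<and> p dvd n \<and> p < P0} \<le> card {..<P0}" by (rule card_mono) auto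
    hence "M ^ card {p. prime p \<and> p dvd n \<and> p < P0} \<le> M ^ P0" using M by (intro power_increasing) auto
    hence "M ^ card {p. prime p \<and> p dvd n \<and> p < P0} * real n powr \<epsilon> \<le> M ^ P0 * real n powr \<epsilon>"
      by (intro mult_right_mono) auto
    thus ?thesis using main[OF that] by linarith
  qed
  thus thesis using that[of "M ^ P0"] M one_le_power by blast
qed

lemma card_pdivs_nat: "card (pdivs (int n)) = card {d. d dvd n}" if "n > 0" for n :: nat
proof -
  have "pdivs (int n) = int ` {d. d dvd n}"
  proof safe
    fix x assume "x \<in> pdivs (int n)"
    hence "x = int (nat x)" "nat x dvd n"
        by (auto simp: pdivs_def int_dvd_int_iff [symmetric] simp del: int_dvd_int_iff)
    thus "x \<in> int ` {d. d dvd n}" by blast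
  qed (use that in \<open>auto simp: pdivs_def intro!: Nat.gr0I\<close>)
  thus ?thesis by (simp add: card_image)
qed

lemma card_pdivs_powr:
  fixes \<epsilon> :: real
  assumes "\<epsilon> > 0"
  obtains K where "K \<ge> 1" "\<And>n::int. n > 0 \<Longrightarrow> real (card (pdivs n)) \<le> K * real_of_int n powr \<epsilon>"
proof -
  obtain K where K: "K \<ge> 1" "\<And>n::nat. n > 0 \<Longrightarrow> real (card {d. d dvd n}) \<le> K * real n powr \<epsilon>"
    using card_divisors_powr[OF assms] by blast
  have "real (card (pdivs n)) \<le> K * real_of_int n powr \<epsilon>" if "n > 0" for n
    using K(2)[of "nat n"] card_pdivs_nat[of "nat n"] that by simp
  thus thesis using that K(1) by blast
qed

text \<open>Primes from \<open>P0\<close> on pay for their own factor \<open>C\<close>; the others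
  number at most \<open>P0\<close>, whatever \<open>A\<close> is.\<close>

lemma power_card_primes_powr:
  fixes \<epsilon> C :: real
  assumes "\<epsilon> > 0" "C \<ge> 1"
  obtains K where "K \<ge> 1" "\<And>A. finite A \<Longrightarrow> (\<And>p::nat. p \<in> A \<Longrightarrow> prime p) \<Longrightarrow> C ^ card A \<le> K * real (\<Prod>A) powr \<epsilon>"
proof -
  define P0 where "P0 = nat \<lceil>C powr (1 / \<epsilon>)\<rceil>"
  have big: "real p powr \<epsilon> \<ge> C" if "p \<ge> P0" for p
  proof -
    have "C powr (1 / \<epsilon>) \<le> real p" using that by (simp add: P0_def)
    hence "(C powr (1 / \<epsilon>)) powr \<epsilon> \<le> real p powr \<epsilon>" using assms by (intro powr_mono2) auto
    thus ?thesis using assms by (simp add: powr_powr)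
  qed
  have "C ^ card A \<le> C ^ P0 * real (\<Prod>A) powr \<epsilon>" if A: "finite A" "\<And>p::nat. p \<in> A \<Longrightarrow> prime p" for A
  proof -
    have "C ^ card A = (\<Prod>p\<in>A. C)" by simp
    also have "\<dots> \<le> (\<Prod>p\<in>A. (if p < P0 then C else 1) * real p powr \<epsilon>)"
    proof (rule prod_mono)
      fix p assume p: "p \<in> A"
      have "1 \<le> real p powr \<epsilon>" using prime_ge_1_nat[OF A(2)[OF p]] assms by (intro ge_one_powr_ge_zero) auto
      hence "C * 1 \<le> C * real p powr \<epsilon>" using assms by (intro mult_left_mono) auto
      thus "0 \<le> C \<and> C \<le> (if p < P0 then C else 1) * real p powr \<epsilon>" using big[of p] assms by auto
    qed
    also have "\<dots> = (\<Prod>p\<in>A. if p < P0 then C else 1) * (\<Prod>p\<in>A. real p powr \<epsilon>)" by (rule prod.distrib)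
    also have "(\<Prod>p\<in>A. real p powr \<epsilon>) = real (\<Prod>A) powr \<epsilon>"
      using A(1) by (induction A rule: finite_induct) (auto simp: powr_mult prod_nonneg)
    also have "(\<Prod>p\<in>A. if p < P0 then C else 1) = C ^ card {p\<in>A. p < P0}"
      using A(1) by (simp add: prod.If_cases Int_def)
    also have "C ^ card {p\<in>A. p < P0} * real (\<Prod>A) powr \<epsilon> \<le> C ^ P0 * real (\<Prod>A) powr \<epsilon>"
    proof (intro mult_right_mono power_increasing assms)
      have "card {p\<in>A. p < P0} \<le> card {..<P0}" by (rule card_mono) auto
      thus "card {p\<in>A. p < P0} \<le> P0" by simp
    qed auto
    finally show ?thesis .
  qed
  thus thesis using that[of "C ^ P0"] assms(2) one_le_power by blast
qed

section \<open>Representations by two squares\<close>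

definition sum2sq :: "int \<Rightarrow> (int \<times> int) set" where
  "sum2sq n = {(y,z). 1 \<le> y \<and> 1 \<le> z \<and> y^2 + z^2 = n}"

lemma sum2sq_bounds:
  assumes "(y,z) \<in> sum2sq n"
  shows "1 \<le> y" "y^2 < n" "1 \<le> z" "z^2 < n" "y \<le> n" "z \<le> n" "n > 0"
proof -
  have yz: "1 \<le> y" "1 \<le> z" "y^2 + z^2 = n" using assms by (auto simp: sum2sq_def)
  thus "1 \<le> y" "1 \<le> z" by auto
  have sq: "y^2 > 0" "z^2 > 0" using yz by auto
  thus a: "y^2 < n" "z^2 < n" "n > 0" using yz by linarith+
  have "y * 1 \<le> y^2" unfolding power2_eq_square using yz by (intro mult_left_mono) auto
  thus "y \<le> n" using a by linarith
  have "z * 1 \<le> z^2" unfolding power2_eq_square using yz by (intro mult_left_mono) auto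
  thus "z \<le> n" using a by linarith
qed

lemma finite_sum2sq: "finite (sum2sq n)"
  by (rule finite_subset[of _ "{1..n} \<times> {1..n}"]) (use sum2sq_bounds in auto)

text \<open>Fix a primitive representation \<open>(y1, z1)\<close> of \<open>n\<close>. Then \<open>n\<close> divides
  \<open>(y * z1 - y1 * z) * (y * z1 + y1 * z)\<close> for every representation \<open>(y, z)\<close>, and the primitive ones
  are separated by the divisor \<open>gcd n (y * z1 - y1 * z)\<close>.\<close>

lemma card_primitive_sum2sq_le:
  assumes "n > 0"
  shows "card {(y,z) \<in> sum2sq n. coprime y z} \<le> card (pdivs n)"
proof (cases "{(y,z) \<in> sum2sq n. coprime y z} = {}")
  case False
  then obtain y1 z1 where 1: "(y1,z1) \<in> sum2sq n" "coprime y1 z1" by auto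
  define e where "e = (\<lambda>(y,z). gcd n (y * z1 - y1 * z))"
  have copn: "coprime y n \<and> coprime z n" if "(y,z) \<in> sum2sq n" "coprime y z" for y z
  proof -
    have n: "n = y * y + z * z" using that by (auto simp: sum2sq_def power2_eq_square)
    have "coprime y (z * z)" "coprime z (y * y)" using that(2) by (auto simp: coprime_commute)
    thus ?thesis unfolding n
      by (metis add.commute coprime_iff_gcd_eq_1 gcd_add_mult mult.commute)
  qed
  have split: "n dvd (y * z1 - y1 * z) * (y * z1 + y1 * z)" if "(y,z) \<in> sum2sq n" for y z
  proof -
    have "(y * z1 - y1 * z) * (y * z1 + y1 * z) = y^2 * (y1^2 + z1^2) - y1^2 * (y^2 + z^2)" by algebra
    also have "\<dots> = n * (y^2 - y1^2)" using that 1 by (auto simp: sum2sq_def algebra_simps)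
    finally show ?thesis by simp
  qed
  have e: "e (y,z) > 0" "e (y,z) dvd n" "e (y,z) dvd y * z1 - y1 * z" "n div e (y,z) dvd y * z1 + y1 * z"
    if "(y,z) \<in> sum2sq n" for y z
  proof -
    define x where "x = gcd n (y * z1 - y1 * z)"
    have x: "x > 0" "x dvd n" "x dvd y * z1 - y1 * z" using assms by (auto simp: x_def)
    have "x * (n div x) dvd x * ((y * z1 - y1 * z) div x * (y * z1 + y1 * z))"
      using x split[OF that] by (simp add: mult.assoc [symmetric])
    hence "n div x dvd (y * z1 - y1 * z) div x * (y * z1 + y1 * z)" using x(1) by simp
    moreover have "coprime (n div x) ((y * z1 - y1 * z) div x)" using assms
      unfolding x_def by (intro div_gcd_coprime) auto
    ultimately have "n div x dvd y * z1 + y1 * z" using coprime_dvd_mult_right_iff by blast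
    thus "e (y,z) > 0" "e (y,z) dvd n" "e (y,z) dvd y * z1 - y1 * z" "n div e (y,z) dvd y * z1 + y1 * z"
      using x by (auto simp: e_def x_def)
  qed
  show ?thesis
  proof (rule card_inj_on_le[of e])
    show "e ` {(y,z) \<in> sum2sq n. coprime y z} \<subseteq> pdivs n" using e by (auto simp: pdivs_def)
    show "finite (pdivs n)" by (rule finite_pdivs) fact
    show "inj_on e {(y,z) \<in> sum2sq n. coprime y z}"
    proof (rule inj_onI, clarify)
      fix y z y' z'
      assume a: "(y,z) \<in> sum2sq n" "coprime y z" and b: "(y',z') \<in> sum2sq n" "coprime y' z'"
        and eq: "e (y,z) = e (y',z')"
      \<comment> \<open>Equal values of \<open>e\<close> put both pairs under the same congruences
        modulo \<open>e1\<close> and \<open>e2\<close>; eliminating \<open>y1\<close> shows that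
        both moduli divide \<open>y * z' - y' * z\<close>.\<close>
      define e1 where "e1 = e (y,z)"
      define e2 where "e2 = n div e1"
      have n: "n = e1 * e2" using e(2)[OF a(1)] by (simp add: e1_def e2_def)
      note ea = e[OF a(1), folded e1_def, folded e2_def]
      note eb = e[OF b(1), folded eq, folded e1_def, folded e2_def]
      have "coprime z1 n" using copn[OF 1] by simp
      hence cz1: "coprime e1 z1" "coprime e2 z1" unfolding n by (auto simp: coprime_commute)
      have "e1 dvd (y * z1 - y1 * z) * z' - (y' * z1 - y1 * z') * z"
          by (rule dvd_diff; rule dvd_mult2; rule ea eb)
      also have "(y * z1 - y1 * z) * z' - (y' * z1 - y1 * z') * z = z1 * (y * z' - y' * z)" by algebra
      finally have d1: "e1 dvd y * z' - y' * z" using cz1 coprime_dvd_mult_right_iff by blast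
      have "e2 dvd (y * z1 + y1 * z) * z' - (y' * z1 + y1 * z') * z"
          by (rule dvd_diff; rule dvd_mult2; rule ea eb)
      also have "(y * z1 + y1 * z) * z' - (y' * z1 + y1 * z') * z = z1 * (y * z' - y' * z)" by algebra
      finally have d2: "e2 dvd y * z' - y' * z" using cz1 coprime_dvd_mult_right_iff by blast
      \<comment> \<open>To combine the two divisibilities, \<open>e1\<close> and \<open>e2\<close>
        must be coprime. Their gcd divides \<open>2 * y * z1\<close>, hence 2; and it is not 2, for
        then 4 would divide the sum of two coprime squares.\<close>
      define c where "c = gcd e1 e2"
      have "c dvd (y * z1 - y1 * z) + (y * z1 + y1 * z)" unfolding c_def
        by (rule dvd_add; rule dvd_trans[OF _ ea(3)] dvd_trans[OF _ ea(4)]) auto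
      also have "(y * z1 - y1 * z) + (y * z1 + y1 * z) = z1 * (y * 2)" by simp
      finally have "c dvd z1 * (y * 2)" .
      moreover have "coprime c z1" unfolding c_def using cz1(1)
          by (meson coprime_divisors dvd_refl gcd_dvd1)
      ultimately have "c dvd y * 2" using coprime_dvd_mult_right_iff by blast
      moreover have "coprime c y"
      proof -
        have "c dvd n" unfolding n c_def by (simp add: dvd_mult2)
        thus ?thesis using copn[OF a] by (meson coprime_commute coprime_divisors dvd_refl)
      qed
      ultimately have c2: "c dvd 2" using coprime_dvd_mult_right_iff by blast
      have "c \<noteq> 2"
      proof
        assume "c = 2"
        hence "2 dvd e1" "2 dvd e2" unfolding c_def by (metis gcd_dvd1, metis gcd_dvd2)
        hence "2 * 2 dvd n" unfolding n by (rule mult_dvd_mono)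
        hence 4: "4 dvd y^2 + z^2" using a by (simp add: sum2sq_def)
        have "even (y^2 + z^2)" using 4 by (rule dvd_trans[rotated]) simp
        hence par: "even y \<longleftrightarrow> even z" by simp
        have "even y \<and> even z"
        proof (rule ccontr)
          assume "\<not> (even y \<and> even z)"
          hence "odd y" "odd z" using par by auto
          then obtain i j where "y = 2 * i + 1" "z = 2 * j + 1" by (auto elim!: oddE)
          hence "y^2 + z^2 = 4 * (i^2 + i + j^2 + j) + 2" by (simp add: power2_eq_square algebra_simps)
          thus False using 4 by presburger
        qed
        thus False using a(2) by (metis coprime_common_divisor odd_one)
      qed
      moreover have "c > 0" using ea(1) by (simp add: c_def)
      moreover have "c \<le> 2" using c2 by (rule zdvd_imp_le) simp
      ultimately have "c = 1" by linarith
      hence "coprime e1 e2" by (simp add: c_def coprime_iff_gcd_eq_1)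
      hence nd: "n dvd y * z' - y' * z" unfolding n using d1 d2 by (intro divides_mult)
      \<comment> \<open>The determinant of two representations is smaller than \<open>n\<close>, so
        divisibility by \<open>n\<close> makes it 0: the pairs are proportional, and proportional
        primitive pairs of positive integers are equal.\<close>
      have "\<bar>y * z' - y' * z\<bar> < n"
      proof -
        note ba = sum2sq_bounds[OF a(1)] and bb = sum2sq_bounds[OF b(1)]
        have "2 * (y * z') \<le> y^2 + z'^2" "2 * (y' * z) \<le> y'^2 + z^2"
          using zero_le_power2[of "y - z'"] zero_le_power2[of "y' - z"]
          by (simp_all add: power2_diff algebra_simps)
        moreover have "y * z' > 0" "y' * z > 0" using ba bb by auto
        ultimately show ?thesis using ba bb by linarith
      qed
      hence "y * z' - y' * z = 0" using nd zdvd_not_zless zdvd_imp_le[of n "\<bar>y * z' - y' * z\<bar>"] by force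
      hence eqyz: "y * z' = y' * z" by simp
      hence "y dvd y' * z" by (metis dvd_triv_left)
      hence "y dvd y'" using a(2) coprime_dvd_mult_left_iff by blast
      moreover have "y' dvd y * z'" using eqyz by simp
      hence "y' dvd y" using b(2) coprime_dvd_mult_left_iff by blast
      ultimately have yy: "y = y'" using sum2sq_bounds[OF a(1)] sum2sq_bounds[OF b(1)]
        by (simp add: zdvd_antisym_nonneg)
      thus "y = y' \<and> z = z'" using eqyz sum2sq_bounds[OF b(1)] by auto
    qed
  qed
next
  case True
  thus ?thesis by (simp only: card.empty)
qed

text \<open>Dividing by \<open>g = gcd y z\<close> gives a primitive representation of
  \<open>n div g^2\<close>. Both the number of possible \<open>g\<close> and the number of primitive
  representations for each are at most the number of divisors of \<open>n\<close>.\<close>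

lemma card_sum2sq_le:
  assumes "n > 0"
  shows "card (sum2sq n) \<le> card (pdivs n) ^ 2"
proof -
  define Gs where "Gs = {g \<in> pdivs n. g^2 dvd n}"
  define Prim where "Prim = (\<lambda>m. {(y,z) \<in> sum2sq m. coprime y z})"
  have finG: "finite Gs" unfolding Gs_def using finite_pdivs[OF assms] by simp
  have finP: "finite (Prim m)" for m unfolding Prim_def using finite_sum2sq[of m]
      by (rule finite_subset[rotated]) auto
  have "sum2sq n \<subseteq> (\<Union>g\<in>Gs. (\<lambda>(a,b). (g * a, g * b)) ` Prim (n div g^2))"
  proof clarify
    fix y z assume yz: "(y,z) \<in> sum2sq n"
    note b = sum2sq_bounds[OF yz]
    define g where "g = gcd y z"
    have g: "g > 0" using b by (simp add: g_def)
    obtain a c where ac: "y = g * a" "z = g * c" unfolding g_def by (meson dvdE gcd_dvd1 gcd_dvd2)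
    have "a = y div g" "c = z div g" using ac g by auto
    hence cop: "coprime a c" using b unfolding g_def by (simp only:) (intro div_gcd_coprime, auto)
    have n: "n = g^2 * (a^2 + c^2)" using yz by (simp add: sum2sq_def ac power_mult_distrib distrib_left)
    have "g dvd n" unfolding n by (simp add: power2_eq_square)
    hence "g \<in> Gs" using g n by (simp add: Gs_def pdivs_def)
    moreover have "a \<ge> 1" "c \<ge> 1" using b g ac by (auto simp: zero_less_mult_iff int_one_le_iff_zero_less)
    hence "(a,c) \<in> Prim (n div g^2)" using cop g unfolding Prim_def sum2sq_def n by simp
    ultimately show "(y,z) \<in> (\<Union>g\<in>Gs. (\<lambda>(a,b). (g * a, g * b)) ` Prim (n div g^2))"
      using ac by (intro UN_I[of g] image_eqI[of _ _ "(a,c)"]) auto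
  qed
  hence "card (sum2sq n) \<le> card (\<Union>g\<in>Gs. (\<lambda>(a,b). (g * a, g * b)) ` Prim (n div g^2))"
    using finG finP by (intro card_mono) auto
  also have "\<dots> \<le> (\<Sum>g\<in>Gs. card ((\<lambda>(a,b). (g * a, g * b)) ` Prim (n div g^2)))"
    by (rule card_UN_le[OF finG])
  also have "\<dots> \<le> (\<Sum>g\<in>Gs. card (pdivs n))"
  proof (rule sum_mono)
    fix g assume g: "g \<in> Gs"
    have m: "n div g^2 > 0" "n div g^2 dvd n" using g assms
      by (auto simp: Gs_def pdivs_def pos_imp_zdiv_pos_iff zdvd_imp_le)
    have "card ((\<lambda>(a,b). (g * a, g * b)) ` Prim (n div g^2)) \<le> card (Prim (n div g^2))"
      by (rule card_image_le) (rule finP)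
    also have "\<dots> \<le> card (pdivs (n div g^2))" unfolding Prim_def by (rule card_primitive_sum2sq_le[OF m(1)])
    also have "\<dots> \<le> card (pdivs n)" by (rule card_pdivs_mono[OF m(2) assms])
    finally show "card ((\<lambda>(a,b). (g * a, g * b)) ` Prim (n div g^2)) \<le> card (pdivs n)" .
  qed
  also have "\<dots> = card Gs * card (pdivs n)" by simp
  also have "\<dots> \<le> card (pdivs n) * card (pdivs n)"
    by (intro mult_right_mono card_mono finite_pdivs assms) (auto simp: Gs_def)
  finally show ?thesis by (simp add: power2_eq_square)
qed

text \<open>Points with value 0 are left out: they belong to every modulus and would spoil the decay
  in \<open>q\<close>.\<close>

definition count_dvd_nz :: "nat \<Rightarrow> int \<Rightarrow> int \<Rightarrow> nat" where
  "count_dvd_nz h q k = card {(x,y,z) \<in> {1..int h} \<times> {1..int h} \<times> {1..int h}.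
     x^2 + y^2 + z^2 + k \<noteq> 0 \<and> q dvd x^2 + y^2 + z^2 + k}"

text \<open>A point is determined by \<open>x\<close>, the cofactor \<open>m\<close> and a
  representation of \<open>q * m - x^2 - k\<close> by two squares. Values exceed \<open>k\<close>
  and \<open>q > \<bar>k\<bar>\<close>, so a nonzero multiple of \<open>q\<close> has
  \<open>m \<ge> 1\<close>; hence there are at most \<open>X div q\<close> cofactors, without an
  additional 1.\<close>

lemma count_dvd_nz_le:
  assumes K: "\<And>n. n > 0 \<Longrightarrow> real (card (sum2sq n)) \<le> K * real_of_int n powr \<epsilon>" and "\<epsilon> > 0" "K \<ge> 0"
    and q: "q > \<bar>k\<bar>"
  shows "real (count_dvd_nz h q k) \<le> real h * ((3 * real h ^ 2 + \<bar>real_of_int k\<bar>) / real_of_int q) * (K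
      * (2 * real h ^ 2) powr \<epsilon>)"
proof -
  have q0: "q > 0" using q by linarith
  define X where "X = 3 * int h ^ 2 + \<bar>k\<bar>"
  define Y where "Y = (\<lambda>(x::int,m::int). {(y,z)\<in>{1..int h} \<times> {1..int h}. y^2 + z^2 = q * m - x^2 - k})"
  define I where "I = {1..int h} \<times> {1..X div q}"
  define Z where "Z = {(x,y,z) \<in> {1..int h} \<times> {1..int h} \<times> {1..int h}.
     x^2 + y^2 + z^2 + k \<noteq> 0 \<and> q dvd x^2 + y^2 + z^2 + k}"
  have finY: "finite (Y i)" for i unfolding Y_def
    by (rule finite_subset[of _ "{1..int h} \<times> {1..int h}"]) auto
  have "Z \<subseteq> (\<Union>i\<in>I. (\<lambda>(y,z). (fst i, y, z)) ` Y i)"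
  proof
    fix t assume t: "t \<in> Z"
    obtain x y z where tt: "t = (x,y,z)" by (cases t)
    have b: "x \<in> {1..int h}" "y \<in> {1..int h}" "z \<in> {1..int h}" "x^2 + y^2 + z^2 + k \<noteq> 0"
      "q dvd x^2 + y^2 + z^2 + k" using t by (auto simp: Z_def tt)
    then obtain m where m: "x^2 + y^2 + z^2 + k = q * m" by (auto elim: dvdE)
    have "m \<ge> 1"
    proof (rule ccontr)
      assume "\<not> m \<ge> 1"
      moreover have "m \<noteq> 0" using m b(4) by auto
      ultimately have "m \<le> -1" by linarith
      hence "q * m \<le> q * (-1)" using q0 by (intro mult_left_mono) auto
      moreover have "x^2 + y^2 + z^2 \<ge> 0" by simp
      ultimately show False using m q by linarith
    qed
    moreover have "m \<le> X div q"
    proof -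
      have "x^2 \<le> int h ^ 2" "y^2 \<le> int h ^ 2" "z^2 \<le> int h ^ 2" using b by (auto intro!: power_mono)
      hence "q * m \<le> X" using m by (simp add: X_def)
      hence "(q * m) div q \<le> X div q" using q0 by (intro zdiv_mono1)
      thus ?thesis using q0 by simp
    qed
    ultimately have "(x,m) \<in> I" using b by (simp add: I_def)
    moreover have "(y,z) \<in> Y (x,m)" using b m by (simp add: Y_def)
    ultimately show "t \<in> (\<Union>i\<in>I. (\<lambda>(y,z). (fst i, y, z)) ` Y i)" using tt by force
  qed
  hence "card Z \<le> card (\<Union>i\<in>I. (\<lambda>(y,z). (fst i, y, z)) ` Y i)"
    using finY by (intro card_mono) (auto simp: I_def)
  also have "\<dots> \<le> (\<Sum>i\<in>I. card ((\<lambda>(y,z). (fst i, y, z)) ` Y i))"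
    by (rule card_UN_le) (simp add: I_def)
  also have "\<dots> \<le> (\<Sum>i\<in>I. card (Y i))" by (intro sum_mono card_image_le finY)
  finally have "real (card Z) \<le> (\<Sum>i\<in>I. real (card (Y i)))"
      by (simp only: of_nat_sum [symmetric] of_nat_le_iff)
  also have "\<dots> \<le> (\<Sum>i\<in>I. K * (2 * real h ^ 2) powr \<epsilon>)"
  proof (rule sum_mono)
    fix i :: "int \<times> int"
    obtain x m where i: "i = (x,m)" by (cases i)
    define n where "n = q * m - x^2 - k"
    show "real (card (Y i)) \<le> K * (2 * real h ^ 2) powr \<epsilon>"
    proof (cases "Y i = {}")
      case False
      then obtain y z where yz: "y \<in> {1..int h}" "z \<in> {1..int h}" "y^2 + z^2 = n"
          by (auto simp: Y_def i n_def)
      have "y^2 > 0" "z^2 > 0" using yz by auto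
      hence n0: "n > 0" using yz by linarith
      have "y^2 \<le> int h ^ 2" "z^2 \<le> int h ^ 2" using yz by (auto intro!: power_mono)
      hence "n \<le> 2 * int h ^ 2" using yz by linarith
      hence "real_of_int n \<le> real_of_int (2 * int h ^ 2)" by (simp only: of_int_le_iff)
      hence nn: "real_of_int n \<le> 2 * real h ^ 2" by simp
      have "Y i \<subseteq> sum2sq n" by (auto simp: Y_def i n_def sum2sq_def)
      hence "card (Y i) \<le> card (sum2sq n)" by (intro card_mono finite_sum2sq)
      hence "real (card (Y i)) \<le> K * real_of_int n powr \<epsilon>" using K[OF n0] by linarith
      also have "\<dots> \<le> K * (2 * real h ^ 2) powr \<epsilon>" using nn n0 assms
          by (intro mult_left_mono powr_mono2) auto
      finally show ?thesis .
    qed (use assms in simp)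
  qed
  also have "\<dots> = real (card I) * (K * (2 * real h ^ 2) powr \<epsilon>)" by simp
  also have "\<dots> \<le> real h * ((3 * real h ^ 2 + \<bar>real_of_int k\<bar>) / real_of_int q) * (K * (2
      * real h ^ 2) powr \<epsilon>)"
  proof (rule mult_right_mono)
    have X0: "X \<ge> 0" by (simp add: X_def)
    have "real (card I) = real h * real_of_int (X div q)"
      using X0 q0 by (simp add: I_def card_cartesian_product pos_imp_zdiv_nonneg_iff)
    also have "\<dots> \<le> real h * (real_of_int X / real_of_int q)"
      by (intro mult_left_mono real_of_int_div4) simp
    finally show "real (card I) \<le> real h * ((3 * real h ^ 2 + \<bar>real_of_int k\<bar>) / real_of_int q)"
      by (simp add: X_def)
  qed (use assms in simp)
  finally show ?thesis by (simp add: count_dvd_nz_def Z_def)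
qed

section \<open>The truncated Euler product\<close>

text \<open>A squarefree \<open>d\<close> is represented by the set of its primes, with Moebius value \<open>(-1) ^ card A\<close>.\<close>

definition prime_set :: "nat set \<Rightarrow> bool" where
  "prime_set A \<longleftrightarrow> finite A \<and> (\<forall>p\<in>A. prime p)"

lemma prime_setD: "prime_set A \<Longrightarrow> finite A" "prime_set A \<Longrightarrow> p \<in> A \<Longrightarrow> prime p"
  by (auto simp: prime_set_def)

lemma prime_set_prod_pos: "prime_set A \<Longrightarrow> \<Prod>A \<ge> (1::nat)"
  unfolding prime_set_def by (intro prod_ge_1) (auto simp: prime_gt_0_nat Suc_le_eq)

lemma prime_set_recover:
  assumes "prime_set A"
  shows "A = {p. prime p \<and> p dvd \<Prod>A}"
  using assms by (auto simp: prime_set_def prime_dvd_prod_iff) (metis primes_dvd_imp_eq)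

lemma inj_on_Prod_prime_set: "inj_on (\<lambda>A. \<Prod>A) (Collect prime_set)"
proof (rule inj_onI)
  fix A B assume "A \<in> Collect prime_set" "B \<in> Collect prime_set" "\<Prod>A = \<Prod>B"
  thus "A = B" using prime_set_recover[of A] prime_set_recover[of B] by simp
qed

text \<open>By unique factorisation a prime set is determined by its product, so a sum over
  squarefree numbers is bounded by the sum of the nonnegative \<open>F\<close> over all integers in
  \<open>B\<close>.\<close>

lemma sum_prime_sets_le:
  fixes F :: "nat \<Rightarrow> real"
  assumes "\<And>A. A \<in> AA \<Longrightarrow> prime_set A" "finite B" "\<And>A. A \<in> AA \<Longrightarrow> \<Prod>A \<in> B" "\<And>d. d \<in> B \<Longrightarrow> F d \<ge> 0"
  shows "(\<Sum>A\<in>AA. F (\<Prod>A)) \<le> (\<Sum>d\<in>B. F d)"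
proof -
  have inj: "inj_on (\<lambda>A. \<Prod>A) AA" by (rule inj_on_subset[OF inj_on_Prod_prime_set]) (use assms in auto)
  have "(\<Sum>A\<in>AA. F (\<Prod>A)) = (\<Sum>d\<in>(\<lambda>A. \<Prod>A) ` AA. F d)" by (simp add: sum.reindex[OF inj])
  also have "\<dots> \<le> (\<Sum>d\<in>B. F d)" by (rule sum_mono2) (use assms in auto)
  finally show ?thesis .
qed

section \<open>Tails of power sums\<close>

lemma powr_telescope:
  fixes x s :: real
  assumes "x > 0" "s > 1"
  shows "(s - 1) * (x + 1) powr (- s) \<le> x powr (1 - s) - (x + 1) powr (1 - s)"
proof -
  have "\<exists>z. x < z \<and> z < x + 1 \<and> (x + 1) powr (1 - s) - x powr (1 - s) = (x + 1 - x) * ((1 - s)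
      * z powr (1 - s - 1))"
  proof (rule MVT2)
    fix y assume "x \<le> y" "y \<le> x + 1"
    thus "((\<lambda>a. a powr (1 - s)) has_real_derivative (1 - s) * y powr (1 - s - 1)) (at y)"
      using assms by (intro has_real_derivative_powr) simp
  qed simp
  then obtain z where z: "x < z" "z < x + 1" "(x + 1) powr (1 - s) - x powr (1 - s) = (1 - s)
      * z powr (- s)"
    by auto
  have "(x + 1) powr (- s) \<le> z powr (- s)" using z assms by (intro powr_mono2') auto
  hence "(s - 1) * (x + 1) powr (- s) \<le> (s - 1) * z powr (- s)" using assms by (intro mult_left_mono) auto
  thus ?thesis using z(3) by (simp add: algebra_simps)
qed

text \<open>A telescoping form of the comparison with an integral. The telescope starts at the
  integer part of \<open>D\<close>, which is at least \<open>D / 2\<close>; this costs the factor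
  \<open>2 powr (s - 1)\<close>.\<close>

lemma sum_powr_tail_le:
  fixes s D :: real and B :: "nat set"
  assumes "s > 1" "D \<ge> 1" "finite B" "\<And>d. d \<in> B \<Longrightarrow> real d > D"
  shows "(\<Sum>d\<in>B. real d powr (- s)) \<le> 2 powr (s - 1) / (s - 1) * D powr (1 - s)"
proof -
  define m where "m = nat \<lfloor>D\<rfloor>"
  have m: "m \<ge> 1" "real m > D - 1" using assms(2) unfolding m_def by linarith+
  hence "real m \<ge> 1" by simp
  with m(2) have "real m \<ge> D / 2" by (simp add: field_simps)
  note m = m(1) this
  define M where "M = Max (insert (Suc m) B)"
  have "B \<subseteq> Suc ` {m..<M}"
  proof
    fix d assume d: "d \<in> B"
    have "real m \<le> D" using assms(2) unfolding m_def by linarith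
    hence "real m < real d" using assms(4)[OF d] by linarith
    moreover have "d \<le> M" unfolding M_def using assms(3) d by (intro Max_ge) auto
    ultimately show "d \<in> Suc ` {m..<M}" by (intro image_eqI[of _ _ "d - 1"]) auto
  qed
  hence "(\<Sum>d\<in>B. real d powr (- s)) \<le> (\<Sum>d\<in>Suc ` {m..<M}. real d powr (- s))"
    by (intro sum_mono2) auto
  also have "\<dots> = (\<Sum>j\<in>{m..<M}. (real j + 1) powr (- s))"
    by (subst sum.reindex) (auto simp: add.commute)
  also have "\<dots> \<le> (\<Sum>j\<in>{m..<M}. (real j powr (1 - s) - real (Suc j) powr (1 - s)) / (s - 1))"
  proof (rule sum_mono)
    fix j assume "j \<in> {m..<M}"
    hence "real j > 0" using m by auto
    from powr_telescope[OF this assms(1)]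
    show "(real j + 1) powr (- s) \<le> (real j powr (1 - s) - real (Suc j) powr (1 - s)) / (s - 1)"
      using assms(1) by (simp add: field_simps)
  qed
  also have "\<dots> = (\<Sum>j\<in>{m..<M}. real j powr (1 - s) - real (Suc j) powr (1 - s)) / (s - 1)"
    by (simp add: sum_divide_distrib)
  also have "\<dots> \<le> real m powr (1 - s) / (s - 1)"
  proof (rule divide_right_mono)
    have "m \<le> M" unfolding M_def using assms(3) by (intro order.trans[of m "Suc m" "Max _"] Max_ge) auto
    hence "(\<Sum>j\<in>{m..<M}. real j powr (1 - s) - real (Suc j) powr (1 - s))
        = real m powr (1 - s) - real M powr (1 - s)"
    proof (induction M rule: dec_induct)
      case (step n)
      thus ?case by simp
    qed simp
    thus "(\<Sum>j\<in>{m..<M}. real j powr (1 - s) - real (Suc j) powr (1 - s)) \<le> real m powr (1 - s)" by simp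
  qed (use assms in simp)
  also have "real m powr (1 - s) \<le> (D / 2) powr (1 - s)" using m assms by (intro powr_mono2') auto
  also have "(D / 2) powr (1 - s) = 2 powr (s - 1) * D powr (1 - s)"
  proof -
    have "2 powr (1 - s) * 2 powr (s - 1) = (1::real)" by (simp flip: powr_add)
    thus ?thesis using assms by (simp add: powr_divide field_simps)
  qed
  finally show ?thesis using assms by (simp add: divide_right_mono)
qed

lemma sum_powr_le:
  fixes s :: real and B :: "nat set"
  assumes "s > 1" "finite B" "\<And>d. d \<in> B \<Longrightarrow> d > 0"
  shows "(\<Sum>d\<in>B. real d powr (- s)) \<le> 1 + 2 powr (s - 1) / (s - 1)"
proof -
  have "(\<Sum>d\<in>B. real d powr (- s)) \<le> (\<Sum>d\<in>insert 1 (B - {1}). real d powr (- s))"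
    by (rule sum_mono2) (use assms in auto)
  also have "\<dots> = 1 + (\<Sum>d\<in>B - {1}. real d powr (- s))" using assms by (subst sum.insert) auto
  also have "(\<Sum>d\<in>B - {1}. real d powr (- s)) \<le> 2 powr (s - 1) / (s - 1) * 1 powr (1 - s)"
  proof (rule sum_powr_tail_le)
    fix d assume "d \<in> B - {1}"
    hence "d > 0" "d \<noteq> 1" using assms(3) by auto
    thus "1 < real d" by linarith
  qed (use assms in auto)
  finally show ?thesis by simp
qed

section \<open>Local densities and the convergence of their product\<close>

definition \<phi> :: "nat \<Rightarrow> int \<Rightarrow> nat \<Rightarrow> real" where
  "\<phi> r k p = real (lam (p ^ r) k) / real p ^ (3 * r)"

definition density :: "nat \<Rightarrow> int \<Rightarrow> nat set \<Rightarrow> real" where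
  "density r k A = real (lam ((\<Prod>A) ^ r) k) / real ((\<Prod>A) ^ r) ^ 3"

lemma \<phi>_nonneg: "\<phi> r k p \<ge> 0"
  by (simp add: \<phi>_def)

lemma density_eq_prod:
  assumes "prime_set A"
  shows "density r k A = (\<Prod>p\<in>A. \<phi> r k p)"
proof -
  have 1: "real (lam ((\<Prod>A) ^ r) k) = (\<Prod>p\<in>A. real (lam (p ^ r) k))"
    by (subst lam_prod_primes) (use prime_setD[OF assms] in auto)
  have 2: "real ((\<Prod>A) ^ r) ^ 3 = (\<Prod>p\<in>A. real p ^ (3 * r))"
    by (simp add: prod_power_distrib power_mult [symmetric] mult.commute)
  show ?thesis unfolding density_def \<phi>_def 1 2 by (rule prod_dividef [symmetric])
qed

lemma \<phi>_le:
  assumes "prime p"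
  shows "\<phi> r k p \<le> loc_const r k / real p ^ r"
proof -
  have p: "real p > 0" using assms by (simp add: prime_gt_0_nat)
  have "\<phi> r k p \<le> loc_const r k * real p ^ (2 * r) / real p ^ (3 * r)"
    unfolding \<phi>_def by (intro divide_right_mono lam_prime_power_le assms) auto
  also have "real p ^ (3 * r) = real p ^ (2 * r) * real p ^ r" by (simp flip: power_add)
  finally show ?thesis using p by simp
qed

text \<open>Each prime contributes at most \<open>loc_const / p^r\<close>, and the accumulated power
  of \<open>loc_const\<close> is absorbed by a small power of the product.\<close>

lemma density_bound:
  assumes "\<delta> > 0"
  obtains K where "K \<ge> 1" "\<And>A. prime_set A \<Longrightarrow> \<bar>density r k A\<bar> \<le> K * real (\<Prod>A) powr (\<delta> - real r)"
proof -
  obtain K where K: "K \<ge> 1" "\<And>A. finite A \<Longrightarrow> (\<And>p::nat. p \<in> A \<Longrightarrow> prime p) \<Longrightarrow>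
      loc_const r k ^ card A \<le> K * real (\<Prod>A) powr \<delta>"
    using power_card_primes_powr[OF assms loc_const_ge_1] by blast
  have "\<bar>density r k A\<bar> \<le> K * real (\<Prod>A) powr (\<delta> - real r)" if A: "prime_set A" for A
  proof -
    have P: "real (\<Prod>A) > 0" using prime_set_prod_pos[OF A] by linarith
    have "\<bar>density r k A\<bar> = (\<Prod>p\<in>A. \<phi> r k p)"
      unfolding density_eq_prod[OF A] by (simp add: prod_nonneg \<phi>_nonneg)
    also have "\<dots> \<le> (\<Prod>p\<in>A. loc_const r k / real p ^ r)"
      by (intro prod_mono) (use \<phi>_le \<phi>_nonneg prime_setD[OF A] in auto)
    also have "\<dots> = loc_const r k ^ card A / real (\<Prod>A) ^ r"
      by (simp add: prod_dividef prod_power_distrib)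
    also have "\<dots> \<le> K * real (\<Prod>A) powr \<delta> / real (\<Prod>A) ^ r"
      using K(2)[of A] prime_setD[OF A] by (intro divide_right_mono zero_le_power) (auto intro: prod_nonneg)
    also have "\<dots> = K * real (\<Prod>A) powr (\<delta> - real r)"
      using P by (simp add: powr_diff powr_realpow)
    finally show ?thesis .
  qed
  thus thesis using that K(1) by blast
qed

lemma count_dvd_asymp_powr:
  fixes k :: int
  assumes "\<delta> > 0" "r \<ge> 2"
  defines "\<sigma> \<equiv> (if k \<noteq> 0 \<or> r = 2 then 0 else 1 / 2 :: real)"
  obtains K where "K \<ge> 1" "\<And>A h. prime_set A \<Longrightarrow>
     \<bar>real (count_dvd h (int ((\<Prod>A) ^ r)) k) - density r k A * real h ^ 3\<bar> \<le>
       K * (real (\<Prod>A) powr (1 / 2 - real r + \<delta>) * real h ^ 2 + real (\<Prod>A) powr (real r + \<sigma> + \<delta>))"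
proof -
  \<comment> \<open>Seven factors \<open>q powr \<eta>\<close> occur, four from the divisor function
    and three from logarithms; as \<open>q = d^r\<close>, they amount to
    \<open>d powr (\<delta> / 2)\<close>. The other half of \<open>\<delta>\<close> pays for
    \<open>loc_const ^ card A\<close>.\<close>
  define \<eta> where "\<eta> = \<delta> / (14 * real r)"
  have \<eta>: "\<eta> > 0" using assms by (simp add: \<eta>_def)
  obtain K1 where K1: "K1 \<ge> 1" "\<And>A. finite A \<Longrightarrow> (\<And>p::nat. p \<in> A \<Longrightarrow> prime p) \<Longrightarrow>
      loc_const r k ^ card A \<le> K1 * real (\<Prod>A) powr (\<delta> / 2)"
    using power_card_primes_powr[OF half_gt_zero[OF assms(1)] loc_const_ge_1] by blast
  obtain K2 where K2: "K2 \<ge> 1" "\<And>n::int. n > 0 \<Longrightarrow> real (card (pdivs n)) \<le> K2 * real_of_int n powr \<eta>"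
    using card_pdivs_powr[OF \<eta>] by blast
  define K3 where "K3 = 1 + 1 / \<eta>"
  have K3: "K3 \<ge> 1" using \<eta> by (simp add: K3_def)
  define K where "K = 1152 * K1 * K2 ^ 4 * K3 ^ 3"
  have "1 * 1 * 1 * 1 \<le> 1152 * K1 * K2 ^ 4 * K3 ^ 3"
    by (intro mult_mono one_le_power K2 K3) (use K1(1) K2(1) in auto)
  hence K: "K \<ge> 1" by (simp add: K_def)
  have "\<bar>real (count_dvd h (int ((\<Prod>A) ^ r)) k) - density r k A * real h ^ 3\<bar> \<le>
       K * (real (\<Prod>A) powr (1 / 2 - real r + \<delta>) * real h ^ 2 + real (\<Prod>A) powr (real r + \<sigma> + \<delta>))"
    if A: "prime_set A" for A h
  proof -
    define d where "d = real (\<Prod>A)"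
    have d: "d \<ge> 1" using prime_set_prod_pos[OF A] unfolding d_def by linarith
    define q where "q = (\<Prod>A) ^ r"
    have q: "q > 0" using prime_set_prod_pos[OF A] unfolding q_def by simp
    have qd: "real q = d powr real r" using d by (simp add: q_def d_def powr_realpow)
    have q1: "real q \<ge> 1" using q by linarith
    have t: "real (card (pdivs (int q))) \<le> K2 * real q powr \<eta>" using K2(2)[of "int q"] q by simp
    have L: "log1 (int q) \<le> K3 * real q powr \<eta>"
    proof -
      have "1 \<le> real q powr \<eta>" using q1 \<eta> by (intro ge_one_powr_ge_zero) auto
      moreover have "ln (real q) \<le> real q powr \<eta> / \<eta>" using q1 \<eta> by (rule ln_powr_bound)
      ultimately have "log1 (int q) \<le> real q powr \<eta> + real q powr \<eta> / \<eta>" by (simp add: log1_def)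
      also have "\<dots> = K3 * real q powr \<eta>" by (simp add: K3_def algebra_simps)
      finally show ?thesis .
    qed
    have L1: "log1 (int q) \<ge> 1" using q by (intro log1_ge_1) simp
    have C1: "loc_const r k ^ card A \<ge> 1" using loc_const_ge_1 by (rule one_le_power)
    define E where "E = (if k \<noteq> 0 \<or> r = 2 then 1 else sqrt d)"
    have E: "E = d powr \<sigma>" using d by (simp add: E_def \<sigma>_def powr_half_sqrt)
    have "\<bar>real (count_dvd h (int q) k) - density r k A * real h ^ 3\<bar> \<le>
      1152 * loc_const r k ^ card A * real (card (pdivs (int q))) ^ 4 * log1 (int q) ^ 3 *
      (sqrt d * real h ^ 2 / real q + real q * E)"
      unfolding d_def q_def density_def E_def
      by (rule count_dvd_asymp) (use prime_setD[OF A] assms in auto)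
    also have "\<dots> \<le> 1152 * (K1 * d powr (\<delta> / 2)) * (K2 * real q powr \<eta>) ^ 4 * (K3 * real q powr \<eta>) ^ 3 *
      (sqrt d * real h ^ 2 / real q + real q * E)"
      using t L L1 C1 K1(2)[of A] prime_setD[OF A] K1(1) K2(1) K3 d
      by (intro mult_right_mono mult_mono power_mono order_refl) (auto simp: d_def E_def intro!: mult_nonneg_nonneg)
    also have "\<dots> = K * (d powr (\<delta> / 2) * (real q powr \<eta>) ^ 7) * (sqrt d * real h ^ 2 / real q + real q * E)"
      by (simp add: K_def power_mult_distrib mult_ac flip: power_add)
    also have "(real q powr \<eta>) ^ 7 = d powr (\<delta> / 2)"
    proof -
      have "(real q powr \<eta>) ^ 7 = (d powr (real r * \<eta>)) powr 7"
        using d by (subst powr_numeral) (auto simp: qd powr_powr)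
      also have "\<dots> = d powr (real r * \<eta> * 7)" by (simp add: powr_powr)
      also have "real r * \<eta> * 7 = \<delta> / 2" using assms by (simp add: \<eta>_def)
      finally show ?thesis .
    qed
    also have "d powr (\<delta> / 2) * d powr (\<delta> / 2) = d powr \<delta>" by (simp flip: powr_add)
    also have "K * d powr \<delta> * (sqrt d * real h ^ 2 / real q + real q * E) =
      K * (d powr (1 / 2 - real r + \<delta>) * real h ^ 2 + d powr (real r + \<sigma> + \<delta>))"
    proof -
      have "d powr (1 / 2 - real r + \<delta>) = d powr \<delta> * (sqrt d / real q)"
        using d by (simp add: qd powr_diff powr_add powr_half_sqrt)
      moreover have "d powr (real r + \<sigma> + \<delta>) = d powr \<delta> * (real q * E)"
        by (simp add: qd E powr_add)
      ultimately show ?thesis by (simp add: algebra_simps)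
    qed
    finally show ?thesis by (simp add: q_def d_def)
  qed
  thus thesis using that K by blast
qed

lemma local_factor_eq: "local_factor r k p = (if prime p then 1 - \<phi> r k p else 1)"
  by (simp add: local_factor_def \<phi>_def)

lemma convergent_prod_local_factor:
  assumes "r \<ge> 2"
  shows "convergent_prod (local_factor r k)"
proof -
  have "summable (\<lambda>p. norm (local_factor r k p - 1))"
  proof (rule summable_comparison_test)
    show "\<exists>N. \<forall>p\<ge>N. norm (norm (local_factor r k p - 1)) \<le> loc_const r k * real p powr (- 2)"
    proof (intro exI[of _ 1] allI impI)
      fix p :: nat assume p: "p \<ge> 1"
      show "norm (norm (local_factor r k p - 1)) \<le> loc_const r k * real p powr (- 2)"
      proof (cases "prime p")
        case True
        have "\<phi> r k p \<le> loc_const r k / real p ^ r" by (rule \<phi>_le[OF True])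
        also have "\<dots> \<le> loc_const r k / real p ^ 2"
          using p assms loc_const_ge_1[of r k] by (intro divide_left_mono power_increasing) auto
        also have "\<dots> = loc_const r k * real p powr (- 2)" using p by (simp add: powr_minus divide_inverse)
        finally show ?thesis using True \<phi>_nonneg[of r k p] by (simp add: local_factor_eq)
      next
        case False
        thus ?thesis using loc_const_ge_1[of r k] by (simp add: local_factor_eq)
      qed
    qed
    show "summable (\<lambda>p. loc_const r k * real p powr (- 2))"
      by (intro summable_mult) (simp add: summable_real_powr_iff)
  qed
  hence "abs_convergent_prod (local_factor r k)" by (simp add: abs_convergent_prod_conv_summable)
  thus ?thesis by (rule abs_convergent_prod_imp_convergent_prod)
qed

section \<open>Truncation by the size of the product\<close>

definition primes_upto :: "nat \<Rightarrow> nat set" where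
  "primes_upto N = {p. prime p \<and> p \<le> N}"

text \<open>Of the two finite families in use, \<open>Pow (primes_upto N)\<close> carries the exact
  identities, for partial products and for Moebius inversion, and \<open>prime_sets_upto D\<close>
  is the truncation in \<open>d\<close>. The latter lies in the former once
  \<open>D \<le> N\<close>.\<close>

definition prime_sets_upto :: "real \<Rightarrow> nat set set" where
  "prime_sets_upto D = {A. prime_set A \<and> real (\<Prod>A) \<le> D}"

lemma finite_primes_upto [simp]: "finite (primes_upto N)"
  by (rule finite_subset[of _ "{..N}"]) (auto simp: primes_upto_def)

lemma prime_set_Pow_primes_upto: "A \<in> Pow (primes_upto N) \<Longrightarrow> prime_set A"
  using finite_subset[OF _ finite_primes_upto, of A N] by (auto simp: prime_set_def primes_upto_def)

lemma prime_sets_upto_subset: "D \<le> real N \<Longrightarrow> prime_sets_upto D \<subseteq> Pow (primes_upto N)"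
proof clarify
  fix A p assume D: "D \<le> real N" and A: "A \<in> prime_sets_upto D" and p: "p \<in> A"
  have "p dvd \<Prod>A" using A p by (auto simp: prime_sets_upto_def prime_set_def intro: dvd_prodI)
  hence "p \<le> \<Prod>A" using prime_set_prod_pos[of A] A by (intro dvd_imp_le) (auto simp: prime_sets_upto_def)
  hence "real p \<le> real N" using A D by (auto simp: prime_sets_upto_def simp del: of_nat_prod)
  thus "p \<in> primes_upto N" using A p by (auto simp: primes_upto_def prime_sets_upto_def prime_set_def)
qed

lemma finite_prime_sets_upto: "finite (prime_sets_upto D)"
  using prime_sets_upto_subset[of D "nat \<lceil>D\<rceil>"] by (rule finite_subset) (linarith, simp)

lemma Prod_prime_sets_upto: "A \<in> prime_sets_upto D \<Longrightarrow> \<Prod>A \<in> {1..nat \<lfloor>D\<rfloor>}"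
  using prime_set_prod_pos[of A] by (auto simp: prime_sets_upto_def le_nat_floor simp del: of_nat_prod)

lemma card_prime_sets_upto_le: "D \<ge> 0 \<Longrightarrow> real (card (prime_sets_upto D)) \<le> D"
proof -
  assume D: "D \<ge> 0"
  have "(\<Sum>A\<in>prime_sets_upto D. (1::real)) \<le> (\<Sum>d\<in>{1..nat \<lfloor>D\<rfloor>}. 1)"
    using sum_prime_sets_le[of "prime_sets_upto D" "{1..nat \<lfloor>D\<rfloor>}" "\<lambda>_. 1"] Prod_prime_sets_upto
        by (auto simp: prime_sets_upto_def)
  also have "\<dots> \<le> D" using D by simp
  finally show ?thesis by simp
qed

lemma partial_product_eq:
  "(\<Prod>p\<le>N. local_factor r k p) = (\<Sum>A\<in>Pow (primes_upto N). (-1) ^ card A * density r k A)"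
proof -
  have "(\<Prod>p\<le>N. local_factor r k p) = (\<Prod>p\<in>primes_upto N. - \<phi> r k p + 1)"
    by (rule prod.mono_neutral_cong_right) (auto simp: primes_upto_def local_factor_eq)
  also have "\<dots> = (\<Sum>A\<in>Pow (primes_upto N). (\<Prod>p\<in>A. - \<phi> r k p) * (\<Prod>p\<in>primes_upto N - A. 1))"
    by (rule prod_add) simp
  also have "\<dots> = (\<Sum>A\<in>Pow (primes_upto N). (-1) ^ card A * density r k A)"
    by (intro sum.cong refl) (simp add: prod_uminus density_eq_prod[OF prime_set_Pow_primes_upto])
  finally show ?thesis .
qed

lemma sum_powr_outside_le:
  assumes "s > 1" "D \<ge> 1"
  shows "(\<Sum>A\<in>Pow (primes_upto N) - prime_sets_upto D. real (\<Prod>A) powr (- s)) \<le> 2 powr (s - 1) / (s - 1)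
      * D powr (1 - s)"
proof -
  let ?B = "(\<lambda>A. \<Prod>A) ` (Pow (primes_upto N) - prime_sets_upto D)"
  have "(\<Sum>A\<in>Pow (primes_upto N) - prime_sets_upto D. real (\<Prod>A) powr (- s)) \<le> (\<Sum>d\<in>?B. real d powr (- s))"
    by (rule sum_prime_sets_le) (use prime_set_Pow_primes_upto[of _ N] in auto)
  also have "\<dots> \<le> 2 powr (s - 1) / (s - 1) * D powr (1 - s)"
  proof (rule sum_powr_tail_le)
    fix d assume "d \<in> ?B"
    then obtain A where "A \<in> Pow (primes_upto N)" "A \<notin> prime_sets_upto D" "d = \<Prod>A" by auto
    thus "real d > D" using prime_set_Pow_primes_upto[of A N]
        by (auto simp: prime_sets_upto_def simp del: of_nat_prod)
  qed (use assms in auto)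
  finally show ?thesis .
qed

text \<open>For every \<open>N \<ge> D\<close> the truncated sum differs from the product over
  \<open>p \<le> N\<close> by a sum over prime sets with product beyond \<open>D\<close>. The bound
  for it does not depend on \<open>N\<close> and passes to the limit.\<close>

lemma euler_product_truncation:
  assumes "r \<ge> 2" "0 < \<delta>" "\<delta> \<le> 1 / 4"
  obtains K where "K \<ge> 1" "\<And>D. D \<ge> 1 \<Longrightarrow>
    \<bar>(\<Sum>A\<in>prime_sets_upto D. (-1) ^ card A * density r k A) - (\<Prod>p. local_factor r k p)\<bar> \<le> K
        * D powr (1 - real r + \<delta>)"
proof -
  obtain K1 where K1: "K1 \<ge> 1" "\<And>A. prime_set A \<Longrightarrow> \<bar>density r k A\<bar> \<le> K1 * real (\<Prod>A) powr (\<delta> - real r)"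
    using density_bound[OF assms(2)] by blast
  define s where "s = real r - \<delta>"
  have "real r \<ge> 2" using assms by simp
  hence s: "s > 1" using assms unfolding s_def by linarith
  define K where "K = max 1 (K1 * (2 powr (s - 1) / (s - 1)))"
  have "\<bar>(\<Sum>A\<in>prime_sets_upto D. (-1) ^ card A * density r k A) - (\<Prod>p. local_factor r k p)\<bar> \<le> K
      * D powr (1 - real r + \<delta>)"
    if D: "D \<ge> 1" for D
  proof -
    let ?M = "\<Sum>A\<in>prime_sets_upto D. (-1) ^ card A * density r k A"
    have bound: "\<bar>?M - (\<Prod>p\<le>N. local_factor r k p)\<bar> \<le> K * D powr (1 - s)" if N: "D \<le> real N" for N
    proof -
      have "(\<Sum>A\<in>Pow (primes_upto N). (-1) ^ card A * density r k A) =
          (\<Sum>A\<in>Pow (primes_upto N) - prime_sets_upto D. (-1) ^ card A * density r k A) + ?M"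
        by (rule sum.subset_diff) (use prime_sets_upto_subset[OF N] in auto)
      hence "\<bar>?M - (\<Prod>p\<le>N. local_factor r k p)\<bar> = \<bar>\<Sum>A\<in>Pow (primes_upto N) - prime_sets_upto D.
          (-1) ^ card A * density r k A\<bar>"
        unfolding partial_product_eq by simp
      also have "\<dots> \<le> (\<Sum>A\<in>Pow (primes_upto N) - prime_sets_upto D. \<bar>(-1) ^ card A * density r k A\<bar>)"
          by (rule sum_abs)
      also have "\<dots> \<le> (\<Sum>A\<in>Pow (primes_upto N) - prime_sets_upto D. K1 * real (\<Prod>A) powr (- s))"
        using K1(2) prime_set_Pow_primes_upto
            by (intro sum_mono) (auto simp: abs_mult s_def simp del: of_nat_prod)
      also have "\<dots> = K1 * (\<Sum>A\<in>Pow (primes_upto N) - prime_sets_upto D. real (\<Prod>A) powr (- s))"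
          by (simp add: sum_distrib_left)
      also have "\<dots> \<le> K1 * (2 powr (s - 1) / (s - 1) * D powr (1 - s))"
        using K1(1) by (intro mult_left_mono sum_powr_outside_le s D) auto
      also have "\<dots> = K1 * (2 powr (s - 1) / (s - 1)) * D powr (1 - s)" by simp
      also have "\<dots> \<le> K * D powr (1 - s)" unfolding K_def by (intro mult_right_mono) auto
      finally show ?thesis .
    qed
    have "(\<lambda>N. \<bar>?M - (\<Prod>p\<le>N. local_factor r k p)\<bar>) \<longlonglongrightarrow> \<bar>?M - (\<Prod>p. local_factor r k p)\<bar>"
      by (intro tendsto_intros convergent_prod_LIMSEQ convergent_prod_local_factor assms)
    moreover have "\<forall>\<^sub>F N in sequentially. \<bar>?M - (\<Prod>p\<le>N. local_factor r k p)\<bar> \<le> K * D powr (1 - s)"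
    proof (rule eventually_sequentiallyI[of "nat \<lceil>D\<rceil>"])
      fix N assume "nat \<lceil>D\<rceil> \<le> N"
      hence "D \<le> real N" by linarith
      thus "\<bar>?M - (\<Prod>p\<le>N. local_factor r k p)\<bar> \<le> K * D powr (1 - s)" by (rule bound)
    qed
    ultimately have "\<bar>?M - (\<Prod>p. local_factor r k p)\<bar> \<le> K * D powr (1 - s)"
      by (rule tendsto_upperbound) simp
    thus ?thesis by (simp add: s_def algebra_simps)
  qed
  moreover have "K \<ge> 1" by (simp add: K_def)
  ultimately show thesis using that by blast
qed

section \<open>The sieve\<close>

definition cube :: "nat \<Rightarrow> (int \<times> int \<times> int) set" where
  "cube h = {1..int h} \<times> {1..int h} \<times> {1..int h}"

definition quad_val :: "int \<Rightarrow> int \<times> int \<times> int \<Rightarrow> int" where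
  "quad_val k = (\<lambda>(x,y,z). x^2 + y^2 + z^2 + k)"

lemma finite_cube [simp]: "finite (cube h)"
  by (simp add: cube_def)

lemma R_eq_card:
  assumes "H \<ge> 0"
  shows "R H r k = card {t \<in> cube (nat \<lfloor>H\<rfloor>). r_free r (quad_val k t)}"
proof -
  have "real_of_int x \<le> H \<longleftrightarrow> x \<le> int (nat \<lfloor>H\<rfloor>)" for x :: int
    using assms by (simp add: le_floor_iff)
  thus ?thesis unfolding R_def by (intro arg_cong[of _ _ card]) (auto simp: cube_def quad_val_def)
qed

lemma count_dvd_nz_eq_card: "count_dvd_nz h q k = card {t \<in> cube h. quad_val k t \<noteq> 0 \<and> q dvd quad_val k t}"
  unfolding count_dvd_nz_def by (intro arg_cong[of _ _ card]) (auto simp: cube_def quad_val_def)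

lemma count_dvd_eq_card: "count_dvd h q k = card {t \<in> cube h. q dvd quad_val k t}"
  unfolding count_dvd_def by (intro arg_cong[of _ _ card]) (auto simp: cube_def quad_val_def)

text \<open>At a zero, \<open>x \<le> x^2 \<le> \<bar>k\<bar>\<close>, and likewise for
  \<open>y\<close> and \<open>z\<close>; so the bound is independent of \<open>h\<close>.\<close>

lemma card_quad_val_zero_le: "card {t \<in> cube h. quad_val k t = 0} \<le> nat \<bar>k\<bar> ^ 3"
proof -
  have "{t \<in> cube h. quad_val k t = 0} \<subseteq> cube (nat \<bar>k\<bar>)"
  proof clarify
    fix x y z assume t: "(x,y,z) \<in> cube h" "quad_val k (x,y,z) = 0"
    have le: "a \<le> a^2" if "a \<ge> 1" for a :: int
      using mult_left_mono[of 1 a a] that by (simp add: power2_eq_square)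
    have "x \<ge> 1" "y \<ge> 1" "z \<ge> 1" using t by (auto simp: cube_def)
    moreover from this have "x \<le> x^2" "y \<le> y^2" "z \<le> z^2" by (auto intro: le)
    moreover have "x^2 + y^2 + z^2 + k = 0" using t by (simp add: quad_val_def)
    ultimately have "x \<le> \<bar>k\<bar>" "y \<le> \<bar>k\<bar>" "z \<le> \<bar>k\<bar>" by linarith+
    thus "(x,y,z) \<in> cube (nat \<bar>k\<bar>)" using \<open>x \<ge> 1\<close> \<open>y \<ge> 1\<close> \<open>z \<ge> 1\<close> by (simp add: cube_def)
  qed
  hence "card {t \<in> cube h. quad_val k t = 0} \<le> card (cube (nat \<bar>k\<bar>))" by (intro card_mono) auto
  also have "\<dots> = nat \<bar>k\<bar> ^ 3" by (simp add: cube_def card_cartesian_product power3_eq_cube)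
  finally show ?thesis .
qed

lemma prod_power_dvd_iff:
  assumes "prime_set A"
  shows "int ((\<Prod>A) ^ r) dvd n \<longleftrightarrow> (\<forall>p\<in>A. int p ^ r dvd n)"
proof
  assume a: "int ((\<Prod>A) ^ r) dvd n"
  show "\<forall>p\<in>A. int p ^ r dvd n"
  proof
    fix p assume "p \<in> A"
    hence "p dvd \<Prod>A" using prime_setD[OF assms] by (intro dvd_prodI)
    hence "int (p ^ r) dvd int ((\<Prod>A) ^ r)" by (simp only: int_dvd_int_iff dvd_power_same)
    thus "int p ^ r dvd n" using a by (metis dvd_trans of_nat_power)
  qed
next
  have "finite A" using prime_setD[OF assms] by simp
  hence "(\<forall>p\<in>A. prime p) \<Longrightarrow> (\<forall>p\<in>A. int p ^ r dvd n) \<Longrightarrow> int ((\<Prod>A) ^ r) dvd n"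
  proof (induction A rule: finite_induct)
    case (insert p A)
    have "coprime p (\<Prod>A)" by (rule coprime_prime_prod) (use insert in auto)
    hence "coprime (int p) (int (\<Prod>A))" by (simp only: coprime_int_iff)
    hence "coprime (int p ^ r) (int ((\<Prod>A) ^ r))"
      unfolding of_nat_power
          by (intro coprime_power_left_iff[THEN iffD2] coprime_power_right_iff[THEN iffD2] disjI1)
    hence "int p ^ r * int ((\<Prod>A) ^ r) dvd n" using insert by (intro divides_mult) auto
    thus ?case using insert.hyps by (simp add: power_mult_distrib)
  qed simp
  thus "\<forall>p\<in>A. int p ^ r dvd n \<Longrightarrow> int ((\<Prod>A) ^ r) dvd n" using prime_setD(2)[OF assms] by blast
qed

text \<open>Only the set \<open>P\<close> of primes with \<open>p^r\<close> dividing
  \<open>n\<close> matters: the sum runs over its subsets and factors as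
  \<open>(1 - 1)^card P\<close>. The bound on \<open>n\<close> guarantees that no such prime is
  missed.\<close>

lemma indicator_r_free:
  assumes "n \<noteq> 0" "r \<ge> 1" "\<bar>n\<bar> \<le> int N"
  shows "(\<Sum>A\<in>Pow (primes_upto N). if int ((\<Prod>A) ^ r) dvd n then (-1) ^ card A else 0)
      = (if r_free r n then 1 else (0::real))"
proof -
  define P where "P = {p. prime p \<and> int p ^ r dvd n}"
  have PN: "P \<subseteq> primes_upto N"
  proof
    fix p assume p: "p \<in> P"
    have "int p dvd int p ^ r" using assms(2) by (intro dvd_power) auto
    hence "int p dvd \<bar>n\<bar>" using p by (auto simp: P_def intro: dvd_trans)
    hence "int p \<le> \<bar>n\<bar>" using assms(1) by (intro zdvd_imp_le) auto
    thus "p \<in> primes_upto N" using p assms(3) by (simp add: primes_upto_def P_def)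
  qed
  have fin: "finite P" by (rule finite_subset[OF PN finite_primes_upto])
  have "(\<Sum>A\<in>Pow (primes_upto N). if int ((\<Prod>A) ^ r) dvd n then (-1) ^ card A else 0) = (\<Sum>A\<in>Pow P.
      (-1::real) ^ card A)"
  proof (rule sum.mono_neutral_cong_right)
    have iff: "int ((\<Prod>A) ^ r) dvd n \<longleftrightarrow> A \<subseteq> P" if "A \<in> Pow (primes_upto N)" for A
      using prod_power_dvd_iff[OF prime_set_Pow_primes_upto[OF that], of r n] that
          by (auto simp: P_def primes_upto_def)
    show "\<forall>A\<in>Pow (primes_upto N) - Pow P. (if int ((\<Prod>A) ^ r) dvd n then (-1) ^ card A else 0) = (0::real)"
      using iff by auto
    show "(if int ((\<Prod>A) ^ r) dvd n then (-1) ^ card A else 0) = (-1::real) ^ card A" if "A \<in> Pow P" for A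
      using iff[of A] that PN by auto
  qed (use PN in auto)
  also have "\<dots> = (\<Prod>p\<in>P. - 1 + 1 :: real)"
    using prod_add[OF fin, of "\<lambda>_. -1 :: real" "\<lambda>_. 1"] by simp
  also have "\<dots> = (if P = {} then 1 else 0)" using fin by (simp add: power_0_left card_eq_0_iff)
  also have "P = {} \<longleftrightarrow> r_free r n" by (auto simp: P_def r_free_def)
  finally show ?thesis .
qed

lemma not_r_free_0: "r \<ge> 1 \<Longrightarrow> \<not> r_free r 0"
  using two_is_prime_nat by (auto simp: r_free_def)

text \<open>All values on the cube are bounded by \<open>N\<close>, so one \<open>N\<close> serves
  every point. Points with value 0 drop out because 0 is not \<open>r\<close>-free.\<close>

lemma card_r_free_eq:
  assumes "r \<ge> 1" "3 * h ^ 2 + nat \<bar>k\<bar> \<le> N"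
  shows "real (card {t \<in> cube h. r_free r (quad_val k t)}) =
    (\<Sum>A\<in>Pow (primes_upto N). (-1) ^ card A * real (count_dvd_nz h (int ((\<Prod>A) ^ r)) k))"
proof -
  define T where "T = {t \<in> cube h. quad_val k t \<noteq> 0}"
  have fin: "finite T" by (simp add: T_def)
  have bound: "\<bar>quad_val k t\<bar> \<le> int N" if "t \<in> cube h" for t
  proof -
    obtain x y z where t: "t = (x,y,z)" by (cases t)
    have "x^2 \<le> int h ^ 2" "y^2 \<le> int h ^ 2" "z^2 \<le> int h ^ 2"
      using that by (auto simp: t cube_def intro!: power_mono)
    moreover have "0 \<le> x^2" "0 \<le> y^2" "0 \<le> z^2" by auto
    moreover have "int (3 * h ^ 2 + nat \<bar>k\<bar>) \<le> int N" using assms(2) by (simp only: of_nat_le_iff)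
    hence "3 * int h ^ 2 + \<bar>k\<bar> \<le> int N" by simp
    moreover have "quad_val k t = x^2 + y^2 + z^2 + k" by (simp add: t quad_val_def)
    ultimately show ?thesis by linarith
  qed
  have "{t \<in> cube h. r_free r (quad_val k t)} = {t \<in> T. r_free r (quad_val k t)}"
    using not_r_free_0[OF assms(1)] by (auto simp: T_def)
  hence "real (card {t \<in> cube h. r_free r (quad_val k t)}) = (\<Sum>t\<in>T.
      if r_free r (quad_val k t) then 1 else 0)"
    using fin by (simp add: sum.If_cases Int_def)
  also have "\<dots> = (\<Sum>t\<in>T. \<Sum>A\<in>Pow (primes_upto N).
      if int ((\<Prod>A) ^ r) dvd quad_val k t then (-1) ^ card A else 0)"
    by (intro sum.cong refl indicator_r_free[symmetric] assms) (auto simp: T_def bound)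
  also have "\<dots> = (\<Sum>A\<in>Pow (primes_upto N). \<Sum>t\<in>T.
      if int ((\<Prod>A) ^ r) dvd quad_val k t then (-1) ^ card A else 0)"
    by (rule sum.swap)
  also have "\<dots> = (\<Sum>A\<in>Pow (primes_upto N). (-1) ^ card A * real (count_dvd_nz h (int ((\<Prod>A) ^ r)) k))"
  proof (intro sum.cong refl)
    fix A
    have "T \<inter> {t. int ((\<Prod>A) ^ r) dvd quad_val k t} = {t \<in> cube h. quad_val k t \<noteq> 0
        \<and> int ((\<Prod>A) ^ r) dvd quad_val k t}"
      by (auto simp: T_def)
    thus "(\<Sum>t\<in>T. if int ((\<Prod>A) ^ r) dvd quad_val k t then (-1) ^ card A else 0) = (-1) ^ card A
        * real (count_dvd_nz h (int ((\<Prod>A) ^ r)) k)"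
      unfolding count_dvd_nz_eq_card using fin
          by (simp add: sum.If_cases mult.commute del: of_nat_prod of_nat_power)
  qed
  finally show ?thesis .
qed

lemma count_dvd_nz_eq_minus: "real (count_dvd_nz h q k) = real (count_dvd h q k) - real (card {t
    \<in> cube h. quad_val k t = 0})"
proof -
  have "{t \<in> cube h. q dvd quad_val k t} = {t \<in> cube h. quad_val k t \<noteq> 0 \<and> q dvd quad_val k t} \<union> {t
      \<in> cube h. quad_val k t = 0}"
    by auto
  hence "card {t \<in> cube h. q dvd quad_val k t} = card {t \<in> cube h. quad_val k t \<noteq> 0
      \<and> q dvd quad_val k t} + card {t \<in> cube h. quad_val k t = 0}"
    by (simp only:) (rule card_Un_disjoint, auto)
  thus ?thesis by (simp add: count_dvd_nz_eq_card count_dvd_eq_card)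
qed

text \<open>The errors for single \<open>d\<close> are summed over \<open>d \<le> D\<close>. The
  \<open>h^2\<close> terms form a convergent series, so \<open>h^2\<close> appears without loss; the
  remaining terms are at most \<open>D\<close> times their bound at \<open>D\<close>. Discarding the
  points of value 0 costs a constant for each of at most \<open>D\<close> moduli.\<close>

lemma small_moduli_bound:
  fixes k :: int
  assumes "r \<ge> 2" "0 < \<delta>" "\<delta> \<le> 1 / 4"
  defines "\<sigma> \<equiv> (if k \<noteq> 0 \<or> r = 2 then 0 else 1 / 2 :: real)"
  obtains K where "K \<ge> 1" "\<And>h D. D \<ge> 1 \<Longrightarrow>
    \<bar>(\<Sum>A\<in>prime_sets_upto D. (-1) ^ card A * real (count_dvd_nz h (int ((\<Prod>A) ^ r)) k)) -
        (\<Sum>A\<in>prime_sets_upto D. (-1) ^ card A * density r k A) * real h ^ 3\<bar>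
      \<le> K * (real h ^ 2 + D powr (real r + 1 + \<sigma> + \<delta>))"
proof -
  obtain K1 where K1: "K1 \<ge> 1" "\<And>A h. prime_set A \<Longrightarrow>
     \<bar>real (count_dvd h (int ((\<Prod>A) ^ r)) k) - density r k A * real h ^ 3\<bar> \<le>
       K1 * (real (\<Prod>A) powr (1 / 2 - real r + \<delta>) * real h ^ 2 + real (\<Prod>A) powr (real r + \<sigma> + \<delta>))"
    using count_dvd_asymp_powr[OF assms(2,1), of k] unfolding \<sigma>_def by blast
  \<comment> \<open>\<open>r \<ge> 2\<close> and \<open>\<delta> \<le> 1 / 4\<close> give
    \<open>s \<ge> 5 / 4\<close>: convergence survives the loss of \<open>sqrt d\<close>.\<close>
  define s where "s = real r - 1 / 2 - \<delta>"
  have r2: "real r \<ge> 2" using assms by simp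
  have s: "s > 1" using assms r2 unfolding s_def by linarith
  have sig: "\<sigma> \<ge> 0" by (simp add: \<sigma>_def)
  define c where "c = 1 + 2 powr (s - 1) / (s - 1)"
  have c: "c \<ge> 1" using s by (simp add: c_def)
  define Z where "Z = real (nat \<bar>k\<bar> ^ 3)"
  define K where "K = K1 * c + K1 + Z"
  have "K1 * c \<ge> 1 * 1" by (intro mult_mono K1(1) c) (use K1(1) in auto)
  moreover have "Z \<ge> 0" by (simp add: Z_def)
  ultimately have K: "K \<ge> 1" using K1(1) unfolding K_def by linarith
  have "\<bar>(\<Sum>A\<in>prime_sets_upto D. (-1) ^ card A * real (count_dvd_nz h (int ((\<Prod>A) ^ r)) k)) -
      (\<Sum>A\<in>prime_sets_upto D. (-1) ^ card A * density r k A) * real h ^ 3\<bar>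
      \<le> K * (real h ^ 2 + D powr (real r + 1 + \<sigma> + \<delta>))" if D: "D \<ge> 1" for h D
  proof -
    let ?B = "{1..nat \<lfloor>D\<rfloor>}"
    have floorD: "real (nat \<lfloor>D\<rfloor>) \<le> D" using D by simp
    define W where "W = D powr (real r + 1 + \<sigma> + \<delta>)"
    have DW: "D \<le> W"
    proof -
      have "D powr 1 \<le> W" unfolding W_def using D sig assms r2 by (intro powr_mono) auto
      thus ?thesis using D by simp
    qed
    have "\<bar>(\<Sum>A\<in>prime_sets_upto D. (-1) ^ card A * real (count_dvd_nz h (int ((\<Prod>A) ^ r)) k)) -
        (\<Sum>A\<in>prime_sets_upto D. (-1) ^ card A * density r k A) * real h ^ 3\<bar>
       = \<bar>\<Sum>A\<in>prime_sets_upto D. (-1) ^ card A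
           * (real (count_dvd_nz h (int ((\<Prod>A) ^ r)) k) - density r k A * real h ^ 3)\<bar>"
      by (simp only: sum_distrib_right sum_subtractf [symmetric] right_diff_distrib mult.assoc)
    also have "\<dots> \<le> (\<Sum>A\<in>prime_sets_upto D. \<bar>(-1) ^ card A
        * (real (count_dvd_nz h (int ((\<Prod>A) ^ r)) k) - density r k A * real h ^ 3)\<bar>)"
      by (rule sum_abs)
    also have "\<dots> \<le> (\<Sum>A\<in>prime_sets_upto D. K1 * (real (\<Prod>A) powr (- s) * real h ^ 2
        + real (\<Prod>A) powr (real r + \<sigma> + \<delta>)) + Z)"
    proof (rule sum_mono)
      fix A assume "A \<in> prime_sets_upto D"
      hence A: "prime_set A" by (simp add: prime_sets_upto_def)
      have "real (card {t \<in> cube h. quad_val k t = 0}) \<le> Z" unfolding Z_def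
        by (simp only: of_nat_le_iff card_quad_val_zero_le)
      moreover have "\<bar>real (count_dvd h (int ((\<Prod>A) ^ r)) k) - density r k A * real h ^ 3\<bar> \<le>
        K1 * (real (\<Prod>A) powr (- s) * real h ^ 2 + real (\<Prod>A) powr (real r + \<sigma> + \<delta>))"
      proof -
        have "- s = 1 / 2 - real r + \<delta>" by (simp add: s_def)
        thus ?thesis using K1(2)[OF A, of h] by (simp only:)
      qed
      ultimately have "\<bar>real (count_dvd_nz h (int ((\<Prod>A) ^ r)) k) - density r k A * real h ^ 3\<bar> \<le>
        K1 * (real (\<Prod>A) powr (- s) * real h ^ 2 + real (\<Prod>A) powr (real r + \<sigma> + \<delta>)) + Z"
        unfolding count_dvd_nz_eq_minus by linarith
      thus "\<bar>(-1) ^ card A * (real (count_dvd_nz h (int ((\<Prod>A) ^ r)) k) - density r k A * real h ^ 3)\<bar> \<le>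
        K1 * (real (\<Prod>A) powr (- s) * real h ^ 2 + real (\<Prod>A) powr (real r + \<sigma> + \<delta>)) + Z"
        by (simp only: abs_mult power_abs abs_neg_one power_one mult_1)
    qed
    also have "\<dots> = K1 * ((\<Sum>A\<in>prime_sets_upto D. real (\<Prod>A) powr (- s)) * real h ^ 2 +
        (\<Sum>A\<in>prime_sets_upto D. real (\<Prod>A) powr (real r + \<sigma> + \<delta>)))
        + real (card (prime_sets_upto D)) * Z"
      by (simp only: sum.distrib sum_constant sum_distrib_left [symmetric] sum_distrib_right [symmetric])
    also have "\<dots> \<le> K1 * (c * real h ^ 2 + W) + W * Z"
    proof (intro add_mono mult_left_mono mult_right_mono)
      have "(\<Sum>A\<in>prime_sets_upto D. real (\<Prod>A) powr (- s)) \<le> (\<Sum>d\<in>?B. real d powr (- s))"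
        by (rule sum_prime_sets_le) (use Prod_prime_sets_upto in \<open>auto simp: prime_sets_upto_def\<close>)
      also have "\<dots> \<le> c" unfolding c_def by (rule sum_powr_le[OF s]) auto
      finally show "(\<Sum>A\<in>prime_sets_upto D. real (\<Prod>A) powr (- s)) \<le> c" .
      have "(\<Sum>A\<in>prime_sets_upto D. real (\<Prod>A) powr (real r + \<sigma> + \<delta>)) \<le> (\<Sum>d\<in>?B. real d powr (real r + \<sigma> + \<delta>))"
        by (rule sum_prime_sets_le) (use Prod_prime_sets_upto in \<open>auto simp: prime_sets_upto_def\<close>)
      also have "\<dots> \<le> (\<Sum>d\<in>?B. D powr (real r + \<sigma> + \<delta>))"
      proof (rule sum_mono)
        fix d assume d: "d \<in> ?B"
        hence "real d \<le> real (nat \<lfloor>D\<rfloor>)" by (simp only: of_nat_le_iff atLeastAtMost_iff)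
        hence "real d \<le> D" using floorD by linarith
        thus "real d powr (real r + \<sigma> + \<delta>) \<le> D powr (real r + \<sigma> + \<delta>)" using sig assms
            by (intro powr_mono2) auto
      qed
      also have "\<dots> = real (nat \<lfloor>D\<rfloor>) * D powr (real r + \<sigma> + \<delta>)" by simp
      also have "\<dots> \<le> D powr 1 * D powr (real r + \<sigma> + \<delta>)" using floorD D by (intro mult_right_mono) auto
      also have "\<dots> = W" unfolding W_def powr_add [symmetric] by (simp add: add_ac)
      finally show "(\<Sum>A\<in>prime_sets_upto D. real (\<Prod>A) powr (real r + \<sigma> + \<delta>)) \<le> W" .
      show "real (card (prime_sets_upto D)) \<le> W" using card_prime_sets_upto_le[of D] D DW by linarith
    qed (use K1 in \<open>auto simp: Z_def\<close>)
    also have "\<dots> \<le> K * (real h ^ 2 + W)"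
    proof -
      have "0 \<le> W" using D DW by linarith
      thus ?thesis using K1(1) c by (simp add: K_def Z_def algebra_simps)
    qed
    finally show ?thesis by (simp only: W_def)
  qed
  thus thesis using that K by blast
qed

text \<open>Because \<open>d > D \<ge> \<bar>k\<bar>\<close>, the modulus exceeds
  \<open>\<bar>k\<bar>\<close> and, up to a constant, at most
  \<open>h powr (3 + \<delta>) / d^r\<close> points are counted for it. The tail over
  \<open>d\<close> gives \<open>D powr (1 - r)\<close>, uniformly in \<open>N\<close>.\<close>

lemma large_moduli_bound:
  assumes "r \<ge> 2" "0 < \<delta>"
  obtains K where "K \<ge> 1" "\<And>h D N. D \<ge> 1 \<Longrightarrow> D \<ge> \<bar>real_of_int k\<bar> \<Longrightarrow> h \<ge> 1 \<Longrightarrow>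
    (\<Sum>A\<in>Pow (primes_upto N) - prime_sets_upto D. real (count_dvd_nz h (int ((\<Prod>A) ^ r)) k)) \<le> K
        * (real h powr (3 + \<delta>) * D powr (1 - real r))"
proof -
  \<comment> \<open>The divisor function is squared in the count of two squares representations, and
    its argument is at most \<open>2 * h^2\<close>; so \<open>\<delta> / 4\<close> here becomes
    \<open>h powr \<delta>\<close>.\<close>
  obtain K0 where K0: "K0 \<ge> 1" "\<And>n::int. n > 0 \<Longrightarrow> real (card (pdivs n)) \<le> K0 * real_of_int n powr (\<delta> / 4)"
    using card_pdivs_powr[of "\<delta> / 4"] assms by auto
  have sum2sq: "real (card (sum2sq n)) \<le> K0 ^ 2 * real_of_int n powr (\<delta> / 2)" if "n > 0" for n
  proof -
    have "real (card (sum2sq n)) \<le> real (card (pdivs n) ^ 2)" using card_sum2sq_le[OF that]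
        by (simp only: of_nat_le_iff)
    also have "\<dots> = real (card (pdivs n)) ^ 2" by simp
    also have "\<dots> \<le> (K0 * real_of_int n powr (\<delta> / 4)) ^ 2" using K0(2)[OF that] by (intro power_mono) auto
    also have "\<dots> = K0 ^ 2 * (real_of_int n powr (\<delta> / 4) * real_of_int n powr (\<delta> / 4))"
      by (simp add: power2_eq_square)
    also have "real_of_int n powr (\<delta> / 4) * real_of_int n powr (\<delta> / 4) = real_of_int n powr (\<delta> / 2)"
      by (simp flip: powr_add)
    finally show ?thesis .
  qed
  define s where "s = real r"
  have s: "s > 1" using assms by (simp add: s_def)
  define K where "K = (3 + \<bar>real_of_int k\<bar>) * (K0 ^ 2 * 2 powr (\<delta> / 2)) * (1 + 2 powr (s - 1) / (s - 1))"
  have K1: "1 \<le> K0 ^ 2 * 2 powr (\<delta> / 2)"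
    using mult_mono[of 1 "K0 ^ 2" 1 "2 powr (\<delta> / 2)"] K0(1) assms
        by (simp add: one_le_power ge_one_powr_ge_zero)
  have "1 * 1 * 1 \<le> K" unfolding K_def
    by (intro mult_mono) (use K1 s in auto)
  hence K: "K \<ge> 1" by simp
  have "(\<Sum>A\<in>Pow (primes_upto N) - prime_sets_upto D. real (count_dvd_nz h (int ((\<Prod>A) ^ r)) k)) \<le> K
      * (real h powr (3 + \<delta>) * D powr (1 - real r))"
    if D: "D \<ge> 1" "D \<ge> \<bar>real_of_int k\<bar>" and h: "h \<ge> 1" for h D N
  proof -
    define X where "X = (3 + \<bar>real_of_int k\<bar>) * (K0 ^ 2 * 2 powr (\<delta> / 2)) * real h powr (3 + \<delta>)"
    have X: "X \<ge> 0" by (simp add: X_def)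
    have "(\<Sum>A\<in>Pow (primes_upto N) - prime_sets_upto D. real (count_dvd_nz h (int ((\<Prod>A) ^ r)) k)) \<le>
        (\<Sum>A\<in>Pow (primes_upto N) - prime_sets_upto D. X * real (\<Prod>A) powr (- s))"
    proof (rule sum_mono)
      fix A assume A: "A \<in> Pow (primes_upto N) - prime_sets_upto D"
      define d where "d = \<Prod>A"
      have dD: "real d > D" using A prime_set_Pow_primes_upto[of A N]
          by (auto simp: prime_sets_upto_def d_def simp del: of_nat_prod)
      have "d \<ge> 1" using dD D by linarith
      hence "d ^ 1 \<le> d ^ r" using assms by (intro power_increasing) auto
      moreover have "real_of_int \<bar>k\<bar> < real_of_int (int d)" using dD D by simp
      hence "\<bar>k\<bar> < int d" by (simp only: of_int_less_iff)
      ultimately have qk: "int (d ^ r) > \<bar>k\<bar>" by (metis less_le_trans of_nat_le_iff power_one_right)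
      have "real (count_dvd_nz h (int (d ^ r)) k) \<le> real h * ((3 * real h ^ 2
          + \<bar>real_of_int k\<bar>) / real_of_int (int (d ^ r))) *
         (K0 ^ 2 * (2 * real h ^ 2) powr (\<delta> / 2))"
        by (rule count_dvd_nz_le) (use sum2sq assms qk in auto)
      also have "\<dots> \<le> real h * (((3 + \<bar>real_of_int k\<bar>) * real h ^ 2) / real_of_int (int (d ^ r))) *
         (K0 ^ 2 * (2 * real h ^ 2) powr (\<delta> / 2))"
      proof (intro mult_right_mono mult_left_mono divide_right_mono)
        have "\<bar>real_of_int k\<bar> * 1 \<le> \<bar>real_of_int k\<bar> * real h ^ 2" using h by (intro mult_left_mono) auto
        thus "3 * real h ^ 2 + \<bar>real_of_int k\<bar> \<le> (3 + \<bar>real_of_int k\<bar>) * real h ^ 2"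
            by (simp add: algebra_simps)
      qed auto
      also have "(2 * real h ^ 2) powr (\<delta> / 2) = 2 powr (\<delta> / 2) * real h powr \<delta>"
        using h by (simp add: powr_mult powr_powr flip: powr_numeral)
      also have "real h * (((3 + \<bar>real_of_int k\<bar>) * real h ^ 2) / real_of_int (int (d ^ r))) *
         (K0 ^ 2 * (2 powr (\<delta> / 2) * real h powr \<delta>)) = X * real d powr (- s)"
      proof -
        have "real d powr (- s) = 1 / real_of_int (int (d ^ r))" using \<open>d \<ge> 1\<close>
          by (simp add: s_def powr_minus powr_realpow divide_inverse)
        moreover have "real h powr (3 + \<delta>) = real h * real h ^ 2 * real h powr \<delta>"
          using h by (simp add: powr_add power3_eq_cube power2_eq_square)
        ultimately show ?thesis by (simp add: X_def)
      qed
      finally show "real (count_dvd_nz h (int ((\<Prod>A) ^ r)) k) \<le> X * real (\<Prod>A) powr (- s)"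
          by (simp only: d_def)
    qed
    also have "\<dots> = X * (\<Sum>A\<in>Pow (primes_upto N) - prime_sets_upto D. real (\<Prod>A) powr (- s))"
        by (simp only: sum_distrib_left)
    also have "\<dots> \<le> X * (2 powr (s - 1) / (s - 1) * D powr (1 - s))"
      by (intro mult_left_mono sum_powr_outside_le s D X)
    also have "\<dots> \<le> X * ((1 + 2 powr (s - 1) / (s - 1)) * D powr (1 - s))"
      by (intro mult_left_mono mult_right_mono X) auto
    also have "\<dots> = K * (real h powr (3 + \<delta>) * D powr (1 - real r))"
      by (simp add: X_def K_def s_def)
    finally show ?thesis .
  qed
  thus thesis using that K by blast
qed

section \<open>Assembling the error terms and choosing the cut-off\<close>

lemma R_asymp_param:
  fixes k :: int
  assumes "r \<ge> 2" "0 < \<delta>" "\<delta> \<le> 1 / 4"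
  defines "\<sigma> \<equiv> (if k \<noteq> 0 \<or> r = 2 then 0 else 1 / 2 :: real)"
  obtains K where "K \<ge> 1" "\<And>h D. D \<ge> 1 \<Longrightarrow> D \<ge> \<bar>real_of_int k\<bar> \<Longrightarrow> h \<ge> 1 \<Longrightarrow>
    \<bar>real (card {t \<in> cube h. r_free r (quad_val k t)}) - (\<Prod>p. local_factor r k p) * real h ^ 3\<bar> \<le>
     K * (real h ^ 2 + D powr (real r + 1 + \<sigma> + \<delta>) + real h powr (3 + \<delta>) * D powr (1 - real r)
        + real h ^ 3 * D powr (1 - real r + \<delta>))"
proof -
  obtain K1 where K1: "K1 \<ge> 1" "\<And>h D. D \<ge> 1 \<Longrightarrow>
    \<bar>(\<Sum>A\<in>prime_sets_upto D. (-1) ^ card A * real (count_dvd_nz h (int ((\<Prod>A) ^ r)) k)) -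
        (\<Sum>A\<in>prime_sets_upto D. (-1) ^ card A * density r k A) * real h ^ 3\<bar>
      \<le> K1 * (real h ^ 2 + D powr (real r + 1 + \<sigma> + \<delta>))"
    using small_moduli_bound[OF assms(1-3), of k] unfolding \<sigma>_def by blast
  obtain K2 where K2: "K2 \<ge> 1" "\<And>h D N. D \<ge> 1 \<Longrightarrow> D \<ge> \<bar>real_of_int k\<bar> \<Longrightarrow> h \<ge> 1 \<Longrightarrow>
    (\<Sum>A\<in>Pow (primes_upto N) - prime_sets_upto D. real (count_dvd_nz h (int ((\<Prod>A) ^ r)) k)) \<le> K2
        * (real h powr (3 + \<delta>) * D powr (1 - real r))"
    using large_moduli_bound[OF assms(1,2), of k] by blast
  obtain K3 where K3: "K3 \<ge> 1" "\<And>D. D \<ge> 1 \<Longrightarrow>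
    \<bar>(\<Sum>A\<in>prime_sets_upto D. (-1) ^ card A * density r k A) - (\<Prod>p. local_factor r k p)\<bar> \<le> K3
        * D powr (1 - real r + \<delta>)"
    using euler_product_truncation[OF assms(1-3), of k] by blast
  define K where "K = K1 + K2 + K3"
  have "\<bar>real (card {t \<in> cube h. r_free r (quad_val k t)}) - (\<Prod>p. local_factor r k p) * real h ^ 3\<bar> \<le>
     K * (real h ^ 2 + D powr (real r + 1 + \<sigma> + \<delta>) + real h powr (3 + \<delta>) * D powr (1 - real r)
        + real h ^ 3 * D powr (1 - real r + \<delta>))"
    if D: "D \<ge> 1" "D \<ge> \<bar>real_of_int k\<bar>" and h: "h \<ge> 1" for h D
  proof -
    \<comment> \<open>\<open>N\<close> only has to be large enough for the sieve identity and for
      the inclusion of the truncated family; no bound depends on it.\<close>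
    define N where "N = max (3 * h ^ 2 + nat \<bar>k\<bar>) (nat \<lceil>D\<rceil>)"
    have N: "3 * h ^ 2 + nat \<bar>k\<bar> \<le> N" by (simp add: N_def)
    have "nat \<lceil>D\<rceil> \<le> N" by (simp add: N_def)
    hence DN: "D \<le> real N" by linarith
    let ?n = "\<lambda>A. real (count_dvd_nz h (int ((\<Prod>A) ^ r)) k)"
    define M where "M = (\<Sum>A\<in>prime_sets_upto D. (-1) ^ card A * density r k A)"
    define a where "a = real h ^ 2 + D powr (real r + 1 + \<sigma> + \<delta>)"
    define b where "b = real h powr (3 + \<delta>) * D powr (1 - real r)"
    define c where "c = real h ^ 3 * D powr (1 - real r + \<delta>)"
    have pos: "a \<ge> 0" "b \<ge> 0" "c \<ge> 0" by (auto simp: a_def b_def c_def)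
    have eq: "real (card {t \<in> cube h. r_free r (quad_val k t)}) =
       (\<Sum>A\<in>Pow (primes_upto N) - prime_sets_upto D. (-1) ^ card A * ?n A) + (\<Sum>A\<in>prime_sets_upto D.
           (-1) ^ card A * ?n A)"
      using card_r_free_eq[of r h k N] N assms(1) sum.subset_diff[OF prime_sets_upto_subset[OF DN], of
          "\<lambda>A. (-1) ^ card A * ?n A"] by simp
    have 1: "\<bar>(\<Sum>A\<in>prime_sets_upto D. (-1) ^ card A * ?n A) - M * real h ^ 3\<bar> \<le> K1 * a"
      unfolding M_def a_def by (rule K1(2)[OF D(1)])
    have "\<bar>\<Sum>A\<in>Pow (primes_upto N) - prime_sets_upto D. (-1) ^ card A * ?n A\<bar> \<le>
        (\<Sum>A\<in>Pow (primes_upto N) - prime_sets_upto D. \<bar>(-1) ^ card A * ?n A\<bar>)"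
      by (rule sum_abs)
    also have "\<dots> = (\<Sum>A\<in>Pow (primes_upto N) - prime_sets_upto D. ?n A)"
      by (intro sum.cong refl) (simp only: abs_mult power_abs abs_neg_one power_one mult_1 abs_of_nat)
    also have "\<dots> \<le> K2 * b" unfolding b_def by (rule K2(2)[OF D h])
    finally have 2: "\<bar>\<Sum>A\<in>Pow (primes_upto N) - prime_sets_upto D. (-1) ^ card A * ?n A\<bar> \<le> K2 * b" .
    have "\<bar>M * real h ^ 3 - (\<Prod>p. local_factor r k p) * real h ^ 3\<bar> = real h ^ 3 * \<bar>M - (\<Prod>p.
        local_factor r k p)\<bar>"
      by (simp add: abs_mult flip: left_diff_distrib)
    also have "\<dots> \<le> real h ^ 3 * (K3 * D powr (1 - real r + \<delta>))"
      unfolding M_def by (intro mult_left_mono K3(2) D) auto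
    also have "\<dots> = K3 * c" by (simp add: c_def)
    finally have 3: "\<bar>M * real h ^ 3 - (\<Prod>p. local_factor r k p) * real h ^ 3\<bar> \<le> K3 * c" .
    have "\<bar>real (card {t \<in> cube h. r_free r (quad_val k t)}) - (\<Prod>p. local_factor r k p) * real h ^ 3\<bar>
        \<le> K1 * a + K2 * b + K3 * c"
      using 1 2 3 unfolding eq by linarith
    also have "\<dots> \<le> K * a + K * b + K * c"
      using pos K1(1) K2(1) K3(1) by (intro add_mono mult_right_mono) (auto simp: K_def)
    finally show ?thesis by (simp add: a_def b_def c_def algebra_simps)
  qed
  moreover have "K \<ge> 1" using K1 K2 K3 by (simp add: K_def)
  ultimately show thesis using that by blast
qed

text \<open>The cut-off between small and large moduli is \<open>D = H powr \<theta>\<close>.\<close>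

lemma R_asymp_exponent:
  fixes k :: int
  assumes "r \<ge> 2" "0 < \<delta>" "\<delta> \<le> 1 / 4" "0 < \<theta>" "\<theta> \<le> 1"
  defines "\<sigma> \<equiv> (if k \<noteq> 0 \<or> r = 2 then 0 else 1 / 2 :: real)"
  shows "(\<lambda>H. real (R H r k) - (\<Prod>p. local_factor r k p) * H ^ 3) \<in>
    O[at_top](\<lambda>H. H ^ 2 + H powr (\<theta> * (real r + 1 + \<sigma>) + \<delta>) + H powr (3 - \<theta> * (real r - 1) + \<delta>))"
proof -
  obtain K where K: "K \<ge> 1" "\<And>h D. D \<ge> 1 \<Longrightarrow> D \<ge> \<bar>real_of_int k\<bar> \<Longrightarrow> h \<ge> 1 \<Longrightarrow>
    \<bar>real (card {t \<in> cube h. r_free r (quad_val k t)}) - (\<Prod>p. local_factor r k p) * real h ^ 3\<bar> \<le>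
     K * (real h ^ 2 + D powr (real r + 1 + \<sigma> + \<delta>) + real h powr (3 + \<delta>) * D powr (1 - real r)
        + real h ^ 3 * D powr (1 - real r + \<delta>))"
    using R_asymp_param[OF assms(1-3), of k] unfolding \<sigma>_def by blast
  define P where "P = \<bar>\<Prod>p. local_factor r k p\<bar>"
  define H0 where "H0 = max 1 (\<bar>real_of_int k\<bar> powr (1 / \<theta>))"
  show ?thesis
  proof (rule bigoI[of _ "2 * K + 3 * P"], rule eventually_mono[OF eventually_ge_at_top[of H0]])
    fix H assume "H \<ge> H0"
    hence H: "H \<ge> 1" "H \<ge> \<bar>real_of_int k\<bar> powr (1 / \<theta>)" by (auto simp: H0_def)
    define h where "h = nat \<lfloor>H\<rfloor>"
    have h: "h \<ge> 1" "real h \<le> H" "H - 1 \<le> real h" using H(1) unfolding h_def by linarith+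
    define D where "D = H powr \<theta>"
    have D1: "D \<ge> 1" unfolding D_def using H assms by (intro ge_one_powr_ge_zero) auto
    have Dk: "D \<ge> \<bar>real_of_int k\<bar>"
    proof -
      have "(\<bar>real_of_int k\<bar> powr (1 / \<theta>)) powr \<theta> \<le> D" unfolding D_def using H assms
          by (intro powr_mono2) auto
      thus ?thesis using assms by (simp add: powr_powr)
    qed
    define a b c where "a = H ^ 2" and "b = H powr (\<theta> * (real r + 1 + \<sigma>) + \<delta>)" and "c = H powr (3 - \<theta>
        * (real r - 1) + \<delta>)"
    have pos: "a \<ge> 0" "b \<ge> 0" "c \<ge> 0" by (auto simp: a_def b_def c_def)
    have \<theta>\<delta>: "\<theta> * \<delta> \<le> \<delta>" using assms by simp
    have h2: "real h ^ 2 \<le> a" unfolding a_def using h by (intro power_mono) auto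
    have t1: "D powr (real r + 1 + \<sigma> + \<delta>) \<le> b"
    proof -
      have "D powr (real r + 1 + \<sigma> + \<delta>) = H powr (\<theta> * (real r + 1 + \<sigma>) + \<theta> * \<delta>)"
        by (simp add: D_def powr_powr algebra_simps)
      also have "\<dots> \<le> b" unfolding b_def using H \<theta>\<delta> by (intro powr_mono) auto
      finally show ?thesis .
    qed
    have t2: "real h powr (3 + \<delta>) * D powr (1 - real r) \<le> c"
    proof -
      have "real h powr (3 + \<delta>) * D powr (1 - real r) \<le> H powr (3 + \<delta>) * D powr (1 - real r)"
        using h assms by (intro mult_right_mono powr_mono2) auto
      also have "\<dots> = c" by (simp add: c_def D_def powr_powr algebra_simps flip: powr_add)
      finally show ?thesis .
    qed
    have t3: "real h ^ 3 * D powr (1 - real r + \<delta>) \<le> c"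
    proof -
      have "real h ^ 3 * D powr (1 - real r + \<delta>) \<le> H ^ 3 * D powr (1 - real r + \<delta>)"
        using h by (intro mult_right_mono power_mono) auto
      also have "\<dots> = H powr 3 * H powr (\<theta> * (1 - real r + \<delta>))" using H by (simp add: D_def powr_powr)
      also have "\<dots> = H powr (3 - \<theta> * (real r - 1) + \<theta> * \<delta>)" by (simp add: algebra_simps flip: powr_add)
      also have "\<dots> \<le> c" unfolding c_def using H \<theta>\<delta> by (intro powr_mono) auto
      finally show ?thesis .
    qed
    have "K * (real h ^ 2 + D powr (real r + 1 + \<sigma> + \<delta>) + real h powr (3 + \<delta>) * D powr (1 - real r)
        + real h ^ 3 * D powr (1 - real r + \<delta>)) \<le> K * (a + b + c + c)"
      using K(1) h2 t1 t2 t3 by (intro mult_left_mono add_mono) auto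
    also have "\<dots> \<le> K * (2 * (a + b + c))" using K(1) pos by (intro mult_left_mono) auto
    finally have le: "K * (real h ^ 2 + D powr (real r + 1 + \<sigma> + \<delta>) + real h powr (3 + \<delta>)
        * D powr (1 - real r)
        + real h ^ 3 * D powr (1 - real r + \<delta>)) \<le> 2 * K * (a + b + c)" by (simp only: mult_ac)
    have 1: "\<bar>real (R H r k) - (\<Prod>p. local_factor r k p) * real h ^ 3\<bar> \<le> 2 * K * (a + b + c)"
    proof -
      have "R H r k = card {t \<in> cube h. r_free r (quad_val k t)}" unfolding h_def using H(1)
          by (intro R_eq_card) simp
      thus ?thesis using K(2)[OF D1 Dk h(1)] le by linarith
    qed
    \<comment> \<open>Replacing the integer part \<open>h\<close> by \<open>H\<close> in the main
      term changes it by a multiple of \<open>H^2\<close>, which the error term covers.\<close>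
    have cube: "\<bar>real h ^ 3 - H ^ 3\<bar> \<le> 3 * a"
    proof -
      have "H ^ 3 - real h ^ 3 = (H - real h) * (H^2 + H * real h + real h ^ 2)" by algebra
      also have "\<dots> \<le> 1 * (H^2 + H * H + H ^ 2)"
        using h H by (intro mult_mono add_mono mult_left_mono power_mono) auto
      finally have "H ^ 3 - real h ^ 3 \<le> 3 * a" by (simp add: a_def power2_eq_square)
      moreover have "real h ^ 3 \<le> H ^ 3" using h by (intro power_mono) auto
      ultimately show ?thesis using pos by linarith
    qed
    have 2: "\<bar>(\<Prod>p. local_factor r k p) * real h ^ 3 - (\<Prod>p. local_factor r k p) * H ^ 3\<bar> \<le> P * (3 * a)"
      unfolding right_diff_distrib [symmetric] abs_mult P_def using cube by (intro mult_left_mono) auto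
    have "P * (3 * a) \<le> P * (3 * (a + b + c))" using pos by (intro mult_left_mono) (auto simp: P_def)
    hence "\<bar>real (R H r k) - (\<Prod>p. local_factor r k p) * H ^ 3\<bar> \<le> 2 * K * (a + b + c) + 3 * P * (a + b + c)"
      using 1 2 by linarith
    thus "norm (real (R H r k) - (\<Prod>p. local_factor r k p) * H ^ 3) \<le> (2 * K + 3 * P) *
      norm (H ^ 2 + H powr (\<theta> * (real r + 1 + \<sigma>) + \<delta>) + H powr (3 - \<theta> * (real r - 1) + \<delta>))"
      using pos unfolding a_def b_def c_def by (simp add: algebra_simps)
  qed
qed

theorem theorem1p1:
  fixes r :: nat and k :: int and \<epsilon> :: real
  assumes "r \<ge> 2" and "\<epsilon> > 0"
  shows "(k \<noteq> 0 \<longrightarrow>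
            convergent_prod (local_factor r k) \<and>
            (\<lambda>H. real (R H r k) - (\<Prod>p. local_factor r k p) * H ^ 3)
              \<in> O[at_top](\<lambda>H. H ^ 2 + H powr (3 / 2 + 3 / (2 * real r) + \<epsilon>))) \<and>
         (k = 0 \<longrightarrow>
            convergent_prod (local_factor r 0) \<and>
            (\<lambda>H. real (R H r 0) - (\<Prod>p. local_factor r 0 p) * H ^ 3)
              \<in> O[at_top](\<lambda>H. H powr (2 + \<epsilon>) + H powr (9 * real r / (5 * real r - 2) + \<epsilon>)))"
proof -
  define \<delta> where "\<delta> = min \<epsilon> (1 / 4)"
  have \<delta>: "0 < \<delta>" "\<delta> \<le> 1 / 4" "\<delta> \<le> \<epsilon>" using assms by (auto simp: \<delta>_def)
  have r: "real r \<ge> 2" using assms by simp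
  have "(\<lambda>H. real (R H r k) - (\<Prod>p. local_factor r k p) * H ^ 3)
     \<in> O[at_top](\<lambda>H. H ^ 2 + H powr (3 / 2 + 3 / (2 * real r) + \<epsilon>))" if k: "k \<noteq> 0"
  proof -
    \<comment> \<open>The solution of \<open>\<theta> * (r + 1) = 3 - \<theta> * (r - 1)\<close>:
      small and large moduli contribute equally.\<close>
    define \<theta> where "\<theta> = 3 / (2 * real r)"
    have \<theta>: "0 < \<theta>" "\<theta> \<le> 1" using r by (auto simp: \<theta>_def)
    have e: "\<theta> * (real r + 1 + 0) = 3 / 2 + 3 / (2 * real r)" "3 - \<theta> * (real r - 1) = 3 / 2 + 3 / (2
        * real r)"
      using r by (auto simp: \<theta>_def field_simps)
    have "(\<lambda>H. real (R H r k) - (\<Prod>p. local_factor r k p) * H ^ 3) \<in>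
      O[at_top](\<lambda>H. H ^ 2 + H powr (\<theta> * (real r + 1 + (if k \<noteq> 0 \<or> r = 2 then 0 else 1 / 2)) + \<delta>) +
         H powr (3 - \<theta> * (real r - 1) + \<delta>))"
      by (rule R_asymp_exponent[OF assms(1) \<delta>(1,2) \<theta>])
    also have "(\<lambda>H. H ^ 2 + H powr (\<theta> * (real r + 1 + (if k \<noteq> 0 \<or> r = 2 then 0 else 1 / 2)) + \<delta>) +
         H powr (3 - \<theta> * (real r - 1) + \<delta>)) \<in> O[at_top](\<lambda>H. H ^ 2 + H powr (3 / 2 + 3 / (2 * real r) + \<epsilon>))"
    proof (rule bigoI[of _ 2], rule eventually_mono[OF eventually_ge_at_top[of 1]])
      fix H :: real assume H: "H \<ge> 1"
      define X Y Y' where "X = H ^ 2" and "Y = H powr (3 / 2 + 3 / (2 * real r) + \<delta>)" and "Y'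
          = H powr (3 / 2 + 3 / (2 * real r) + \<epsilon>)"
      have "Y \<le> Y'" unfolding Y_def Y'_def using H \<delta> by (intro powr_mono) auto
      moreover have "X \<ge> 0" "Y \<ge> 0" "Y' \<ge> 0" by (auto simp: X_def Y_def Y'_def)
      ultimately have "norm (X + Y + Y) \<le> 2 * norm (X + Y')"
        by simp
      moreover have "(if k \<noteq> 0 \<or> r = 2 then 0 else 1 / 2 :: real) = 0" using k by simp
      ultimately show "norm (H ^ 2 + H powr (\<theta> * (real r + 1 + (if k \<noteq> 0 \<or> r = 2 then 0 else 1 / 2)) + \<delta>) +
         H powr (3 - \<theta> * (real r - 1) + \<delta>)) \<le> 2 * norm (H ^ 2 + H powr (3 / 2 + 3 / (2 * real r) + \<epsilon>))"
        by (simp only: e X_def Y_def Y'_def)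
    qed
    finally show ?thesis .
  qed
  moreover have "(\<lambda>H. real (R H r 0) - (\<Prod>p. local_factor r 0 p) * H ^ 3)
     \<in> O[at_top](\<lambda>H. H powr (2 + \<epsilon>) + H powr (9 * real r / (5 * real r - 2) + \<epsilon>))"
  proof -
    \<comment> \<open>Chosen so that the large moduli contribute exactly the exponent
      \<open>\<alpha>\<close>.\<close>
    define \<theta> where "\<theta> = 6 / (5 * real r - 2)"
    define \<sigma> :: real where "\<sigma> = (if (0::int) \<noteq> 0 \<or> r = 2 then 0 else 1 / 2)"
    define \<alpha> where "\<alpha> = 9 * real r / (5 * real r - 2)"
    have \<theta>: "0 < \<theta>" "\<theta> \<le> 1" using r by (auto simp: \<theta>_def)
    have e2: "3 - \<theta> * (real r - 1) = \<alpha>"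
      using r by (simp add: \<theta>_def \<alpha>_def field_simps)
    \<comment> \<open>For \<open>r = 2\<close> and \<open>r = 3\<close> the small moduli also give
      exactly \<open>\<alpha>\<close>, for \<open>r = 2\<close> thanks to
      \<open>\<sigma> = 0\<close>. For \<open>r \<ge> 4\<close> they stay within the exponent
      2.\<close>
    have e1: "\<theta> * (real r + 1 + \<sigma>) \<le> 2 \<or> \<theta> * (real r + 1 + \<sigma>) \<le> \<alpha>"
    proof -
      consider "r = 2" | "r = 3" | "r \<ge> 4" using assms(1) by linarith
      thus ?thesis
      proof cases
        case 3
        hence "real r \<ge> 4" by simp
        hence "\<theta> * (real r + 1 + \<sigma>) \<le> 2" by (simp add: \<theta>_def \<sigma>_def field_simps)
        thus ?thesis ..
      qed (auto simp: \<theta>_def \<sigma>_def \<alpha>_def)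
    qed
    have "(\<lambda>H. real (R H r 0) - (\<Prod>p. local_factor r 0 p) * H ^ 3) \<in>
      O[at_top](\<lambda>H. H ^ 2 + H powr (\<theta> * (real r + 1 + \<sigma>) + \<delta>) + H powr (3 - \<theta> * (real r - 1) + \<delta>))"
      unfolding \<sigma>_def by (rule R_asymp_exponent[OF assms(1) \<delta>(1,2) \<theta>])
    also have "(\<lambda>H. H ^ 2 + H powr (\<theta> * (real r + 1 + \<sigma>) + \<delta>) + H powr (3 - \<theta> * (real r - 1) + \<delta>))
       \<in> O[at_top](\<lambda>H. H powr (2 + \<epsilon>) + H powr (\<alpha> + \<epsilon>))"
    proof (rule bigoI[of _ 3], rule eventually_mono[OF eventually_ge_at_top[of 1]])
      fix H :: real assume H: "H \<ge> 1"
      have "H ^ 2 = H powr 2" using H by simp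
      also have "\<dots> \<le> H powr (2 + \<epsilon>)" using H assms by (intro powr_mono) auto
      finally have 1: "H ^ 2 \<le> H powr (2 + \<epsilon>)" .
      have 2: "H powr (\<alpha> + \<delta>) \<le> H powr (\<alpha> + \<epsilon>)" using H \<delta> by (intro powr_mono) auto
      have 3: "H powr (\<theta> * (real r + 1 + \<sigma>) + \<delta>) \<le> H powr (2 + \<epsilon>) + H powr (\<alpha> + \<epsilon>)"
        using e1
      proof
        assume "\<theta> * (real r + 1 + \<sigma>) \<le> 2"
        hence "H powr (\<theta> * (real r + 1 + \<sigma>) + \<delta>) \<le> H powr (2 + \<epsilon>)" using H \<delta> by (intro powr_mono) auto
        thus ?thesis by (simp add: add_increasing2)
      next
        assume "\<theta> * (real r + 1 + \<sigma>) \<le> \<alpha>"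
        hence "H powr (\<theta> * (real r + 1 + \<sigma>) + \<delta>) \<le> H powr (\<alpha> + \<epsilon>)" using H \<delta> by (intro powr_mono) auto
        thus ?thesis by (simp add: add_increasing)
      qed
      have sum3: "a + y + c \<le> 3 * (A + B)"
        if "a \<le> A" "y \<le> A + B" "c \<le> B" "0 \<le> A" "0 \<le> B" for a y c A B :: real
        using that unfolding distrib_left by linarith
      have nn: "H ^ 2 \<ge> 0" "H powr x \<ge> 0" for x by auto
      show "norm (H ^ 2 + H powr (\<theta> * (real r + 1 + \<sigma>) + \<delta>) + H powr (3 - \<theta> * (real r - 1) + \<delta>))
        \<le> 3 * norm (H powr (2 + \<epsilon>) + H powr (\<alpha> + \<epsilon>))"
      proof -
        have "H ^ 2 + H powr (\<theta> * (real r + 1 + \<sigma>) + \<delta>) + H powr (\<alpha> + \<delta>) \<le> 3 * (H powr (2 + \<epsilon>)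
            + H powr (\<alpha> + \<epsilon>))"
          using sum3[OF 1 3 2 nn(2) nn(2)] .
        thus ?thesis by (simp add: e2)
      qed
    qed
    finally show ?thesis by (simp add: \<alpha>_def)
  qed
  ultimately show ?thesis using convergent_prod_local_factor[OF assms(1)] by blast
qed

end
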